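(* Suppose $\mu\vdash n-1$ is an isoclinic partition with $m$ distinct parts. Enumerate $\lfloor\mu\rfloor=\{(k_1,l_1),\dots,(k_m,l_m)\}$ so that $l_1-k_1>l_2-k_2>\dots>l_m-k_m$, and $\mu^\uparrow=\{\lambda_1,\dots,\lambda_{m+1}\}$ so that the superdiagonal indices of the boxes $\lambda_1-\mu,\dots,\lambda_{m+1}-\mu$ are strictly decreasing. Then: (a) there are exactly two nonempty proper subsets $L\subset\mu^\uparrow$ for which $\mathcal{W}_L$ is equi-isoclinic, namely $L_0:=\{\lambda_p:p\in[m+1]\text{ even}\}$ and $L_1:=\{\lambda_p:p\in[m+1]\text{ odd}\}$; (b) for $\delta\in\{0,1\}$, if $\frac{n^2d_\mu^2}{d_{L_\delta}^2}\beta^2$ (with $\beta\ge0$) is the common isoclinism parameter of $\mathcal{W}_{L_\delta}$, then \[\sum_{\lambda\in L_\delta}\frac{d_\lambda}{nd_\mu}\cdot\frac{1}{D(\lambda-\mu,(k_q,l_q))}=(-1)^{q+\delta}\beta\qquad\text{for all }q\in[m].\]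
   Context: Partitions $\lambda\vdash n$: nonincreasing positive integers summing to $n$; the number of distinct parts is the number of distinct values. Young diagram boxes $(i,j)$ with $j\le\lambda_i$; box $(i,j)$ lies on superdiagonal $j-i$; axial distance $D((i,j),(k,l))=(j-i)-(l-k)$. For $\mu\vdash n-1$: a box is removable if deleting it leaves a Young diagram, $\lfloor\mu\rfloor$ is the set of removable boxes; $\mu^\uparrow$ is the set of $\lambda\vdash n$ obtained by adding one box, $\lambda-\mu$ being the added box. $\operatorname{Tab}(\lambda)$: standard tableaux (bijective fillings with $1,\dots,n$ increasing along rows and down columns), $d_\lambda=|\operatorname{Tab}(\lambda)|$; $V_\lambda$ the real Hilbert space with orthonormal basis $\{v_T\}$; $\pi_\lambda$ Young's orthogonal form, $\pi_\lambda(s_k)v_T=\frac1{D_T(k+1,k)}v_T+\sqrt{1-\frac1{D_T(k+1,k)^2}}v_{s_kT}$ with $s_k=(k\ k{+}1)$ acting on entries and $D_T(a,b)$ the axial distance from the box of $a$ to the box of $b$. For $R\in\operatorname{Tab}(\mu)$, $R^\lambda$ puts $n$ in box $\lambda-\mu$; $\Psi_{\lambda,\mu}v_R=v_{R^\lambda}$. For $L\subseteq\mu^\uparrow$: $V_L=\bigoplus_{\lambda\in L}V_\lambda$, $\pi_L=\bigoplus\pi_\lambda$, $d_L=\sum_{\lambda\in L}d_\lambda$, $W_L$ the image of $\Psi_L(v)=\{\sqrt{d_\lambda/d_L}\Psi_{\lambda,\mu}v\}_{\lambda\in L}$, $\mathcal{W}_L=\{\pi_L(t_k)W_L\}_{k\in[n]}$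 for $t_k\in S_n$ with $t_k(n)=k$. Equi-isoclinic with parameter $\alpha$: for isometries $\Phi_k$ onto the members, $(\Phi_k^*\Phi_\ell)^*(\Phi_k^*\Phi_\ell)=\alpha I$ for all $k\ne\ell$. $\mu$ is isoclinic if some nonempty proper $L\subset\mu^\uparrow$ makes $\mathcal{W}_L$ equi-isoclinic. *)

theory Defs
  imports Complex_Main "HOL-Combinatorics.Permutations"
begin

text \<open>The Hilbert space with orthonormal basis labelled by a finite set \<open>A\<close> is modelled by the
  real functions that vanish outside \<open>A\<close>; the basis vector labelled \<open>a\<close> is \<open>bvec a\<close>.\<close>

definition hspace :: "'a set \<Rightarrow> ('a \<Rightarrow> real) set" where
  "hspace A = {v. \<forall>x. x \<notin> A \<longrightarrow> v x = 0}"

definition bvec :: "'a \<Rightarrow> 'a \<Rightarrow> real" where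
  "bvec a = (\<lambda>x. if x = a then 1 else 0)"

definition ip :: "'a set \<Rightarrow> ('a \<Rightarrow> real) \<Rightarrow> ('a \<Rightarrow> real) \<Rightarrow> real" where
  "ip A v w = (\<Sum>x\<in>A. v x * w x)"

definition lin_map :: "'a set \<Rightarrow> 'b set \<Rightarrow> (('a \<Rightarrow> real) \<Rightarrow> ('b \<Rightarrow> real)) \<Rightarrow> bool" where
  "lin_map A B F \<longleftrightarrow>
     (\<forall>v\<in>hspace A. F v \<in> hspace B) \<and>
     (\<forall>v\<in>hspace A. \<forall>w\<in>hspace A. F (\<lambda>x. v x + w x) = (\<lambda>y. F v y + F w y)) \<and>
     (\<forall>c. \<forall>v\<in>hspace A. F (\<lambda>x. c * v x) = (\<lambda>y. c * F v y))"

definition isometry :: "'a set \<Rightarrow> 'b set \<Rightarrow> (('a \<Rightarrow> real) \<Rightarrow> ('b \<Rightarrow> real)) \<Rightarrow> bool" where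
  "isometry A B F \<longleftrightarrow>
     lin_map A B F \<and> (\<forall>v\<in>hspace A. \<forall>w\<in>hspace A. ip B (F v) (F w) = ip A v w)"

text \<open>The adjoint of a linear map, given by its coordinates; lemma \<open>ip_adj\<close> below is the
  defining property.\<close>

definition adj :: "'a set \<Rightarrow> 'b set \<Rightarrow> (('a \<Rightarrow> real) \<Rightarrow> ('b \<Rightarrow> real)) \<Rightarrow> ('b \<Rightarrow> real) \<Rightarrow> ('a \<Rightarrow> real)" where
  "adj A B F w = (\<lambda>x. if x \<in> A then ip B (F (bvec x)) w else 0)"

lemma lin_map_expand:
  assumes "finite A" and F: "lin_map A B F" and v: "v \<in> hspace A"
  shows "F v = (\<lambda>y. \<Sum>x\<in>A. v x * F (bvec x) y)"
proof -
  have add: "F (\<lambda>x. v x + w x) = (\<lambda>y. F v y + F w y)"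
    if "v \<in> hspace A" "w \<in> hspace A" for v w
    using F that by (simp add: lin_map_def)
  have scale: "F (\<lambda>x. c * v x) = (\<lambda>y. c * F v y)" if "v \<in> hspace A" for c v
    using F that by (simp add: lin_map_def)
  have *: "F (\<lambda>y. \<Sum>x\<in>S. v x * bvec x y) = (\<lambda>y. \<Sum>x\<in>S. v x * F (bvec x) y)"
    if "finite S" "S \<subseteq> A" for S
    using that
  proof (induction S)
    case empty
    have "(\<lambda>y. 0) \<in> hspace A" by (simp add: hspace_def)
    from scale[OF this, of 0]
    show ?case by simp
  next
    case (insert a S)
    have b: "bvec a \<in> hspace A" using insert by (auto simp: hspace_def bvec_def)
    then have b': "(\<lambda>y. v a * bvec a y) \<in> hspace A" by (auto simp: hspace_def)
    have s: "(\<lambda>y. \<Sum>x\<in>S. v x * bvec x y) \<in> hspace A"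
      using insert by (auto simp: hspace_def bvec_def intro!: sum.neutral)
    have "F (\<lambda>y. v a * bvec a y + (\<Sum>x\<in>S. v x * bvec x y))
        = (\<lambda>y. F (\<lambda>y. v a * bvec a y) y + F (\<lambda>y. \<Sum>x\<in>S. v x * bvec x y) y)"
      by (rule add[OF b' s])
    moreover have "F (\<lambda>y. v a * bvec a y) = (\<lambda>y. v a * F (bvec a) y)"
      by (rule scale[OF b])
    ultimately show ?case using insert by simp
  qed
  have "v = (\<lambda>y. \<Sum>x\<in>A. v x * bvec x y)"
  proof
    fix y
    have "(\<Sum>x\<in>A. v x * bvec x y) = (\<Sum>x\<in>A. if x = y then v x else 0)"
      by (rule sum.cong) (auto simp: bvec_def)
    then show "v y = (\<Sum>x\<in>A. v x * bvec x y)"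
      using v \<open>finite A\<close> by (simp add: hspace_def)
  qed
  with *[of A] \<open>finite A\<close> show ?thesis by simp
qed

lemma ip_adj:
  assumes "finite A" "lin_map A B F" "v \<in> hspace A"
  shows "ip B (F v) w = ip A v (adj A B F w)"
proof -
  have "ip B (F v) w = (\<Sum>y\<in>B. \<Sum>x\<in>A. v x * (F (bvec x) y * w y))"
    unfolding ip_def by (subst lin_map_expand[OF assms]) (simp add: sum_distrib_right mult.assoc)
  also have "\<dots> = (\<Sum>x\<in>A. \<Sum>y\<in>B. v x * (F (bvec x) y * w y))"
    by (rule sum.swap)
  finally show ?thesis
    by (simp add: ip_def adj_def sum_distrib_left)
qed

text \<open>A family of subspaces \<open>W k\<close>, \<open>k \<in> K\<close>, of \<open>hspace B\<close>, each an isometric image of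
  \<open>hspace A\<close>. The condition does not depend on the isometries \<open>\<Phi> k\<close>: two isometries with the
  same image differ by an orthogonal map of \<open>hspace A\<close>, which cancels.\<close>

definition equi_isoclinic ::
  "'a set \<Rightarrow> 'b set \<Rightarrow> 'k set \<Rightarrow> ('k \<Rightarrow> ('b \<Rightarrow> real) set) \<Rightarrow> real \<Rightarrow> bool" where
  "equi_isoclinic A B K W \<alpha> \<longleftrightarrow>
     (\<exists>\<Phi>. (\<forall>k\<in>K. isometry A B (\<Phi> k) \<and> \<Phi> k ` hspace A = W k) \<and>
          (\<forall>k\<in>K. \<forall>l\<in>K. k \<noteq> l \<longrightarrow>
             (let Q = adj A B (\<Phi> k) \<circ> \<Phi> l
              in \<forall>v\<in>hspace A. adj A A Q (Q v) = (\<lambda>x. \<alpha> * v x))))"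

type_synonym box = "nat \<times> nat"
type_synonym tableau = "box \<Rightarrow> nat"

definition partition_of :: "nat \<Rightarrow> nat list \<Rightarrow> bool" where
  "partition_of n la \<longleftrightarrow> sorted_wrt (\<ge>) la \<and> (\<forall>p\<in>set la. 0 < p) \<and> sum_list la = n"

definition diagram :: "nat list \<Rightarrow> box set" where
  "diagram la = {(i, j). 1 \<le> i \<and> i \<le> length la \<and> 1 \<le> j \<and> j \<le> la ! (i - 1)}"

definition superdiag :: "box \<Rightarrow> int" where
  "superdiag b = int (snd b) - int (fst b)"

definition axial :: "box \<Rightarrow> box \<Rightarrow> int" where
  "axial b c = superdiag b - superdiag c"

definition removable :: "nat list \<Rightarrow> box set" where
  "removable \<mu> = {b \<in> diagram \<mu>. \<exists>n \<nu>. partition_of n \<nu> \<and> diagram \<nu> = diagram \<mu> - {b}}"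

definition up :: "nat list \<Rightarrow> nat list set" where
  "up \<mu> = {la. partition_of (sum_list \<mu> + 1) la \<and>
              (\<exists>b. b \<notin> diagram \<mu> \<and> diagram la = insert b (diagram \<mu>))}"

definition added_box :: "nat list \<Rightarrow> nat list \<Rightarrow> box" where
  "added_box la \<mu> = the_elem (diagram la - diagram \<mu>)"

text \<open>Fillings are extended by \<open>0\<close> outside the diagram, so that a tableau is determined by its
  entries and \<open>Tab la\<close> is finite.\<close>

definition Tab :: "nat list \<Rightarrow> tableau set" where
  "Tab la = {T. bij_betw T (diagram la) {1..sum_list la} \<and>
               (\<forall>b. b \<notin> diagram la \<longrightarrow> T b = 0) \<and>
               (\<forall>i j j'. (i, j) \<in> diagram la \<longrightarrow> (i, j') \<in> diagram la \<longrightarrow> j < j'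
                  \<longrightarrow> T (i, j) < T (i, j')) \<and>
               (\<forall>i i' j. (i, j) \<in> diagram la \<longrightarrow> (i', j) \<in> diagram la \<longrightarrow> i < i'
                  \<longrightarrow> T (i, j) < T (i', j))}"

definition dimn :: "nat list \<Rightarrow> nat" where
  "dimn la = card (Tab la)"

definition box_of :: "nat list \<Rightarrow> tableau \<Rightarrow> nat \<Rightarrow> box" where
  "box_of la T a = inv_into (diagram la) T a"

definition axial_tab :: "nat list \<Rightarrow> tableau \<Rightarrow> nat \<Rightarrow> nat \<Rightarrow> int" where
  "axial_tab la T a b = axial (box_of la T a) (box_of la T b)"

definition adj_trans :: "nat \<Rightarrow> nat \<Rightarrow> nat" where
  "adj_trans k = Transposition.transpose k (k + 1)"

text \<open>The linear extension of the formula for the generators. If \<open>adj_trans k \<circ> T\<close> is not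
  standard, then \<open>k\<close> and \<open>k + 1\<close> are adjacent in \<open>T\<close> and the coefficient of
  \<open>bvec (adj_trans k \<circ> T)\<close> is \<open>0\<close>.\<close>

definition young_gen :: "nat list \<Rightarrow> nat \<Rightarrow> (tableau \<Rightarrow> real) \<Rightarrow> (tableau \<Rightarrow> real)" where
  "young_gen la k v = (\<lambda>S. \<Sum>T\<in>Tab la. v T *
     (1 / real_of_int (axial_tab la T (k + 1) k) * bvec T S +
      sqrt (1 - 1 / (real_of_int (axial_tab la T (k + 1) k))\<^sup>2) * bvec (adj_trans k \<circ> T) S))"

definition word_perm :: "nat list \<Rightarrow> nat \<Rightarrow> nat" where
  "word_perm ks = foldr (\<lambda>k \<sigma>. adj_trans k \<circ> \<sigma>) ks id"

definition word_op :: "nat list \<Rightarrow> nat list \<Rightarrow> (tableau \<Rightarrow> real) \<Rightarrow> (tableau \<Rightarrow> real)" where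
  "word_op la ks = foldr (\<lambda>k F. young_gen la k \<circ> F) ks id"

text \<open>The operators \<open>young_gen la k\<close> satisfy the Coxeter relations of the symmetric group on
  \<open>{1..sum_list la}\<close>, so on \<open>hspace (Tab la)\<close> the value at \<open>\<sigma>\<close> does not depend on the chosen
  factorization of \<open>\<sigma>\<close> into adjacent transpositions.\<close>

definition young_rep :: "nat list \<Rightarrow> (nat \<Rightarrow> nat) \<Rightarrow> (tableau \<Rightarrow> real) \<Rightarrow> (tableau \<Rightarrow> real)" where
  "young_rep la \<sigma> =
     word_op la (SOME ks. set ks \<subseteq> {k. 1 \<le> k \<and> k < sum_list la} \<and> word_perm ks = \<sigma>)"

definition dim_set :: "nat list set \<Rightarrow> nat" where
  "dim_set L = (\<Sum>la\<in>L. dimn la)"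

text \<open>Basis labels of the direct sum of the spaces \<open>hspace (Tab la)\<close>, \<open>la \<in> L\<close>.\<close>

definition Tab_set :: "nat list set \<Rightarrow> (nat list \<times> tableau) set" where
  "Tab_set L = Sigma L Tab"

definition young_rep_set ::
  "nat list set \<Rightarrow> (nat \<Rightarrow> nat) \<Rightarrow> (nat list \<times> tableau \<Rightarrow> real) \<Rightarrow> (nat list \<times> tableau \<Rightarrow> real)" where
  "young_rep_set L \<sigma> v = (\<lambda>(la, T). if la \<in> L then young_rep la \<sigma> (\<lambda>S. v (la, S)) T else 0)"

definition extend_tab :: "nat list \<Rightarrow> nat list \<Rightarrow> tableau \<Rightarrow> tableau" where
  "extend_tab la \<mu> R = R(added_box la \<mu> := sum_list la)"

definition Psi :: "nat list \<Rightarrow> nat list \<Rightarrow> (tableau \<Rightarrow> real) \<Rightarrow> (tableau \<Rightarrow> real)" where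
  "Psi la \<mu> v = (\<lambda>S. \<Sum>R\<in>Tab \<mu>. v R * bvec (extend_tab la \<mu> R) S)"

definition Psi_set ::
  "nat list \<Rightarrow> nat list set \<Rightarrow> (tableau \<Rightarrow> real) \<Rightarrow> (nat list \<times> tableau \<Rightarrow> real)" where
  "Psi_set \<mu> L v = (\<lambda>(la, T). if la \<in> L
     then sqrt (real (dimn la) / real (dim_set L)) * Psi la \<mu> v T else 0)"

definition W_sub :: "nat list \<Rightarrow> nat list set \<Rightarrow> (nat list \<times> tableau \<Rightarrow> real) set" where
  "W_sub \<mu> L = Psi_set \<mu> L ` hspace (Tab \<mu>)"

definition W_fam ::
  "(nat \<Rightarrow> nat \<Rightarrow> nat) \<Rightarrow> nat list \<Rightarrow> nat list set \<Rightarrow> nat \<Rightarrow> (nat list \<times> tableau \<Rightarrow> real) set" where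
  "W_fam t \<mu> L k = young_rep_set L (t k) ` W_sub \<mu> L"

definition coset_reps :: "nat \<Rightarrow> (nat \<Rightarrow> nat \<Rightarrow> nat) \<Rightarrow> bool" where
  "coset_reps n t \<longleftrightarrow> (\<forall>k\<in>{1..n}. t k permutes {1..n} \<and> t k n = k)"

definition W_equi_isoclinic ::
  "(nat \<Rightarrow> nat \<Rightarrow> nat) \<Rightarrow> nat list \<Rightarrow> nat list set \<Rightarrow> real \<Rightarrow> bool" where
  "W_equi_isoclinic t \<mu> L \<alpha> \<longleftrightarrow>
     equi_isoclinic (Tab \<mu>) (Tab_set L) {1..sum_list \<mu> + 1} (W_fam t \<mu> L) \<alpha>"

text \<open>The family \<open>W_fam t \<mu> L\<close>, hence this notion, is the same for all \<open>t\<close> with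
  \<open>coset_reps (sum_list \<mu> + 1) t\<close>, because \<open>W_sub \<mu> L\<close> is invariant under the stabilizer of
  \<open>sum_list \<mu> + 1\<close>.\<close>

definition isoclinic :: "(nat \<Rightarrow> nat \<Rightarrow> nat) \<Rightarrow> nat list \<Rightarrow> bool" where
  "isoclinic t \<mu> \<longleftrightarrow> (\<exists>L. L \<noteq> {} \<and> L \<subset> up \<mu> \<and> (\<exists>\<alpha>. W_equi_isoclinic t \<mu> L \<alpha>))"

end

theory Submission
  imports Defs "HOL-Computational_Algebra.Polynomial"
begin

text \<open>Writing a permutation that moves \<open>n\<close> as \<open>\<sigma> s \<tau>\<close>, with \<open>s = (n - 1 n)\<close> and
  \<open>\<sigma>\<close>, \<open>\<tau>\<close> fixing \<open>n\<close>, shows that every cross Gram operator of the family is, up to orthogonal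
  factors, the compression of \<open>s\<close> to \<open>W_L\<close>. By Young's formula this compression is diagonal in the
  tableau basis; its entry depends only on the box \<open>r\<close> of \<open>n - 1\<close> and equals
  \<open>\<Sum> (d_\<lambda> / d_L) / D(\<lambda> - \<mu>, r)\<close>, summed over \<open>\<lambda> \<in> L\<close>. So the family is equi-isoclinic iff these
  numbers have the same absolute value for all removable \<open>r\<close>.

  The sum over all of \<open>up \<mu>\<close> vanishes for every \<open>r\<close>: by Frobenius' formula for \<open>d_\<lambda>\<close> it is a
  Lagrange interpolation sum of a polynomial of too small a degree. Hence a set and its complement
  are equi-isoclinic together. The sum over \<open>L\<close> is a rational function of the superdiagonal of \<open>r\<close>
  that increases between its poles, and removable and addable superdiagonals interlace; a function
  with values \<open>\<beta>\<close> or \<open>- \<beta>\<close> at all removable superdiagonals must therefore have its poles at every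
  other addable one, and monotonicity also determines the signs.\<close>

section \<open>Partitions, their rows and tableaux\<close>

text \<open>Three obstacles shape the proof. \<open>young_rep\<close> evaluates an arbitrarily
  chosen word, so multiplicativity in the permutation cannot be used directly; the factorization is
  instead performed on the word \<open>rev (rep_word k) @ rep_word l\<close>, by rewriting steps
  that preserve both the permutation and the operator. Only relations that never increase the number
  of top letters occur, so neither normal forms nor uniqueness of reduced words enters.
  Equi-isoclinism quantifies over all isometries onto the given subspaces, while the computation
  concerns one canonical choice, \<open>Phi\<close>. For an isometry F the operator F F* is the
  orthogonal projection onto the image, so inner products of vectors F* w depend on the image only.
  For the dimensions, each part is shifted by its row index to a node a_i. Adding or deleting a box
  changes one node by 1, and distinct rows have distinct nodes. Both the branching recursion behind
  Frobenius' formula and the vanishing of the total sum then amount to reading off one coefficient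
  of a polynomial interpolated at the a_i.\<close>

definition row :: "nat list \<Rightarrow> nat \<Rightarrow> nat" where
  "row la i = (if i < length la then la ! i else 0)"

definition is_partition :: "nat list \<Rightarrow> bool" where
  "is_partition la \<longleftrightarrow> partition_of (sum_list la) la"

text \<open>Partitions are handled through row lengths indexed from 0 and extended by 0, so that
  moving a box is a function update. Cutting at the first zero row returns a list without zero
  parts.\<close>

definition of_rows :: "(nat \<Rightarrow> nat) \<Rightarrow> nat list" where
  "of_rows f = map f [0..<(LEAST i. f i = 0)]"

lemma partition_of_is_partition: "partition_of n la \<Longrightarrow> is_partition la \<and> sum_list la = n"
  by (auto simp: is_partition_def partition_of_def)

lemma mem_diagram_Suc: "(Suc i, j) \<in> diagram la \<longleftrightarrow> 1 \<le> j \<and> j \<le> row la i"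
  by (auto simp: diagram_def row_def)

lemma mem_diagram: "(i, j) \<in> diagram la \<longleftrightarrow> 1 \<le> i \<and> 1 \<le> j \<and> j \<le> row la (i - 1)"
  by (auto simp: diagram_def row_def)

lemma row_antimono:
  assumes "is_partition la" "i \<le> j"
  shows "row la j \<le> row la i"
proof (cases "i < j \<and> j < length la")
  case True
  then show ?thesis
    using assms sorted_wrt_nth_less[of "(\<ge>)" la i j]
    by (auto simp: is_partition_def partition_of_def row_def)
next
  case False
  then show ?thesis using assms by (auto simp: row_def)
qed

lemma row_antimono': "is_partition la \<Longrightarrow> antimono (row la)"
  by (auto intro!: antimonoI row_antimono)

lemma row_pos_iff: "is_partition la \<Longrightarrow> 0 < row la i \<longleftrightarrow> i < length la"
  by (auto simp: row_def is_partition_def partition_of_def)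

lemma row_eq_0: "length la \<le> i \<Longrightarrow> row la i = 0"
  by (simp add: row_def)

lemma sum_row:
  assumes "length la \<le> N"
  shows "(\<Sum>i<N. row la i) = sum_list la"
proof -
  have "(\<Sum>i<N. row la i) = (\<Sum>i<length la. row la i)"
    using assms by (intro sum.mono_neutral_right) (auto simp: row_def)
  also have "\<dots> = sum_list la"
    by (simp add: sum_list_sum_nth atLeast0LessThan row_def)
  finally show ?thesis .
qed

lemma row_inject:
  assumes "is_partition la" "is_partition la'" "row la = row la'"
  shows "la = la'"
proof (rule nth_equalityI)
  have "i < length la \<longleftrightarrow> i < length la'" for i
    using row_pos_iff[OF assms(1), of i] row_pos_iff[OF assms(2), of i] assms(3) by simp
  then show len: "length la = length la'"
    by (metis linorder_neqE_nat less_irrefl)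
  fix i assume "i < length la"
  then show "la ! i = la' ! i"
    using fun_cong[OF assms(3), of i] len by (simp add: row_def)
qed

lemma of_rows:
  assumes "antimono f" "f N = 0"
  shows "row (of_rows f) = f" "is_partition (of_rows f)" "length (of_rows f) \<le> N"
proof -
  define M where "M = (LEAST i. f i = 0)"
  have M0: "f M = 0" unfolding M_def using assms(2) by (rule LeastI)
  have MN: "M \<le> N" unfolding M_def using assms(2) by (rule Least_le)
  have pos: "0 < f i" if "i < M" for i
    using that not_less_Least[of i "\<lambda>i. f i = 0"] by (auto simp: M_def)
  have z: "f i = 0" if "M \<le> i" for i
    using antimonoD[OF assms(1) that] M0 by simp
  have eq: "of_rows f = map f [0..<M]" by (simp add: of_rows_def M_def)
  show "row (of_rows f) = f" using z by (auto simp: eq row_def fun_eq_iff)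
  show "length (of_rows f) \<le> N" using MN by (simp add: eq)
  show "is_partition (of_rows f)"
    using pos antimonoD[OF assms(1)]
    by (auto simp: is_partition_def partition_of_def eq sorted_wrt_iff_nth_less)
qed

text \<open>Rows of both diagrams are initial segments, so the extra box can only sit one place past
  the end of a row of \<open>\<mu>\<close>.\<close>

lemma diagram_insert_row:
  assumes "diagram la = insert b (diagram \<mu>)" "b \<notin> diagram \<mu>"
  shows "\<exists>i. b = (Suc i, Suc (row \<mu> i)) \<and> row la = (row \<mu>)(i := Suc (row \<mu> i))"
proof -
  obtain i0 j where b: "b = (i0, j)" by (cases b)
  have bla: "(i0, j) \<in> diagram la" using assms b by auto
  then obtain i where i: "i0 = Suc i" by (cases i0) (auto simp: mem_diagram)
  have iff: "1 \<le> j' \<and> j' \<le> row la i' \<longleftrightarrow> 1 \<le> j' \<and> j' \<le> row \<mu> i' \<or> i' = i \<and> j' = j" for i' j'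
    using assms(1) mem_diagram_Suc[of i' j' la] mem_diagram_Suc[of i' j' \<mu>] b i by auto
  have j: "1 \<le> j" "row \<mu> i < j" "j \<le> row la i"
    using assms(2) bla b i by (auto simp: mem_diagram_Suc)
  have j2: "j = Suc (row \<mu> i)"
    using iff[of "Suc (row \<mu> i)" i] j by auto
  have "row la i = j" using iff[of "row la i" i] j by auto
  moreover have "row la i' = row \<mu> i'" if "i' \<noteq> i" for i'
    using iff[of "row la i'" i'] iff[of "row \<mu> i'" i'] that
    by (cases "row la i' = 0"; cases "row \<mu> i' = 0") auto
  ultimately show ?thesis using b i j2 by (auto simp: fun_eq_iff)
qed

lemma diagram_of_row_insert:
  assumes "row la = (row \<mu>)(i := Suc (row \<mu> i))"
  shows "diagram la = insert (Suc i, Suc (row \<mu> i)) (diagram \<mu>)"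
    and "(Suc i, Suc (row \<mu> i)) \<notin> diagram \<mu>"
proof -
  show "(Suc i, Suc (row \<mu> i)) \<notin> diagram \<mu>" by (simp add: mem_diagram_Suc)
  show "diagram la = insert (Suc i, Suc (row \<mu> i)) (diagram \<mu>)"
  proof (rule set_eqI)
    fix x :: box
    obtain a j where x: "x = (a, j)" by (cases x)
    show "x \<in> diagram la \<longleftrightarrow> x \<in> insert (Suc i, Suc (row \<mu> i)) (diagram \<mu>)"
      by (cases a) (auto simp: x mem_diagram_Suc assms mem_diagram[of 0])
  qed
qed

lemma sum_list_row_insert:
  assumes "row la = (row \<mu>)(i := Suc (row \<mu> i))"
  shows "sum_list la = Suc (sum_list \<mu>)"
proof -
  define N where "N = Suc (max i (max (length la) (length \<mu>)))"
  have "sum_list la = (\<Sum>k<N. row la k)" by (rule sum_row[symmetric]) (simp add: N_def)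
  also have "\<dots> = row la i + (\<Sum>k\<in>{..<N} - {i}. row la k)"
    by (rule sum.remove) (auto simp: N_def)
  also have "(\<Sum>k\<in>{..<N} - {i}. row la k) = (\<Sum>k\<in>{..<N} - {i}. row \<mu> k)"
    by (rule sum.cong) (auto simp: assms)
  also have "row la i = Suc (row \<mu> i)" by (simp add: assms)
  also have "Suc (row \<mu> i) + (\<Sum>k\<in>{..<N} - {i}. row \<mu> k) = Suc (\<Sum>k<N. row \<mu> k)"
    by (subst sum.remove[of "{..<N}" i "row \<mu>"]) (auto simp: N_def)
  also have "(\<Sum>k<N. row \<mu> k) = sum_list \<mu>" by (rule sum_row) (simp add: N_def)
  finally show ?thesis .
qed

lemma up_iff:
  "la \<in> up \<mu> \<longleftrightarrow> is_partition la \<and> (\<exists>i. row la = (row \<mu>)(i := Suc (row \<mu> i)))"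
proof
  assume "la \<in> up \<mu>"
  then show "is_partition la \<and> (\<exists>i. row la = (row \<mu>)(i := Suc (row \<mu> i)))"
    using diagram_insert_row[of la _ \<mu>] partition_of_is_partition by (fastforce simp: up_def)
next
  assume a: "is_partition la \<and> (\<exists>i. row la = (row \<mu>)(i := Suc (row \<mu> i)))"
  then obtain i where i: "row la = (row \<mu>)(i := Suc (row \<mu> i))" by blast
  show "la \<in> up \<mu>"
    using a sum_list_row_insert[OF i] diagram_of_row_insert[OF i]
    by (auto simp: up_def is_partition_def)
qed

text \<open>For a partition, index \<open>length \<mu>\<close> belongs to this set: it stands for
  the box that starts a new bottom row.\<close>

definition addable_rows :: "nat list \<Rightarrow> nat set" where
  "addable_rows \<mu> = {i. i = 0 \<or> row \<mu> i < row \<mu> (i - 1)}"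

definition add_row :: "nat list \<Rightarrow> nat \<Rightarrow> nat list" where
  "add_row \<mu> i = of_rows ((row \<mu>)(i := Suc (row \<mu> i)))"

lemma added_box_row:
  assumes "row la = (row \<mu>)(i := Suc (row \<mu> i))"
  shows "added_box la \<mu> = (Suc i, Suc (row \<mu> i))"
proof -
  have "diagram la - diagram \<mu> = {(Suc i, Suc (row \<mu> i))}"
    using diagram_of_row_insert[OF assms] by auto
  then show ?thesis by (simp add: added_box_def)
qed

lemma antimono_add_row:
  assumes "is_partition \<mu>" "i \<in> addable_rows \<mu>"
  shows "antimono ((row \<mu>)(i := Suc (row \<mu> i)))"
proof (rule antimonoI)
  fix x y :: nat assume xy: "x \<le> y"
  show "((row \<mu>)(i := Suc (row \<mu> i))) y \<le> ((row \<mu>)(i := Suc (row \<mu> i))) x"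
  proof (cases "y = i \<and> x < y")
    case True
    then have "row \<mu> i < row \<mu> (i - 1)" "row \<mu> (i - 1) \<le> row \<mu> x"
      using assms(2) row_antimono[OF assms(1), of x "i - 1"] by (auto simp: addable_rows_def)
    then show ?thesis using True by simp
  next
    case False
    then show ?thesis using xy row_antimono[OF assms(1) xy] by auto
  qed
qed

lemma add_row:
  assumes "is_partition \<mu>" "i \<in> addable_rows \<mu>"
  shows "row (add_row \<mu> i) = (row \<mu>)(i := Suc (row \<mu> i))" "is_partition (add_row \<mu> i)"
proof -
  have "((row \<mu>)(i := Suc (row \<mu> i))) (Suc (i + length \<mu>)) = 0" by (simp add: row_def)
  from of_rows[OF antimono_add_row[OF assms] this]
  show "row (add_row \<mu> i) = (row \<mu>)(i := Suc (row \<mu> i))" "is_partition (add_row \<mu> i)"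
    by (simp_all only: add_row_def)
qed

text \<open>Turns sums over \<open>up \<mu>\<close> into sums over row indices, which are the
  indices of the interpolation nodes later on.\<close>

lemma bij_betw_add_row:
  assumes "is_partition \<mu>"
  shows "bij_betw (add_row \<mu>) (addable_rows \<mu>) (up \<mu>)"
proof (rule bij_betw_imageI)
  show "inj_on (add_row \<mu>) (addable_rows \<mu>)"
  proof (rule inj_onI)
    fix i j assume ij: "i \<in> addable_rows \<mu>" "j \<in> addable_rows \<mu>" "add_row \<mu> i = add_row \<mu> j"
    then have "((row \<mu>)(i := Suc (row \<mu> i))) i = ((row \<mu>)(j := Suc (row \<mu> j))) i"
      using add_row(1)[OF assms] by metis
    then show "i = j" by (auto split: if_splits)
  qed
  show "add_row \<mu> ` addable_rows \<mu> = up \<mu>"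
  proof (intro equalityI subsetI)
    fix la assume "la \<in> up \<mu>"
    then obtain i where la: "is_partition la" and i: "row la = (row \<mu>)(i := Suc (row \<mu> i))"
      by (auto simp: up_iff)
    have "i \<in> addable_rows \<mu>"
      using row_antimono[OF la, of "i - 1" i] i
      by (cases "i = 0") (auto simp: addable_rows_def split: if_splits)
    moreover have "la = add_row \<mu> i"
      by (rule row_inject) (use la i add_row[OF assms \<open>i \<in> addable_rows \<mu>\<close>] in auto)
    ultimately show "la \<in> add_row \<mu> ` addable_rows \<mu>" by blast
  qed (use add_row[OF assms] in \<open>auto simp: up_iff\<close>)
qed

lemma addable_rows_subset:
  assumes "is_partition \<mu>" "length \<mu> < N"
  shows "addable_rows \<mu> \<subseteq> {..<N}"
  using assms(2) by (auto simp: addable_rows_def row_def split: if_splits)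

lemma finite_up: "is_partition \<mu> \<Longrightarrow> finite (up \<mu>)"
  using bij_betw_finite[OF bij_betw_add_row]
    finite_subset[OF addable_rows_subset[of \<mu> "Suc (length \<mu>)"]] by auto

definition removable_rows :: "nat list \<Rightarrow> nat set" where
  "removable_rows la = {i. row la (Suc i) < row la i}"

definition del_row :: "nat list \<Rightarrow> nat \<Rightarrow> nat list" where
  "del_row la i = of_rows ((row la)(i := row la i - 1))"

lemma del_row:
  assumes "is_partition la" "i \<in> removable_rows la"
  shows "row (del_row la i) = (row la)(i := row la i - 1)" "is_partition (del_row la i)"
    "length (del_row la i) \<le> length la"
    "row la = (row (del_row la i))(i := Suc (row (del_row la i) i))"
proof -
  have am: "antimono ((row la)(i := row la i - 1))"
  proof (rule antimonoI)
    fix x y :: nat assume xy: "x \<le> y"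
    show "((row la)(i := row la i - 1)) y \<le> ((row la)(i := row la i - 1)) x"
    proof (cases "x = i \<and> x < y")
      case True
      then have "row la (Suc i) < row la i" "row la y \<le> row la (Suc i)"
        using assms(2) row_antimono[OF assms(1), of "Suc i" y] by (auto simp: removable_rows_def)
      then show ?thesis using True by simp
    next
      case False
      then show ?thesis using xy row_antimono[OF assms(1) xy] by auto
    qed
  qed
  have "((row la)(i := row la i - 1)) (length la) = 0"
    using assms(2) by (auto simp: row_def removable_rows_def split: if_splits)
  from of_rows[OF am this]
  show *: "row (del_row la i) = (row la)(i := row la i - 1)" "is_partition (del_row la i)"
    "length (del_row la i) \<le> length la"
    by (simp_all only: del_row_def)
  show "row la = (row (del_row la i))(i := Suc (row (del_row la i) i))"
    using assms(2) by (auto simp: *(1) fun_eq_iff removable_rows_def)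
qed

lemma removable_eq:
  assumes "is_partition \<mu>"
  shows "removable \<mu> = (\<lambda>i. (Suc i, row \<mu> i)) ` removable_rows \<mu>"
proof (intro equalityI subsetI)
  fix b assume "b \<in> removable \<mu>"
  then obtain n \<nu> where b: "b \<in> diagram \<mu>" and \<nu>: "partition_of n \<nu>" "diagram \<nu> = diagram \<mu> - {b}"
    by (auto simp: removable_def)
  then have "diagram \<mu> = insert b (diagram \<nu>)" "b \<notin> diagram \<nu>" by auto
  from diagram_insert_row[OF this] obtain i
    where i: "b = (Suc i, Suc (row \<nu> i))" "row \<mu> = (row \<nu>)(i := Suc (row \<nu> i))" by blast
  have "row \<nu> (Suc i) \<le> row \<nu> i"
    using \<nu>(1) partition_of_is_partition row_antimono by fastforce
  then have "i \<in> removable_rows \<mu>" using i by (simp add: removable_rows_def)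
  then show "b \<in> (\<lambda>i. (Suc i, row \<mu> i)) ` removable_rows \<mu>" using i by auto
next
  fix b assume "b \<in> (\<lambda>i. (Suc i, row \<mu> i)) ` removable_rows \<mu>"
  then obtain i where i: "i \<in> removable_rows \<mu>" "b = (Suc i, row \<mu> i)" by blast
  note d = del_row[OF assms i(1)]
  have "b = (Suc i, Suc (row (del_row \<mu> i) i))" using d(4) i(2) by (metis fun_upd_same)
  then have "diagram \<mu> = insert b (diagram (del_row \<mu> i))" "b \<notin> diagram (del_row \<mu> i)"
    using diagram_of_row_insert[OF d(4)] by auto
  then show "b \<in> removable \<mu>"
    using d(2) by (auto simp: removable_def is_partition_def intro!: exI[of _ "del_row \<mu> i"])
qed

section \<open>Standard tableaux and the branching rule\<close>

lemma finite_diagram: "finite (diagram la)"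
proof -
  have "diagram la \<subseteq> {..length la} \<times> {..sum_list la}"
    by (auto simp: diagram_def intro!: order_trans[OF _ member_le_sum_list])
  then show ?thesis by (rule finite_subset) auto
qed

lemma finite_Tab: "finite (Tab la)"
proof -
  have "Tab la \<subseteq> {f. \<forall>x. (x \<in> diagram la \<longrightarrow> f x \<in> {1..sum_list la}) \<and> (x \<notin> diagram la \<longrightarrow> f x = 0)}"
    by (auto simp: Tab_def bij_betw_def)
  then show ?thesis
    using finite_set_of_finite_funs[OF finite_diagram, of "{1..sum_list la}" la 0]
    by (rule finite_subset) auto
qed

lemma Tab_D:
  assumes "T \<in> Tab la"
  shows "bij_betw T (diagram la) {1..sum_list la}" "b \<notin> diagram la \<Longrightarrow> T b = 0"
    "(i, j) \<in> diagram la \<Longrightarrow> (i, j') \<in> diagram la \<Longrightarrow> j < j' \<Longrightarrow> T (i, j) < T (i, j')"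
    "(i, j) \<in> diagram la \<Longrightarrow> (i', j) \<in> diagram la \<Longrightarrow> i < i' \<Longrightarrow> T (i, j) < T (i', j)"
  using assms unfolding Tab_def by blast+

lemma diagram_down:
  assumes "is_partition la" "(i', j') \<in> diagram la" "1 \<le> i" "i \<le> i'" "1 \<le> j" "j \<le> j'"
  shows "(i, j) \<in> diagram la"
  using assms row_antimono[OF assms(1) diff_le_mono[OF assms(4), of 1]] by (auto simp: mem_diagram)

text \<open>An entry larger than all others, placed in an addable box, cannot violate standardness:
  every box in its row or column precedes it. Resetting the value at \<open>b\<close> to 0 restores
  the convention that fillings vanish outside the diagram.\<close>

lemma Tab_extend_iff:
  assumes \<mu>: "is_partition \<mu>" and r: "row la = (row \<mu>)(i := Suc (row \<mu> i))"
    and b: "b = (Suc i, Suc (row \<mu> i))" and S: "S b = sum_list la"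
  shows "S \<in> Tab la \<longleftrightarrow> S(b := 0) \<in> Tab \<mu>"
proof -
  note dg = diagram_of_row_insert[OF r, folded b]
  have n: "sum_list la = Suc (sum_list \<mu>)" by (rule sum_list_row_insert[OF r])
  show ?thesis
  proof
    assume "S \<in> Tab la"
    note T = Tab_D[OF this]
    have "bij_betw S (diagram la - {b}) ({1..sum_list la} - {S b})"
      using T(1) dg(1) by (intro bij_betw_DiffI) (auto simp: bij_betw_def)
    moreover have "diagram la - {b} = diagram \<mu>" "{1..sum_list la} - {S b} = {1..sum_list \<mu>}"
      using dg S n by auto
    ultimately have "bij_betw S (diagram \<mu>) {1..sum_list \<mu>}" by simp
    then have "bij_betw (S(b := 0)) (diagram \<mu>) {1..sum_list \<mu>}"
      using dg(2) by (subst bij_betw_cong[of _ _ S]) auto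
    moreover have "(S(b := 0)) x = 0" if "x \<notin> diagram \<mu>" for x
      using T(2)[of x] that dg(1) by auto
    moreover have "(S(b := 0)) x = S x \<and> x \<in> diagram la" if "x \<in> diagram \<mu>" for x
      using that dg by auto
    ultimately show "S(b := 0) \<in> Tab \<mu>"
      using T(3,4) unfolding Tab_def by auto
  next
    assume "S(b := 0) \<in> Tab \<mu>"
    note T = Tab_D[OF this]
    have eq: "(S(b := 0)) x = S x" if "x \<in> diagram \<mu>" for x using that dg(2) by auto
    have bij: "bij_betw S (diagram \<mu>) {1..sum_list \<mu>}"
      using T(1) eq by (subst bij_betw_cong[of _ _ "S(b := 0)"]) auto
    have lt: "S x < S b" if "x \<in> diagram \<mu>" for x
      using bij_betwE[OF bij] that S n by fastforce
    have "bij_betw S (insert b (diagram \<mu>)) (insert (S b) {1..sum_list \<mu>})"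
      using notIn_Un_bij_betw[OF dg(2) _ bij] S n by simp
    moreover have "insert (S b) {1..sum_list \<mu>} = {1..sum_list la}" using S n by auto
    ultimately have 1: "bij_betw S (diagram la) {1..sum_list la}" using dg(1) by simp
    have 2: "S x = 0" if "x \<notin> diagram la" for x
      using T(2)[of x] that dg by (auto split: if_splits)
    \<comment> \<open>A box of \<open>\<mu>\<close> weakly to the right of and below
      \<open>b\<close> would force \<open>b\<close> into \<open>\<mu>\<close>. Hence the smaller of
      two comparable boxes is never \<open>b\<close>.\<close>
    have bmax: "x \<notin> diagram \<mu>" if "x = (i', j')" "Suc i \<le> i'" "Suc (row \<mu> i) \<le> j'" for x i' j'
      using diagram_down[OF \<mu>, of i' j' "Suc i" "Suc (row \<mu> i)"] that dg(2) b by auto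
    have 3: "S (a, j) < S (a, j')" if h: "(a, j) \<in> diagram la" "(a, j') \<in> diagram la" "j < j'" for a j j'
    proof -
      have *: "(a, j) \<in> diagram \<mu>"
        using bmax[of "(a, j')" a j'] h b
        unfolding dg(1) by auto
      show ?thesis
      proof (cases "(a, j') = b")
        case True
        with lt[OF *] show ?thesis by simp
      next
        case False
        then have "(a, j') \<in> diagram \<mu>" using h unfolding dg(1) by blast
        then show ?thesis using T(3)[OF * _ h(3)] eq[OF *] eq[of "(a, j')"] by simp
      qed
    qed
    have 4: "S (a, j) < S (a', j)" if h: "(a, j) \<in> diagram la" "(a', j) \<in> diagram la" "a < a'" for a a' j
    proof -
      have *: "(a, j) \<in> diagram \<mu>"
        using bmax[of "(a', j)" a' j] h b
        unfolding dg(1) by auto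
      show ?thesis
      proof (cases "(a', j) = b")
        case True
        with lt[OF *] show ?thesis by simp
      next
        case False
        then have "(a', j) \<in> diagram \<mu>" using h unfolding dg(1) by blast
        then show ?thesis using T(4)[OF * _ h(3)] eq[OF *] eq[of "(a', j)"] by simp
      qed
    qed
    show "S \<in> Tab la" unfolding Tab_def using 1 2 3 4 by blast
  qed
qed

lemma bij_betw_Tab_extend:
  assumes \<mu>: "is_partition \<mu>" and r: "row la = (row \<mu>)(i := Suc (row \<mu> i))"
    and b: "b = (Suc i, Suc (row \<mu> i))"
  shows "bij_betw (\<lambda>R. R(b := sum_list la)) (Tab \<mu>) {S \<in> Tab la. S b = sum_list la}"
proof (rule bij_betw_byWitness[where f' = "\<lambda>S. S(b := 0)"])
  have b0: "R b = 0" if "R \<in> Tab \<mu>" for R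
    using Tab_D(2)[OF that] diagram_of_row_insert(2)[OF r] b by auto
  show "\<forall>R\<in>Tab \<mu>. (R(b := sum_list la))(b := 0) = R"
    using b0 by (auto simp: fun_eq_iff)
  show "\<forall>S\<in>{S \<in> Tab la. S b = sum_list la}. (S(b := 0))(b := sum_list la) = S"
    by (auto simp: fun_eq_iff)
  show "(\<lambda>R. R(b := sum_list la)) ` Tab \<mu> \<subseteq> {S \<in> Tab la. S b = sum_list la}"
  proof clarify
    fix R assume R: "R \<in> Tab \<mu>"
    have "(R(b := sum_list la))(b := 0) = R" using b0[OF R] by (auto simp: fun_eq_iff)
    then show "R(b := sum_list la) \<in> Tab la \<and> (R(b := sum_list la)) b = sum_list la"
      using Tab_extend_iff[OF \<mu> r b, of "R(b := sum_list la)"] R by simp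
  qed
  show "(\<lambda>S. S(b := 0)) ` {S \<in> Tab la. S b = sum_list la} \<subseteq> Tab \<mu>"
    using Tab_extend_iff[OF \<mu> r b] by auto
qed

text \<open>A right or lower neighbour of the box of the largest entry would have to carry a still
  larger entry.\<close>

lemma Tab_max_removable:
  assumes la: "is_partition la" and T: "T \<in> Tab la" and "0 < sum_list la"
  shows "\<exists>i\<in>removable_rows la. T (Suc i, row la i) = sum_list la"
proof -
  note TD = Tab_D[OF T]
  have "sum_list la \<in> T ` diagram la" using TD(1) assms(3) by (auto simp: bij_betw_def)
  then obtain b where b: "b \<in> diagram la" "T b = sum_list la" by auto
  then obtain i j where ij: "b = (Suc i, j)" by (cases b; cases "fst b") (auto simp: mem_diagram)
  have le: "T x \<le> sum_list la" if "x \<in> diagram la" for x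
    using bij_betwE[OF TD(1)] that by auto
  have j: "1 \<le> j" "j \<le> row la i" using b ij by (auto simp: mem_diagram_Suc)
  have "j = row la i"
  proof (rule ccontr)
    assume "j \<noteq> row la i"
    then have "(Suc i, Suc j) \<in> diagram la" using j by (simp add: mem_diagram_Suc)
    then show False using TD(3)[of "Suc i" j "Suc j"] le b ij by fastforce
  qed
  moreover have "row la (Suc i) < row la i"
  proof (rule ccontr)
    assume "\<not> row la (Suc i) < row la i"
    then have "(Suc (Suc i), j) \<in> diagram la" using j by (simp add: mem_diagram_Suc)
    then show False using TD(4)[of "Suc i" j "Suc (Suc i)"] le b ij by fastforce
  qed
  ultimately show ?thesis using b ij by (auto simp: removable_rows_def)
qed

lemma finite_removable_rows: "finite (removable_rows la)"
  by (rule finite_subset[of _ "{..<length la}"]) (auto simp: removable_rows_def row_def split: if_splits)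

text \<open>Tableaux are sorted by the corner that holds the largest entry; erasing this entry
  identifies each class with the tableaux of the smaller shape.\<close>

lemma dimn_branching:
  assumes la: "is_partition la" and pos: "0 < sum_list la"
  shows "dimn la = (\<Sum>i\<in>removable_rows la. dimn (del_row la i))"
proof -
  define X where "X i = {T \<in> Tab la. T (Suc i, row la i) = sum_list la}" for i
  have "Tab la = (\<Union>i\<in>removable_rows la. X i)"
    using Tab_max_removable[OF la _ pos] by (auto simp: X_def)
  then have "dimn la = card (\<Union>i\<in>removable_rows la. X i)" by (simp add: dimn_def)
  also have "\<dots> = (\<Sum>i\<in>removable_rows la. card (X i))"
  proof (rule card_UN_disjoint)
    show "\<forall>i\<in>removable_rows la. finite (X i)" by (auto simp: X_def finite_Tab)
    show "\<forall>i\<in>removable_rows la. \<forall>j\<in>removable_rows la. i \<noteq> j \<longrightarrow> X i \<inter> X j = {}"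
    proof (intro ballI impI equals0I)
      fix i j T assume ij: "i \<in> removable_rows la" "j \<in> removable_rows la" "i \<noteq> j" "T \<in> X i \<inter> X j"
      have "(Suc i, row la i) \<in> diagram la" "(Suc j, row la j) \<in> diagram la"
        using ij by (auto simp: mem_diagram_Suc removable_rows_def)
      moreover have "T (Suc i, row la i) = T (Suc j, row la j)" "inj_on T (diagram la)"
        using ij Tab_D(1)[of T la] by (auto simp: X_def bij_betw_def)
      ultimately show False using ij(3) by (auto simp: inj_on_def)
    qed
  qed (rule finite_removable_rows)
  also have "\<dots> = (\<Sum>i\<in>removable_rows la. dimn (del_row la i))"
  proof (rule sum.cong[OF refl])
    fix i assume i: "i \<in> removable_rows la"
    note d = del_row[OF la i]
    have "row la i = Suc (row (del_row la i) i)" using d(4) by (metis fun_upd_same)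
    then show "card (X i) = dimn (del_row la i)"
      using bij_betw_same_card[OF bij_betw_Tab_extend[OF d(2) d(4) refl]]
      by (simp add: X_def dimn_def)
  qed
  finally show ?thesis .
qed

section \<open>Frobenius' dimension formula and the transition identity\<close>

lemma linear_prod_degree:
  fixes a :: "'i \<Rightarrow> real"
  assumes "finite I"
  shows "degree (\<Prod>i\<in>I. [:a i, 1:]) = card I" "coeff (\<Prod>i\<in>I. [:a i, 1:]) (card I) = 1"
proof -
  show *: "degree (\<Prod>i\<in>I. [:a i, 1:]) = card I"
    by (subst degree_prod_eq_sum_degree) auto
  show "coeff (\<Prod>i\<in>I. [:a i, 1:]) (card I) = 1"
    using lead_coeff_prod[of "\<lambda>i. [:a i, 1:]" I] unfolding * by simp
qed

text \<open>Vieta's formulas for the first two elementary symmetric functions, with 2 e_2 written as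
  p_1^2 - p_2. They are proved together because the induction step for e_2 uses e_1.\<close>

lemma linear_prod_coeffs:
  fixes a :: "'i \<Rightarrow> real"
  assumes "finite I"
  shows "(card I = Suc k \<longrightarrow> coeff (\<Prod>i\<in>I. [:a i, 1:]) k = sum a I) \<and>
         (card I = Suc (Suc k) \<longrightarrow> 2 * coeff (\<Prod>i\<in>I. [:a i, 1:]) k = (sum a I)\<^sup>2 - (\<Sum>i\<in>I. (a i)\<^sup>2))"
  using assms
proof (induction arbitrary: k rule: finite_induct)
  case (insert x F)
  show ?case
  proof (intro conjI impI)
    assume "card (insert x F) = Suc k"
    then have c: "card F = k" using insert by simp
    have *: "coeff (\<Prod>i\<in>F. [:a i, 1:]) k = 1" using linear_prod_degree(2)[OF insert(1), of a] c by simp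
    show "coeff (\<Prod>i\<in>insert x F. [:a i, 1:]) k = sum a (insert x F)"
      using insert.IH[of "k - 1"] insert.hyps c *
      by (cases k) (auto simp: coeff_pCons)
  next
    assume "card (insert x F) = Suc (Suc k)"
    then have c: "card F = Suc k" using insert by simp
    have 1: "coeff (\<Prod>i\<in>F. [:a i, 1:]) k = sum a F" using insert.IH[of k] c by simp
    show "2 * coeff (\<Prod>i\<in>insert x F. [:a i, 1:]) k = (sum a (insert x F))\<^sup>2 - (\<Sum>i\<in>insert x F. (a i)\<^sup>2)"
    proof (cases k)
      \<comment> \<open>For a single remaining factor e_2 has no coefficient index of its own, so
        the induction hypothesis does not cover it.\<close>
      case 0
      then obtain y where "F = {y}" using c by (auto simp: card_1_singleton_iff)
      then show ?thesis using 0 insert.hyps by (simp add: coeff_pCons power2_eq_square algebra_simps)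
    next
      case (Suc k')
      then have "2 * coeff (\<Prod>i\<in>F. [:a i, 1:]) k' = (sum a F)\<^sup>2 - (\<Sum>i\<in>F. (a i)\<^sup>2)"
        using insert.IH[of k'] c by simp
      then show ?thesis using 1 Suc insert.hyps
        by (simp add: coeff_pCons power2_eq_square algebra_simps)
    qed
  qed
qed simp

text \<open>\<open>P\<close> equals its interpolant at the nodes. The basis polynomials are monic of
  degree \<open>card I - 1\<close>, so comparing the coefficients at this degree gives the
  sum.\<close>

lemma lagrange_top_coeff:
  fixes a :: "'i \<Rightarrow> real"
  assumes I: "finite I" and inj: "inj_on a I" and P: "degree P < card I"
  shows "(\<Sum>i\<in>I. poly P (a i) / (\<Prod>j\<in>I - {i}. a i - a j)) = coeff P (card I - 1)"
proof -
  define B where "B i = (\<Prod>j\<in>I - {i}. [:- a j, 1:])" for i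
  define R where "R = (\<Sum>i\<in>I. smult (poly P (a i) / (\<Prod>j\<in>I - {i}. a i - a j)) (B i))"
  have B: "degree (B i) = card I - 1" "coeff (B i) (card I - 1) = 1" if "i \<in> I" for i
    using linear_prod_degree[of "I - {i}" "\<lambda>j. - a j"] I that by (auto simp: B_def)
  have pB: "poly (B i) x = (\<Prod>j\<in>I - {i}. x - a j)" for i x
    by (simp add: B_def poly_prod)
  have "R = P"
  proof (rule poly_eqI_degree[of "a ` I"])
    show "card (a ` I) > degree P" using card_image[OF inj] P by simp
    have "degree R \<le> card I - 1" unfolding R_def
      by (rule degree_sum_le[OF I]) (use B(1) in \<open>auto intro!: order_trans[OF degree_smult_le]\<close>)
    then show "card (a ` I) > degree R" using card_image[OF inj] P by simp
    fix x assume "x \<in> a ` I"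
    then obtain k where k: "k \<in> I" "x = a k" by blast
    have nz: "(\<Prod>j\<in>I - {k}. a k - a j) \<noteq> 0" using I inj k by (auto simp: inj_on_def)
    have "poly R x = (\<Sum>i\<in>I. poly P (a i) / (\<Prod>j\<in>I - {i}. a i - a j) * (\<Prod>j\<in>I - {i}. a k - a j))"
      by (simp add: R_def poly_sum pB k(2))
    also have "\<dots> = (\<Sum>i\<in>{k}. poly P (a i) / (\<Prod>j\<in>I - {i}. a i - a j) * (\<Prod>j\<in>I - {i}. a k - a j))"
    proof (rule sum.mono_neutral_right[OF I])
      show "\<forall>i\<in>I - {k}. poly P (a i) / (\<Prod>j\<in>I - {i}. a i - a j) * (\<Prod>j\<in>I - {i}. a k - a j) = 0"
        using I k by (auto intro!: bexI[of _ k])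
    qed (use k in auto)
    also have "\<dots> = poly P x" using nz by (simp add: k)
    finally show "poly R x = poly P x" .
  qed
  then have "coeff P (card I - 1) = coeff R (card I - 1)" by simp
  also have "\<dots> = (\<Sum>i\<in>I. poly P (a i) / (\<Prod>j\<in>I - {i}. a i - a j))"
    by (auto simp: R_def coeff_sum B(2)[simplified] intro!: sum.cong)
  finally show ?thesis by simp
qed

text \<open>The left side is an interpolation sum for a polynomial of degree below
  \<open>card I\<close>; the right side is its coefficient of degree \<open>card I - 1\<close>. Two
  or more nodes are assumed so that the three leading coefficients of \<open>Q\<close> and
  \<open>Q1\<close> exist.\<close>

lemma lagrange_shift_sum:
  fixes a :: "'i \<Rightarrow> real"
  assumes I: "finite I" and inj: "inj_on a I" and N: "card I = Suc (Suc k)"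
  shows "(\<Sum>i\<in>I. a i * (\<Prod>j\<in>I - {i}. (a i - 1 - a j) / (a i - a j)))
       = sum a I - real (card I) * (real (card I) - 1) / 2"
proof -
  define n where "n = real (card I)"
  define Q where "Q = (\<Prod>j\<in>I. [:- a j, 1:])"
  define Q1 where "Q1 = (\<Prod>j\<in>I. [:- a j - 1, 1:])"
  \<comment> \<open>At a node, \<open>- x * Q1\<close> already gives the required numerator, since
    the factor with j = i is -1. The multiple \<open>(x - n) * Q\<close> vanishes at all nodes and
    is chosen to cancel the coefficients of degrees n + 1 and n.\<close>
  define P where "P = [:-n, 1:] * Q - [:0, 1:] * Q1"
  have Qc: "coeff Q (Suc (Suc k)) = 1" "coeff Q (Suc k) = - sum a I"
      "2 * coeff Q k = (sum a I)\<^sup>2 - (\<Sum>i\<in>I. (a i)\<^sup>2)"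
    using linear_prod_degree[OF I, of "\<lambda>i. - a i"] linear_prod_coeffs[OF I, of _ "\<lambda>i. - a i"] N
    by (auto simp: Q_def sum_negf)
  have Q1c: "coeff Q1 (Suc (Suc k)) = 1" "coeff Q1 (Suc k) = - sum a I - n"
      "2 * coeff Q1 k = (sum a I + n)\<^sup>2 - ((\<Sum>i\<in>I. (a i)\<^sup>2) + 2 * sum a I + n)"
  proof -
    have s: "(\<Sum>i\<in>I. - a i - 1) = - sum a I - n" by (simp add: sum_subtractf sum_negf n_def)
    have s2: "(\<Sum>i\<in>I. (- a i - 1)\<^sup>2) = (\<Sum>i\<in>I. (a i)\<^sup>2) + 2 * sum a I + n"
      by (simp add: power2_eq_square algebra_simps sum.distrib n_def flip: sum_distrib_right)
    show "coeff Q1 (Suc (Suc k)) = 1" "coeff Q1 (Suc k) = - sum a I - n"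
      "2 * coeff Q1 k = (sum a I + n)\<^sup>2 - ((\<Sum>i\<in>I. (a i)\<^sup>2) + 2 * sum a I + n)"
      using linear_prod_degree[OF I, of "\<lambda>i. - a i - 1"] linear_prod_coeffs[OF I, of _ "\<lambda>i. - a i - 1"] N
      unfolding s s2 by (auto simp: Q1_def power2_eq_square algebra_simps)
  qed
  have dQ: "degree Q = Suc (Suc k)" "degree Q1 = Suc (Suc k)"
    using linear_prod_degree(1)[OF I] N by (auto simp: Q_def Q1_def)
  have n: "n = 2 + real k" using N by (simp add: n_def)
  have cP: "coeff P (Suc i) = - n * coeff Q (Suc i) + coeff Q i - coeff Q1 i" for i
    by (simp add: P_def coeff_pCons)
  have "coeff P i = 0" if "Suc k < i" for i
  proof -
    have "i = Suc (Suc k) \<or> i = Suc (Suc (Suc k)) \<or> (i = Suc (i - 1) \<and> Suc (Suc k) < i - 1)"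
      using that by auto
    then consider "i = Suc (Suc k)" | "i = Suc (Suc (Suc k))" | "i = Suc (i - 1)" "Suc (Suc k) < i - 1"
      by blast
    then show ?thesis
    proof cases
      case 1
      then show ?thesis using cP[of "Suc k"] Qc Q1c by simp
    next
      case 2
      then show ?thesis using cP[of "Suc (Suc k)"] Qc Q1c dQ by (simp add: coeff_eq_0)
    next
      case 3
      then show ?thesis using cP[of "i - 1"] dQ by (simp add: coeff_eq_0)
    qed
  qed
  then have "degree P \<le> Suc k" by (intro degree_le) auto
  then have dP: "degree P < card I" using N by simp
  have cPk: "coeff P (card I - 1) = sum a I - n * (n - 1) / 2"
  proof -
    have "2 * coeff P (Suc k) = 2 * sum a I - n * (n - 1)"
      using Qc Q1c unfolding cP by (simp add: power2_eq_square algebra_simps)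
    then show ?thesis using N by (simp add: field_simps)
  qed
  have "a i * (\<Prod>j\<in>I - {i}. (a i - 1 - a j) / (a i - a j)) = poly P (a i) / (\<Prod>j\<in>I - {i}. a i - a j)"
    if i: "i \<in> I" for i
  proof -
    have "poly Q (a i) = 0" using I i by (auto simp: Q_def poly_prod)
    moreover have "poly Q1 (a i) = - (\<Prod>j\<in>I - {i}. a i - 1 - a j)"
      using prod.remove[OF I i, of "\<lambda>j. a i - 1 - a j"] by (simp add: Q1_def poly_prod algebra_simps)
    ultimately show ?thesis by (simp add: P_def prod_dividef)
  qed
  then have "(\<Sum>i\<in>I. a i * (\<Prod>j\<in>I - {i}. (a i - 1 - a j) / (a i - a j)))
      = (\<Sum>i\<in>I. poly P (a i) / (\<Prod>j\<in>I - {i}. a i - a j))" by (intro sum.cong) auto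
  also have "\<dots> = sum a I - n * (n - 1) / 2"
    using lagrange_top_coeff[OF I inj dP] cPk by simp
  finally show ?thesis by (simp add: n_def)
qed

section \<open>Frobenius' formula derived from the branching rule\<close>

definition shifted :: "nat \<Rightarrow> (nat \<Rightarrow> nat) \<Rightarrow> nat \<Rightarrow> real" where
  "shifted N f i = real (f i + (N - 1 - i))"

text \<open>The values of \<open>shifted\<close> are the beta numbers of the partition padded by
  zero rows to \<open>N\<close> rows; their differences are differences of superdiagonals at the row
  ends. Keeping \<open>N\<close> as a parameter lets all shapes in one sum share the same set of
  nodes.\<close>

definition frobenius :: "nat \<Rightarrow> (nat \<Rightarrow> nat) \<Rightarrow> real" where
  "frobenius N f = fact (\<Sum>i<N. f i) * (\<Prod>(i, j)\<in>{(i, j). i < j \<and> j < N}. shifted N f i - shifted N f j)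
     / (\<Prod>i<N. fact (f i + (N - 1 - i)))"

lemma shifted_strict:
  assumes "antimono f" "i < j" "j < N"
  shows "shifted N f j < shifted N f i"
  using antimonoD[OF assms(1), of i j] assms by (simp add: shifted_def)

lemma shifted_inj: "antimono f \<Longrightarrow> inj_on (shifted N f) {..<N}"
  by (rule inj_onI) (metis lessThan_iff linorder_neqE_nat shifted_strict less_irrefl)

lemma finite_pairs: "finite {(i::nat, j). i < j \<and> j < N}"
  by (rule finite_subset[of _ "{..<N} \<times> {..<N}"]) auto

lemma frobenius_pos: "antimono f \<Longrightarrow> 0 < frobenius N f"
  unfolding frobenius_def
  by (intro divide_pos_pos mult_pos_pos prod_pos) (auto simp: shifted_strict)

text \<open>Isolates the factors that involve row \<open>k\<close>, the only ones affected when a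
  box is added there. The sign comes from the \<open>k\<close> pairs whose larger index is
  \<open>k\<close>.\<close>

lemma vandermonde_split:
  fixes a :: "nat \<Rightarrow> real"
  assumes "k < N"
  shows "(\<Prod>(i, j)\<in>{(i, j). i < j \<and> j < N}. a i - a j)
    = (-1) ^ k * (\<Prod>j\<in>{..<N} - {k}. a k - a j)
      * (\<Prod>(i, j)\<in>{(i, j). i < j \<and> j < N \<and> i \<noteq> k \<and> j \<noteq> k}. a i - a j)"
proof -
  let ?A = "(\<lambda>j. (k, j)) ` {k<..<N}" and ?B = "(\<lambda>i. (i, k)) ` {..<k}"
  let ?C = "{(i, j). i < j \<and> j < N \<and> i \<noteq> k \<and> j \<noteq> k}"
  have C: "finite ?C" by (rule finite_subset[OF _ finite_pairs[of N]]) auto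
  have eq: "{(i, j). i < j \<and> j < N} = (?A \<union> ?B) \<union> ?C" using assms by auto
  have "(\<Prod>(i, j)\<in>{(i, j). i < j \<and> j < N}. a i - a j)
      = (\<Prod>(i, j)\<in>?A. a i - a j) * (\<Prod>(i, j)\<in>?B. a i - a j) * (\<Prod>(i, j)\<in>?C. a i - a j)"
  proof -
    have "prod h (?A \<union> ?B \<union> ?C) = prod h (?A \<union> ?B) * prod h ?C" for h :: "nat \<times> nat \<Rightarrow> real"
      by (rule prod.union_disjoint) (use C in auto)
    moreover have "prod h (?A \<union> ?B) = prod h ?A * prod h ?B" for h :: "nat \<times> nat \<Rightarrow> real"
      by (rule prod.union_disjoint) auto
    ultimately show ?thesis unfolding eq by simp
  qed
  also have "(\<Prod>(i, j)\<in>?A. a i - a j) = (\<Prod>j\<in>{k<..<N}. a k - a j)"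
    by (subst prod.reindex) (auto simp: inj_on_def)
  also have "(\<Prod>(i, j)\<in>?B. a i - a j) = (\<Prod>i<k. - (a k - a i))"
    by (subst prod.reindex) (auto simp: inj_on_def)
  also have "(\<Prod>i<k. - (a k - a i)) = (-1) ^ k * (\<Prod>i<k. a k - a i)"
    by (subst prod_uminus) simp
  finally have *: "(\<Prod>(i, j)\<in>{(i, j). i < j \<and> j < N}. a i - a j)
      = (\<Prod>j\<in>{k<..<N}. a k - a j) * ((-1) ^ k * (\<Prod>i<k. a k - a i)) * (\<Prod>(i, j)\<in>?C. a i - a j)" .
  have un: "{..<N} - {k} = {..<k} \<union> {k<..<N}" using assms by auto
  have "(\<Prod>j\<in>{..<N} - {k}. a k - a j) = (\<Prod>i<k. a k - a i) * (\<Prod>j\<in>{k<..<N}. a k - a j)"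
    unfolding un by (rule prod.union_disjoint) auto
  then show ?thesis unfolding * by simp
qed

text \<open>Adding a box to row \<open>k\<close> multiplies the factorial in the numerator by the
  new size, the denominator by \<open>shifted N f k + 1\<close>, and moves one Vandermonde node by
  1. The identity is cross-multiplied to cover coinciding nodes. It serves both for deleting boxes,
  in the branching recursion, and for adding them, in the transition identity.\<close>

lemma frobenius_step:
  assumes k: "k < N"
  shows "frobenius N (f(k := Suc (f k))) * (shifted N f k + 1) * (\<Prod>j\<in>{..<N} - {k}. shifted N f k - shifted N f j)
    = frobenius N f * real (Suc (\<Sum>i<N. f i)) * (\<Prod>j\<in>{..<N} - {k}. shifted N f k + 1 - shifted N f j)"
proof -
  define g where "g = f(k := Suc (f k))"
  let ?a = "shifted N f" and ?b = "shifted N g"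
  have b: "?b k = ?a k + 1" "\<And>j. j \<noteq> k \<Longrightarrow> ?b j = ?a j" by (auto simp: shifted_def g_def)
  have sg: "(\<Sum>i<N. g i) = Suc (\<Sum>i<N. f i)"
  proof -
    have "(\<Sum>i<N. g i) = g k + (\<Sum>i\<in>{..<N} - {k}. g i)" using k by (intro sum.remove) auto
    also have "(\<Sum>i\<in>{..<N} - {k}. g i) = (\<Sum>i\<in>{..<N} - {k}. f i)" by (rule sum.cong) (auto simp: g_def)
    finally show ?thesis using k sum.remove[of "{..<N}" k f] by (simp add: g_def)
  qed
  have D: "(\<Prod>i<N. fact (g i + (N - 1 - i))) = (?a k + 1) * (\<Prod>i<N. fact (f i + (N - 1 - i)) :: real)"
  proof -
    have "(\<Prod>i<N. fact (g i + (N - 1 - i)) :: real)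
        = fact (g k + (N - 1 - k)) * (\<Prod>i\<in>{..<N} - {k}. fact (g i + (N - 1 - i)))"
      using k by (intro prod.remove) auto
    also have "(\<Prod>i\<in>{..<N} - {k}. fact (g i + (N - 1 - i)) :: real)
        = (\<Prod>i\<in>{..<N} - {k}. fact (f i + (N - 1 - i)))" by (rule prod.cong) (auto simp: g_def)
    also have "(fact (g k + (N - 1 - k)) :: real) = (?a k + 1) * fact (f k + (N - 1 - k))"
      by (simp add: g_def shifted_def)
    finally show ?thesis
      using k prod.remove[of "{..<N}" k "\<lambda>i. fact (f i + (N - 1 - i)) :: real"] by simp
  qed
  define C where "C = (\<Prod>(i, j)\<in>{(i, j). i < j \<and> j < N \<and> i \<noteq> k \<and> j \<noteq> k}. ?a i - ?a j)"
  have C': "(\<Prod>(i, j)\<in>{(i, j). i < j \<and> j < N \<and> i \<noteq> k \<and> j \<noteq> k}. ?b i - ?b j) = C"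
    unfolding C_def by (rule prod.cong) (auto simp: b)
  have P': "(\<Prod>j\<in>{..<N} - {k}. ?b k - ?b j) = (\<Prod>j\<in>{..<N} - {k}. ?a k + 1 - ?a j)"
    by (rule prod.cong) (auto simp: b)
  have nz: "(\<Prod>i<N. fact (f i + (N - 1 - i)) :: real) \<noteq> 0" "?a k + 1 \<noteq> 0"
    by (auto simp: shifted_def add_eq_0_iff)
  define F s A A' where "F = (\<Prod>i<N. fact (f i + (N - 1 - i)) :: real)" and "s = ?a k + 1"
    and "A = (\<Prod>j\<in>{..<N} - {k}. ?a k - ?a j)" and "A' = (\<Prod>j\<in>{..<N} - {k}. ?a k + 1 - ?a j)"
  have "frobenius N g = fact (Suc (\<Sum>i<N. f i)) * ((-1) ^ k * A' * C) / (s * F)"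
    unfolding frobenius_def sg D vandermonde_split[OF k, of ?b] C' P' F_def s_def A'_def ..
  moreover have "frobenius N f = fact (\<Sum>i<N. f i) * ((-1) ^ k * A * C) / F"
    unfolding frobenius_def vandermonde_split[OF k, of ?a] C_def F_def A_def ..
  ultimately have "frobenius N g * s * A = frobenius N f * real (Suc (\<Sum>i<N. f i)) * A'"
    using nz[folded F_def s_def] by simp
  then show ?thesis unfolding g_def s_def A_def A'_def .
qed

lemma frobenius_zero: "frobenius N (\<lambda>_. 0) = 1"
proof -
  have "(\<Prod>(i, j)\<in>{(i, j). i < j \<and> j < N}. shifted N (\<lambda>_. 0) i - shifted N (\<lambda>_. 0) j)
      = (\<Prod>(i, j)\<in>Sigma {..<N} (\<lambda>i. {i<..<N}). real (j - i))"
    by (rule prod.cong) (auto simp: shifted_def of_nat_diff)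
  also have "\<dots> = (\<Prod>i<N. \<Prod>j\<in>{i<..<N}. real (j - i))"
    by (subst prod.Sigma) auto
  also have "\<dots> = (\<Prod>i<N. fact (N - 1 - i))"
  proof (rule prod.cong[OF refl])
    fix i assume "i \<in> {..<N}"
    have "(\<Prod>j\<in>{i<..<N}. real (j - i)) = (\<Prod>k\<in>{1..N - 1 - i}. real k)"
      by (rule prod.reindex_bij_witness[of _ "\<lambda>k. k + i" "\<lambda>j. j - i"]) auto
    then show "(\<Prod>j\<in>{i<..<N}. real (j - i)) = fact (N - 1 - i)" by (simp add: fact_prod)
  qed
  finally show ?thesis by (simp add: frobenius_def)
qed

text \<open>Let S be the size. After multiplication by S, the term of a removable row becomes
  \<open>frobenius N f * T i\<close>. The sum of all \<open>T i\<close> is S, because the correction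
  N(N-1)/2 in the interpolation sum is exactly the total of the shifts
  \<open>N - 1 - i\<close>.\<close>

lemma frobenius_branching:
  assumes N: "N = Suc (Suc M)" and f: "antimono f" "f N = 0" and pos: "0 < (\<Sum>i<N. f i)"
  shows "frobenius N f = (\<Sum>i\<in>{i. f (Suc i) < f i}. frobenius N (f(i := f i - 1)))"
proof -
  let ?a = "shifted N f" and ?S = "real (\<Sum>i<N. f i)"
  define T where "T i = ?a i * (\<Prod>j\<in>{..<N} - {i}. (?a i - 1 - ?a j) / (?a i - ?a j))" for i
  have nz: "(\<Prod>j\<in>{..<N} - {i}. ?a i - ?a j) \<noteq> 0" if "i < N" for i
    using shifted_inj[OF f(1), of N] that by (auto simp: inj_on_def)
  have rem: "?S * frobenius N (f(i := f i - 1)) = frobenius N f * T i" if i: "f (Suc i) < f i" "i < N" for i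
  proof -
    define g where "g = f(i := f i - 1)"
    have g: "g(i := Suc (g i)) = f" using i by (auto simp: g_def fun_eq_iff)
    have ga: "shifted N g i = ?a i - 1" "\<And>j. j \<noteq> i \<Longrightarrow> shifted N g j = ?a j"
      using i by (auto simp: shifted_def g_def of_nat_diff)
    have "(\<Sum>j<N. f j) = Suc (\<Sum>j<N. g j)"
    proof -
      have "(\<Sum>j<N. g j) = g i + (\<Sum>j\<in>{..<N} - {i}. g j)" using i by (intro sum.remove) auto
      also have "(\<Sum>j\<in>{..<N} - {i}. g j) = (\<Sum>j\<in>{..<N} - {i}. f j)" by (rule sum.cong) (auto simp: g_def)
      finally show ?thesis using i sum.remove[of "{..<N}" i f] by (simp add: g_def)
    qed
    then have S: "real (Suc (\<Sum>j<N. g j)) = ?S" by simp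
    have 1: "(\<Prod>j\<in>{..<N} - {i}. shifted N g i - shifted N g j) = (\<Prod>j\<in>{..<N} - {i}. ?a i - 1 - ?a j)"
      by (rule prod.cong) (auto simp: ga)
    have 2: "(\<Prod>j\<in>{..<N} - {i}. shifted N g i + 1 - shifted N g j) = (\<Prod>j\<in>{..<N} - {i}. ?a i - ?a j)"
      by (rule prod.cong) (auto simp: ga)
    have "frobenius N f * ?a i * (\<Prod>j\<in>{..<N} - {i}. ?a i - 1 - ?a j)
        = frobenius N g * ?S * (\<Prod>j\<in>{..<N} - {i}. ?a i - ?a j)"
      using frobenius_step[OF i(2), of g] unfolding g 1 2 S by (simp add: ga(1))
    then show ?thesis using nz[OF i(2)] 
      unfolding T_def g_def[symmetric] prod_dividef by (simp add: field_simps)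
  qed
  \<comment> \<open>A row as long as the next one has \<open>?a i - 1 = ?a (Suc i)\<close>, which
    kills a factor; for the last row the factor \<open>?a i\<close> itself is 0. The interpolation
    sum over all rows thus reduces to the removable ones.\<close>
  have T0: "T i = 0" if i: "i < N" "\<not> f (Suc i) < f i" for i
  proof (cases "Suc i < N")
    case True
    have "f (Suc i) = f i" using antimonoD[OF f(1), of i "Suc i"] i by simp
    then have "?a i - 1 - ?a (Suc i) = 0" using True by (simp add: shifted_def of_nat_diff)
    moreover have "Suc i \<in> {..<N} - {i}" using True by auto
    ultimately have "(\<Prod>j\<in>{..<N} - {i}. (?a i - 1 - ?a j) / (?a i - ?a j)) = 0"
      by (intro prod_zero) (auto intro!: bexI[of _ "Suc i"])
    then show ?thesis by (simp add: T_def)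
  next
    case False
    then have "Suc i = N" using i by simp
    then have "?a i = 0" using i f(2) by (auto simp: shifted_def)
    then show ?thesis by (simp add: T_def)
  qed
  have sub: "{i. f (Suc i) < f i} \<subseteq> {..<N}"
  proof
    fix i assume "i \<in> {i. f (Suc i) < f i}"
    then show "i \<in> {..<N}" using antimonoD[OF f(1), of N i] f(2) by (cases "i < N") auto
  qed
  have suma: "sum ?a {..<N} = ?S + real N * (real N - 1) / 2"
  proof -
    have "(\<Sum>i<N. N - 1 - i) = (\<Sum>i<N. i)"
      by (rule sum.reindex_bij_witness[of _ "\<lambda>i. N - 1 - i" "\<lambda>i. N - 1 - i"]) auto
    then have "real (\<Sum>i<N. N - 1 - i) = (\<Sum>i<N. real i)" by simp
    also have "\<dots> = real N * (real N - 1) / 2" by (induction N) (auto simp: field_simps)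
    finally have "real (\<Sum>i<N. N - 1 - i) = real N * (real N - 1) / 2" .
    moreover have "sum ?a {..<N} = (\<Sum>i<N. real (f i) + real (N - 1 - i))"
      by (rule sum.cong) (auto simp: shifted_def)
    then have "sum ?a {..<N} = ?S + real (\<Sum>i<N. N - 1 - i)"
      by (simp only: sum.distrib of_nat_sum)
    ultimately show ?thesis by simp
  qed
  have "?S * frobenius N f = frobenius N f * (\<Sum>i<N. T i)"
    using lagrange_shift_sum[OF _ shifted_inj[OF f(1)], of N M] N suma by (simp add: T_def)
  also have "(\<Sum>i<N. T i) = (\<Sum>i\<in>{i. f (Suc i) < f i}. T i)"
    by (rule sum.mono_neutral_right) (use sub T0 in auto)
  also have "frobenius N f * \<dots> = ?S * (\<Sum>i\<in>{i. f (Suc i) < f i}. frobenius N (f(i := f i - 1)))"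
    unfolding sum_distrib_left by (rule sum.cong) (use rem sub in auto)
  finally show ?thesis using pos by (auto simp del: of_nat_sum)
qed

text \<open>Both sides satisfy the same recursion over removable rows and agree at the empty
  partition. \<open>N\<close> stays fixed in the induction, since deleting a box does not lengthen
  the partition.\<close>

lemma dimn_frobenius:
  assumes "is_partition la" "length la \<le> N" "N = Suc (Suc M)"
  shows "real (dimn la) = frobenius N (row la)"
  using assms(1,2)
proof (induction "sum_list la" arbitrary: la)
  case 0
  then have la: "la = []" by (cases la) (auto simp: is_partition_def partition_of_def)
  have "Tab la = {\<lambda>_. 0}" by (auto simp: la Tab_def diagram_def bij_betw_def inj_on_def)
  moreover have "row la = (\<lambda>_. 0)" by (auto simp: row_def la)
  ultimately show ?case by (simp add: dimn_def frobenius_zero)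
next
  case (Suc n)
  have am: "antimono (row la)" by (rule row_antimono'[OF Suc.prems(1)])
  have "real (dimn la) = (\<Sum>i\<in>removable_rows la. real (dimn (del_row la i)))"
    using dimn_branching[OF Suc.prems(1)] Suc(2) by simp
  also have "\<dots> = (\<Sum>i\<in>removable_rows la. frobenius N ((row la)(i := row la i - 1)))"
  proof (rule sum.cong[OF refl])
    fix i assume i: "i \<in> removable_rows la"
    note d = del_row[OF Suc.prems(1) i]
    show "real (dimn (del_row la i)) = frobenius N ((row la)(i := row la i - 1))"
      using Suc(1)[OF _ d(2)] sum_list_row_insert[OF d(4)] Suc(2) d(3) Suc.prems(2) d(1) by simp
  qed
  also have "\<dots> = frobenius N (row la)"
    unfolding removable_rows_def
    by (rule frobenius_branching[symmetric, OF assms(3) am])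
      (use Suc(2) sum_row[OF Suc.prems(2)] Suc.prems(2) row_eq_0 in auto)
  finally show ?case .
qed

lemma dimn_pos: "is_partition la \<Longrightarrow> 0 < dimn la"
  using dimn_frobenius[of la "Suc (Suc (length la))"] frobenius_pos[OF row_antimono'] 
  by (metis le_SucI order_refl of_nat_0_less_iff)

lemma superdiag_row: "superdiag (Suc i, j) = int j - int (Suc i)"
  by (simp add: superdiag_def)

text \<open>Each summand is a value of one polynomial \<open>P\<close> of degree N - 2 divided by
  the interpolation denominator, whereas N nodes extract the coefficient of degree N - 1.\<close>

lemma transition_sum_zero:
  assumes \<mu>: "is_partition \<mu>" and r: "r \<in> removable \<mu>"
  shows "(\<Sum>la\<in>up \<mu>. real (dimn la) / real_of_int (axial (added_box la \<mu>) r)) = 0"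
proof -
  \<comment> \<open>Two padding rows: row \<open>length \<mu>\<close> may be addable, and row
    \<open>N - 1\<close> is a further zero row, with shifted part 0, which is not addable.\<close>
  define N where "N = Suc (Suc (length \<mu>))"
  define f where "f = row \<mu>"
  let ?a = "shifted N f"
  have am: "antimono f" unfolding f_def by (rule row_antimono'[OF \<mu>])
  have inj: "inj_on ?a {..<N}" by (rule shifted_inj[OF am])
  from r obtain q where q: "q \<in> removable_rows \<mu>" "r = (Suc q, f q)"
    by (auto simp: removable_eq[OF \<mu>] f_def)
  have qN: "q < N - 1" using q by (auto simp: removable_rows_def row_def N_def split: if_splits)
  have fq: "f (Suc q) < f q" using q by (simp add: removable_rows_def f_def)
  have fN: "f (N - 1) = 0" by (simp add: f_def N_def row_def)
  \<comment> \<open>Of the factors \<open>x + 1 - ?a j\<close>, two are omitted. The one for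
    \<open>q\<close> is the axial distance to \<open>r\<close>; the one for \<open>N - 1\<close> is
    \<open>x + 1\<close>, the factor by which the factorials change. Both cancel in the summand,
    which lowers the degree.\<close>
  define P where "P = (\<Prod>j\<in>{..<N} - {q, N - 1}. [:1 - ?a j, 1:])"
  define c where "c = frobenius N f * real (Suc (\<Sum>i<N. f i))"
  define G where "G i = c * (poly P (?a i) / (\<Prod>j\<in>{..<N} - {i}. ?a i - ?a j))" for i
  have poly: "poly P x = (\<Prod>j\<in>{..<N} - {q, N - 1}. x + 1 - ?a j)" for x
    by (simp add: P_def poly_prod algebra_simps)
  have nz: "(\<Prod>j\<in>{..<N} - {i}. ?a i - ?a j) \<noteq> 0" if "i < N" for i
    using inj that by (auto simp: inj_on_def)
  have sub: "addable_rows \<mu> \<subseteq> {..<N}" by (rule addable_rows_subset[OF \<mu>]) (simp add: N_def)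
  \<comment> \<open>No addable box lies on the superdiagonal of \<open>r\<close>: rows below
    \<open>q\<close> are strictly shorter, so their nodes stay at least 2 below \<open>?a q\<close>,
    while rows above have larger nodes.\<close>
  have neq: "?a i + 1 - ?a q \<noteq> 0" if "i < N" for i
  proof -
    consider "i = q" | "i < q" | "q < i" by linarith
    then show ?thesis
    proof cases
      case 2
      have "q < N" using qN by simp
      then show ?thesis using shifted_strict[OF am 2, of N] by simp
    next
      case 3
      then have "f i \<le> f (Suc q)" using antimonoD[OF am, of "Suc q" i] by simp
      then show ?thesis using 3 fq that qN by (simp add: shifted_def)
    qed simp
  qed
  \<comment> \<open>Omitting j = i is harmless because that factor equals 1. Hence the product may
    be taken over all rows before splitting off \<open>q\<close> and \<open>N - 1\<close>.\<close>
  have full: "(\<Prod>j\<in>{..<N} - {i}. ?a i + 1 - ?a j) = poly P (?a i) * (?a i + 1) * (?a i + 1 - ?a q)"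
    if i: "i < N" for i
  proof -
    have "(\<Prod>j<N. ?a i + 1 - ?a j) = (\<Prod>j\<in>{..<N} - {i}. ?a i + 1 - ?a j)"
      using i by (subst prod.remove[of _ i]) auto
    moreover have "(\<Prod>j<N. ?a i + 1 - ?a j)
        = (\<Prod>j\<in>{q, N - 1}. ?a i + 1 - ?a j) * (\<Prod>j\<in>{..<N} - {q, N - 1}. ?a i + 1 - ?a j)"
      using qN by (intro prod.subset_diff[THEN trans[OF _ mult.commute]]) auto
    moreover have "(\<Prod>j\<in>{q, N - 1}. ?a i + 1 - ?a j) = (?a i + 1 - ?a q) * (?a i + 1)"
      using qN fN by (simp add: shifted_def)
    ultimately show ?thesis by (simp add: poly mult_ac)
  qed
  have G: "G i = real (dimn (add_row \<mu> i)) / real_of_int (axial (added_box (add_row \<mu> i) \<mu>) r)"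
    if i: "i \<in> addable_rows \<mu>" for i
  proof -
    have iN: "i < N" using sub i by auto
    note ar = add_row[OF \<mu> i]
    have len: "length (add_row \<mu> i) \<le> N"
      using row_pos_iff[OF ar(2), of N] sub i ar(1) by (auto simp: N_def row_def)
    have d: "real (dimn (add_row \<mu> i)) = frobenius N (f(i := Suc (f i)))"
      using dimn_frobenius[OF ar(2) len N_def] ar(1) by (simp add: f_def)
    have a: "real_of_int (axial (added_box (add_row \<mu> i) \<mu>) r) = ?a i + 1 - ?a q"
      using iN qN by (simp add: added_box_row[OF ar(1)] axial_def superdiag_row q(2) shifted_def f_def of_nat_diff)
    have p: "?a i + 1 \<noteq> 0" by (simp add: shifted_def add_eq_0_iff)
    have "frobenius N (f(i := Suc (f i))) * (?a i + 1) * (\<Prod>j\<in>{..<N} - {i}. ?a i - ?a j)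
        = c * (poly P (?a i) * (?a i + 1) * (?a i + 1 - ?a q))"
      using frobenius_step[OF iN, of f] unfolding full[OF iN] c_def .
    moreover have "c * (p / A) = F / d" if "F * s * A = c * (p * s * d)" "s \<noteq> 0" "d \<noteq> 0" "A \<noteq> 0"
      for F s A p d :: real
    proof -
      have "(F * A) * s = (c * p * d) * s" using that(1) by (simp add: mult_ac)
      then have "F * A = c * p * d" using that(2) by simp
      then show ?thesis using that by (simp add: field_simps)
    qed
    ultimately show ?thesis using p neq[OF iN] nz[OF iN] unfolding G_def d a by blast
  qed
  \<comment> \<open>If row \<open>i\<close> has the length of row \<open>i - 1\<close>, then the
    factor of \<open>P\<close> for \<open>i - 1\<close> vanishes at \<open>?a i\<close>; this factor
    was not omitted, because row \<open>q\<close> is strictly longer than the next one.\<close>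
  have G0: "G i = 0" if i: "i < N" "i \<notin> addable_rows \<mu>" for i
  proof -
    have i': "0 < i" "f i = f (i - 1)"
      using i antimonoD[OF am, of "i - 1" i] by (auto simp: addable_rows_def f_def)
    have "?a i + 1 - ?a (i - 1) = 0" using i' i(1) by (simp add: shifted_def of_nat_diff)
    moreover have "i - 1 \<in> {..<N} - {q, N - 1}" using i' i(1) fq by (auto simp: Suc_diff_Suc)
    ultimately have "poly P (?a i) = 0" unfolding poly by (intro prod_zero) auto
    then show ?thesis by (simp add: G_def)
  qed
  have "(\<Sum>la\<in>up \<mu>. real (dimn la) / real_of_int (axial (added_box la \<mu>) r)) = (\<Sum>i\<in>addable_rows \<mu>. G i)"
    by (subst sum.reindex_bij_betw[OF bij_betw_add_row[OF \<mu>], symmetric]) (auto simp: G intro!: sum.cong)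
  also have "\<dots> = (\<Sum>i<N. G i)"
    by (rule sum.mono_neutral_left) (use sub G0 in auto)
  also have "\<dots> = c * (\<Sum>i<N. poly P (?a i) / (\<Prod>j\<in>{..<N} - {i}. ?a i - ?a j))"
    by (simp add: G_def sum_distrib_left)
  also have "\<dots> = c * coeff P (N - 1)"
  proof -
    have "card ({..<N} - {q, N - 1}) = N - 2" using qN by (subst card_Diff_subset) auto
    then have "degree P = N - 2" unfolding P_def by (subst linear_prod_degree(1)) auto
    then show ?thesis
      using lagrange_top_coeff[OF _ inj, of P] by (simp add: N_def)
  qed
  also have "coeff P (N - 1) = 0"
  proof (rule coeff_eq_0)
    have "card ({..<N} - {q, N - 1}) = N - 2" using qN by (subst card_Diff_subset) auto
    then show "degree P < N - 1" unfolding P_def by (subst linear_prod_degree(1)) (auto simp: N_def)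
  qed
  finally show ?thesis by simp
qed

section \<open>Young's orthogonal form\<close>

definition filling :: "nat list \<Rightarrow> tableau \<Rightarrow> bool" where
  "filling la T \<longleftrightarrow> bij_betw T (diagram la) {1..sum_list la}"

definition tab_content :: "nat list \<Rightarrow> tableau \<Rightarrow> nat \<Rightarrow> real" where
  "tab_content la T a = real_of_int (superdiag (box_of la T a))"

definition diag_coeff :: "real \<Rightarrow> real \<Rightarrow> real" where
  "diag_coeff x y = 1 / (y - x)"

definition off_coeff :: "real \<Rightarrow> real \<Rightarrow> real" where
  "off_coeff x y = sqrt (1 - 1 / (y - x)\<^sup>2)"

lemma coeff_sym: "diag_coeff y x = - diag_coeff x y" "off_coeff y x = off_coeff x y"
  by (simp_all add: diag_coeff_def off_coeff_def power2_commute minus_divide_right)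

lemma real_axial_tab: "real_of_int (axial_tab la T a b) = tab_content la T a - tab_content la T b"
  by (simp add: axial_tab_def axial_def tab_content_def)

lemma Tab_filling: "T \<in> Tab la \<Longrightarrow> filling la T"
  unfolding filling_def by (rule Tab_D)

lemma box_of_eq:
  assumes "filling la T" "b \<in> diagram la"
  shows "box_of la T (T b) = b"
  using assms unfolding box_of_def filling_def by (intro inv_into_f_f) (auto simp: bij_betw_def)

lemma box_of:
  assumes "filling la T" "1 \<le> a" "a \<le> sum_list la"
  shows "box_of la T a \<in> diagram la" "T (box_of la T a) = a"
proof -
  have "a \<in> T ` diagram la" using assms by (auto simp: filling_def bij_betw_def)
  then show "box_of la T a \<in> diagram la" "T (box_of la T a) = a"
    unfolding box_of_def by (rule inv_into_into, rule f_inv_into_f)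
qed

lemma adj_trans_invol [simp]: "adj_trans k (adj_trans k a) = a"
  by (simp add: adj_trans_def)

lemma adj_trans_comp_invol [simp]: "adj_trans k \<circ> (adj_trans k \<circ> T) = T"
  by (auto simp: fun_eq_iff)

lemma adj_trans_simps [simp]:
  "adj_trans k k = Suc k" "adj_trans k (Suc k) = k"
  "a \<noteq> k \<Longrightarrow> a \<noteq> Suc k \<Longrightarrow> adj_trans k a = a"
  by (auto simp: adj_trans_def)

lemma adj_trans_permutes:
  assumes "1 \<le> k" "k < n"
  shows "adj_trans k permutes {1..n}"
  using assms unfolding adj_trans_def by (intro permutes_swap_id) auto

lemma filling_swap:
  assumes "filling la T" "1 \<le> k" "k < sum_list la"
  shows "filling la (adj_trans k \<circ> T)"
  using assms bij_betw_trans permutes_imp_bij[OF adj_trans_permutes] unfolding filling_def by blast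

lemma content_swap:
  assumes T: "filling la T" and k: "1 \<le> k" "k < sum_list la" and a: "1 \<le> a" "a \<le> sum_list la"
  shows "tab_content la (adj_trans k \<circ> T) a = tab_content la T (adj_trans k a)"
proof -
  have s: "1 \<le> adj_trans k a" "adj_trans k a \<le> sum_list la"
    using permutes_in_image[OF adj_trans_permutes[OF k], of a] a by auto
  note b = box_of[OF T s]
  have "box_of la (adj_trans k \<circ> T) a = box_of la T (adj_trans k a)"
    using box_of_eq[OF filling_swap[OF T k] b(1)] b(2) by simp
  then show ?thesis by (simp add: tab_content_def)
qed

text \<open>From a box to the next on its diagonal there are two intermediate boxes, to the right
  and below, with distinct entries strictly between. This accounts for the gap of 3.\<close>

lemma Tab_same_diagonal:
  assumes la: "is_partition la" and T: "T \<in> Tab la"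
    and x: "(i, j) \<in> diagram la" and y: "(i', j') \<in> diagram la"
    and d: "int j - int i = int j' - int i'" and lt: "i < i'"
  shows "T (i, j) + 3 \<le> T (i', j')"
proof -
  note TD = Tab_D[OF T]
  have jj: "j < j'" using d lt by linarith
  have pos: "1 \<le> i" "1 \<le> j" using x by (auto simp: mem_diagram)
  have in1: "(i, Suc j) \<in> diagram la" "(Suc i, j) \<in> diagram la" "(Suc i, Suc j) \<in> diagram la"
      "(Suc i, j') \<in> diagram la"
    using diagram_down[OF la y] pos lt jj by auto
  have a: "T (i, j) < T (i, Suc j)" "T (i, j) < T (Suc i, j)"
    "T (i, Suc j) < T (Suc i, Suc j)" "T (Suc i, j) < T (Suc i, Suc j)"
    using TD(3)[OF x in1(1)] TD(4)[OF x in1(2)] TD(4)[OF in1(1,3)] TD(3)[OF in1(2,3)] by auto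
  have ne: "T (i, Suc j) \<noteq> T (Suc i, j)"
    using inj_onD[OF bij_betw_imp_inj_on[OF TD(1)] _ in1(1,2)] by auto
  have "T (Suc i, Suc j) \<le> T (Suc i, j')"
    using TD(3)[OF in1(3,4)] jj by (cases "Suc j = j'") auto
  also have "\<dots> \<le> T (i', j')"
    using TD(4)[OF in1(4) y] lt by (cases "Suc i = i'") auto
  finally show ?thesis using a ne by linarith
qed

text \<open>The range \<open>b \<le> a + 2\<close> covers the three entries involved in a braid
  relation, so all reciprocals of content differences there are meaningful.\<close>

lemma content_distinct:
  assumes la: "is_partition la" and T: "T \<in> Tab la" and a: "1 \<le> a" "a < b" "b \<le> a + 2" "b \<le> sum_list la"
  shows "tab_content la T a \<noteq> tab_content la T b"
proof
  assume eq: "tab_content la T a = tab_content la T b"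
  have f: "filling la T" by (rule Tab_filling[OF T])
  obtain i j i' j' where ij: "box_of la T a = (i, j)" "box_of la T b = (i', j')"
    by (metis surj_pair)
  have A: "(i, j) \<in> diagram la" "T (i, j) = a" "(i', j') \<in> diagram la" "T (i', j') = b"
    using box_of[OF f, of a] box_of[OF f, of b] a ij by auto
  have d: "int j - int i = int j' - int i'" using eq ij by (simp add: tab_content_def superdiag_def)
  consider "i < i'" | "i' < i" | "i = i'" by linarith
  then show False
  proof cases
    case 1
    then show False using Tab_same_diagonal[OF la T A(1,3) d] A a by simp
  next
    case 2
    then show False using Tab_same_diagonal[OF la T A(3,1) d[symmetric]] A a by simp
  next
    case 3
    then show False using A a d by auto
  qed
qed

text \<open>Exchanging \<open>k\<close> and \<open>k + 1\<close> reverses only the comparison of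
  their own two boxes. If that breaks standardness, they share a row or column, and no entry fits
  between them, so they are neighbours.\<close>

lemma swap_not_standard:
  assumes la: "is_partition la" and T: "T \<in> Tab la" and k: "1 \<le> k" "k < sum_list la"
    and ns: "adj_trans k \<circ> T \<notin> Tab la"
  shows "\<bar>tab_content la T (Suc k) - tab_content la T k\<bar> = 1"
proof -
  note TD = Tab_D[OF T]
  have f: "filling la T" by (rule Tab_filling[OF T])
  have f': "bij_betw (adj_trans k \<circ> T) (diagram la) {1..sum_list la}"
    using filling_swap[OF f k] by (simp add: filling_def)
  have z: "(adj_trans k \<circ> T) b = 0" if "b \<notin> diagram la" for b
    using TD(2)[OF that] k by simp
  have flip: "T x = k \<and> T y = Suc k" if "T x < T y" "\<not> (adj_trans k \<circ> T) x < (adj_trans k \<circ> T) y" for x y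
    using that by (auto simp: adj_trans_def transpose_def split: if_splits)
  have inj: "x = y" if "T x = T y" "x \<in> diagram la" "y \<in> diagram la" for x y
    using that TD(1) by (auto simp: bij_betw_def inj_on_def)
  have ct: "tab_content la T (T x) = real_of_int (superdiag x)" if "x \<in> diagram la" for x
    using box_of_eq[OF f that] by (simp add: tab_content_def)
  consider (row) i j j' where "(i, j) \<in> diagram la" "(i, j') \<in> diagram la" "j < j'"
        "\<not> (adj_trans k \<circ> T) (i, j) < (adj_trans k \<circ> T) (i, j')"
    | (col) i i' j where "(i, j) \<in> diagram la" "(i', j) \<in> diagram la" "i < i'"
        "\<not> (adj_trans k \<circ> T) (i, j) < (adj_trans k \<circ> T) (i', j)"
    using ns f' z unfolding Tab_def by blast
  then show ?thesis
  proof cases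
    case row
    have kk: "T (i, j) = k" "T (i, j') = Suc k"
      using flip[OF TD(3)[OF row(1,2,3)] row(4)] by auto
    have "j' = Suc j"
    proof (rule ccontr)
      assume "j' \<noteq> Suc j"
      then have "Suc j < j'" using row(3) by simp
      moreover then have "(i, Suc j) \<in> diagram la" using row(1,2) by (auto simp: mem_diagram)
      ultimately show False using TD(3)[of i j "Suc j"] TD(3)[of i "Suc j" j'] row kk by fastforce
    qed
    then show ?thesis using ct[OF row(1)] ct[OF row(2)] kk by (simp add: superdiag_def)
  next
    case col
    have kk: "T (i, j) = k" "T (i', j) = Suc k"
      using flip[OF TD(4)[OF col(1,2,3)] col(4)] by auto
    have "i' = Suc i"
    proof (rule ccontr)
      assume "i' \<noteq> Suc i"
      then have "Suc i < i'" using col(3) by simp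
      moreover then have "(Suc i, j) \<in> diagram la"
        using diagram_down[OF la col(2), of "Suc i" j] col(1) by (auto simp: mem_diagram)
      ultimately show False using TD(4)[of i j "Suc i"] TD(4)[of "Suc i" j i'] col kk by fastforce
    qed
    then show ?thesis using ct[OF col(1)] ct[OF col(2)] kk by (simp add: superdiag_def)
  qed
qed

text \<open>Young's formula read at a coordinate and freed of the requirement that the swapped
  filling be standard. Algebraic relations can be checked in this form without splitting into cases
  of standardness.\<close>

definition gen_fill :: "nat list \<Rightarrow> nat \<Rightarrow> (tableau \<Rightarrow> real) \<Rightarrow> (tableau \<Rightarrow> real)" where
  "gen_fill la k v S = diag_coeff (tab_content la S k) (tab_content la S (Suc k)) * v S
     + off_coeff (tab_content la S k) (tab_content la S (Suc k)) * v (adj_trans k \<circ> S)"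

lemma off_coeff_nonstandard:
  assumes "is_partition la" "T \<in> Tab la" "1 \<le> k" "k < sum_list la" "adj_trans k \<circ> T \<notin> Tab la"
  shows "off_coeff (tab_content la T k) (tab_content la T (Suc k)) = 0"
proof -
  have "(tab_content la T (Suc k) - tab_content la T k)\<^sup>2 = 1"
    using swap_not_standard[OF assms] by (metis one_power2 power2_abs)
  then show ?thesis by (simp add: off_coeff_def)
qed

lemma content_swap_pair:
  assumes "filling la T" "1 \<le> k" "k < sum_list la"
  shows "tab_content la (adj_trans k \<circ> T) k = tab_content la T (Suc k)"
    "tab_content la (adj_trans k \<circ> T) (Suc k) = tab_content la T k"
  using content_swap[OF assms, of k] content_swap[OF assms, of "Suc k"] assms by auto

text \<open>The coordinate at \<open>S\<close> receives contributions from \<open>S\<close> and from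
  the swapped tableau only. The off-diagonal coefficient is symmetric under the swap, and it
  vanishes when exactly one of the two fillings is standard.\<close>

lemma young_gen_apply:
  assumes la: "is_partition la" and k: "1 \<le> k" "k < sum_list la"
  shows "young_gen la k v S = (if S \<in> Tab la
     then diag_coeff (tab_content la S k) (tab_content la S (Suc k)) * v S +
       (if adj_trans k \<circ> S \<in> Tab la
        then off_coeff (tab_content la S k) (tab_content la S (Suc k)) * v (adj_trans k \<circ> S) else 0)
     else 0)"
proof -
  define p q where "p T = diag_coeff (tab_content la T k) (tab_content la T (Suc k))"
    and "q T = off_coeff (tab_content la T k) (tab_content la T (Suc k))" for T
  have sw: "bvec (adj_trans k \<circ> T) S = bvec T (adj_trans k \<circ> S)" for T
    unfolding bvec_def by (metis adj_trans_comp_invol)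
  have "young_gen la k v S = (\<Sum>T\<in>Tab la. v T * (p T * bvec T S + q T * bvec T (adj_trans k \<circ> S)))"
    by (simp add: young_gen_def real_axial_tab p_def q_def diag_coeff_def off_coeff_def sw)
  also have "\<dots> = (\<Sum>T\<in>Tab la. (if T = S then v T * p T else 0) + (if T = adj_trans k \<circ> S then v T * q T else 0))"
    by (rule sum.cong) (auto simp: bvec_def algebra_simps)
  also have "\<dots> = (if S \<in> Tab la then v S * p S else 0)
      + (if adj_trans k \<circ> S \<in> Tab la then v (adj_trans k \<circ> S) * q (adj_trans k \<circ> S) else 0)"
    by (simp add: sum.distrib finite_Tab)
  also have "\<dots> = (if S \<in> Tab la then p S * v S +
       (if adj_trans k \<circ> S \<in> Tab la then q S * v (adj_trans k \<circ> S) else 0) else 0)"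
  proof (cases "adj_trans k \<circ> S \<in> Tab la")
    case True
    have "q (adj_trans k \<circ> (adj_trans k \<circ> S)) = q (adj_trans k \<circ> S)"
      unfolding q_def content_swap_pair[OF Tab_filling[OF True] k] by (rule coeff_sym)
    then have qs: "q S = q (adj_trans k \<circ> S)" by simp
    show ?thesis
    proof (cases "S \<in> Tab la")
      case False
      then have "q (adj_trans k \<circ> S) = 0"
        using off_coeff_nonstandard[OF la True k] by (simp add: q_def)
      then show ?thesis using False by simp
    qed (use True qs in simp)
  qed simp
  finally show ?thesis by (simp only: p_def q_def)
qed

lemma young_gen_hspace:
  "is_partition la \<Longrightarrow> 1 \<le> k \<Longrightarrow> k < sum_list la \<Longrightarrow> young_gen la k v \<in> hspace (Tab la)"
  by (simp add: hspace_def young_gen_apply)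

text \<open>Agreement of \<open>v\<close> and \<open>u\<close> on standard tableaux suffices,
  because nonstandard coordinates enter with coefficient 0. This form allows nested operators to be
  replaced from the inside out.\<close>

lemma young_gen_fill:
  assumes "is_partition la" "1 \<le> k" "k < sum_list la" "S \<in> Tab la" "\<And>T. T \<in> Tab la \<Longrightarrow> v T = u T"
  shows "young_gen la k v S = gen_fill la k u S"
  using assms off_coeff_nonstandard[OF assms(1,4,2,3)]
  by (auto simp: young_gen_apply gen_fill_def)

lemma hspace_eqI:
  "v \<in> hspace A \<Longrightarrow> w \<in> hspace A \<Longrightarrow> (\<And>x. x \<in> A \<Longrightarrow> v x = w x) \<Longrightarrow> v = w"
proof
  fix x assume "v \<in> hspace A" "w \<in> hspace A" "\<And>x. x \<in> A \<Longrightarrow> v x = w x"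
  then show "v x = w x" by (cases "x \<in> A") (auto simp: hspace_def)
qed

lemma ip_bvec:
  assumes "finite A" "x \<in> A"
  shows "ip A (bvec x) v = v x"
proof -
  have "ip A (bvec x) v = (\<Sum>y\<in>A. if y = x then v y else 0)"
    unfolding ip_def by (rule sum.cong) (auto simp: bvec_def)
  then show ?thesis using assms by simp
qed

text \<open>A nonzero integer distance has square at least 1, so the radicand in
  \<open>off_coeff\<close> is nonnegative and the root squares back.\<close>

lemma coeff_squares:
  assumes "x \<noteq> y" "y - x = real_of_int (d :: int)"
  shows "diag_coeff x y * diag_coeff x y + off_coeff x y * off_coeff x y = 1"
proof -
  have "d \<noteq> 0" using assms by auto
  then have "1 \<le> d\<^sup>2" by (simp add: int_one_le_iff_zero_less)
  then have "1 \<le> (y - x)\<^sup>2" unfolding assms(2) by (metis of_int_1_le_iff of_int_power)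
  then have "1 / (y - x)\<^sup>2 \<le> 1" by (intro divide_le_eq_1_pos[THEN iffD2]) auto
  then show ?thesis by (simp add: diag_coeff_def off_coeff_def power2_eq_square)
qed

lemma content_coeff_squares:
  assumes "tab_content la S a \<noteq> tab_content la S b"
  shows "diag_coeff (tab_content la S a) (tab_content la S b) * diag_coeff (tab_content la S a) (tab_content la S b)
    + off_coeff (tab_content la S a) (tab_content la S b) * off_coeff (tab_content la S a) (tab_content la S b) = 1"
  by (rule coeff_squares[where d = "superdiag (box_of la S b) - superdiag (box_of la S a)", OF assms])
    (simp add: tab_content_def)

text \<open>The 2 by 2 block of a swap is [[p, q], [q, -p]] with p^2 + q^2 = 1: contents are
  exchanged, so the diagonal coefficient changes sign and the mixed terms cancel.\<close>

lemma young_gen_invol: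
  assumes la: "is_partition la" and k: "1 \<le> k" "k < sum_list la" and v: "v \<in> hspace (Tab la)"
  shows "young_gen la k (young_gen la k v) = v"
proof (rule hspace_eqI[OF young_gen_hspace[OF la k] v])
  fix S assume S: "S \<in> Tab la"
  have f: "filling la S" by (rule Tab_filling[OF S])
  have "young_gen la k (young_gen la k v) S = gen_fill la k (gen_fill la k v) S"
    by (intro young_gen_fill[OF la k] S) auto
  moreover have "tab_content la S k \<noteq> tab_content la S (Suc k)"
    using content_distinct[OF la S k(1)] k by simp
  note sq = content_coeff_squares[OF this]
  have "gen_fill la k (gen_fill la k v) S = v S *
    (diag_coeff (tab_content la S k) (tab_content la S (Suc k)) * diag_coeff (tab_content la S k) (tab_content la S (Suc k))
    + off_coeff (tab_content la S k) (tab_content la S (Suc k)) * off_coeff (tab_content la S k) (tab_content la S (Suc k)))"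
    unfolding gen_fill_def content_swap_pair[OF f k]
      coeff_sym[of "tab_content la S (Suc k)" "tab_content la S k"] adj_trans_comp_invol
    by (simp add: algebra_simps)
  ultimately show "young_gen la k (young_gen la k v) S = v S" using sq by simp
qed

lemma adj_trans_commute:
  assumes "i + 1 < j"
  shows "adj_trans i \<circ> (adj_trans j \<circ> S) = adj_trans j \<circ> (adj_trans i \<circ> S)"
  using assms by (auto simp: fun_eq_iff adj_trans_def transpose_def)

lemma young_gen_commute:
  assumes la: "is_partition la" and i: "1 \<le> i" and ij: "i + 1 < j" and j: "j < sum_list la"
  shows "young_gen la i (young_gen la j v) = young_gen la j (young_gen la i v)"
proof -
  have i': "i < sum_list la" and j': "1 \<le> j" using ij i j by auto
  note gi = young_gen_hspace[OF la i i'] and gj = young_gen_hspace[OF la j' j]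
  show ?thesis
  proof (rule hspace_eqI[OF gi gj])
    fix S assume S: "S \<in> Tab la"
    have f: "filling la S" by (rule Tab_filling[OF S])
    have c: "tab_content la (adj_trans j \<circ> S) i = tab_content la S i"
        "tab_content la (adj_trans j \<circ> S) (Suc i) = tab_content la S (Suc i)"
        "tab_content la (adj_trans i \<circ> S) j = tab_content la S j"
        "tab_content la (adj_trans i \<circ> S) (Suc j) = tab_content la S (Suc j)"
      using ij i j i' j' by (auto simp: content_swap[OF f])
    have "young_gen la i (young_gen la j v) S = gen_fill la i (gen_fill la j v) S"
      by (intro young_gen_fill[OF la i i'] S young_gen_fill[OF la j' j]) auto
    moreover have "young_gen la j (young_gen la i v) S = gen_fill la j (gen_fill la i v) S"
      by (intro young_gen_fill[OF la i i'] S young_gen_fill[OF la j' j]) auto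
    moreover have "gen_fill la i (gen_fill la j v) S = gen_fill la j (gen_fill la i v) S"
      unfolding gen_fill_def c adj_trans_commute[OF ij, of S] by (simp add: algebra_simps)
    ultimately show "young_gen la i (young_gen la j v) S = young_gen la j (young_gen la i v) S" by simp
  qed
qed

lemma adj_trans_braid:
  "adj_trans (Suc k) \<circ> (adj_trans k \<circ> (adj_trans (Suc k) \<circ> S))
   = adj_trans k \<circ> (adj_trans (Suc k) \<circ> (adj_trans k \<circ> S))"
  by (auto simp: fun_eq_iff adj_trans_def transpose_def)

text \<open>Both sides are expanded on the six fillings obtained by permuting \<open>k\<close>,
  \<open>k + 1\<close>, \<open>k + 2\<close>. All coefficients depend on the three contents, and
  agreement follows from the square relations and one identity between the reciprocals.\<close>

lemma young_gen_braid:
  assumes la: "is_partition la" and k: "1 \<le> k" "Suc k < sum_list la"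
  shows "young_gen la (Suc k) (young_gen la k (young_gen la (Suc k) v))
    = young_gen la k (young_gen la (Suc k) (young_gen la k v))"
proof -
  have k': "k < sum_list la" and k1: "1 \<le> Suc k" using k by auto
  note g = young_gen_fill[OF la k(1) k'] and g1 = young_gen_fill[OF la k1 k(2)]
  show ?thesis
  proof (rule hspace_eqI[OF young_gen_hspace[OF la k1 k(2)] young_gen_hspace[OF la k(1) k']])
    fix S assume S: "S \<in> Tab la"
    define r s where "r = adj_trans k" and "s = adj_trans (Suc k)"
    define a b c where "a = tab_content la S k" and "b = tab_content la S (Suc k)"
      and "c = tab_content la S (Suc (Suc k))"
    have f: "filling la S" by (rule Tab_filling[OF S])
    have fr: "filling la (r \<circ> T)" and fs: "filling la (s \<circ> T)" if "filling la T" for T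
      using filling_swap[OF that k(1) k'] filling_swap[OF that k1 k(2)] by (auto simp: r_def s_def)
    have cr: "tab_content la (r \<circ> T) k = tab_content la T (Suc k)"
        "tab_content la (r \<circ> T) (Suc k) = tab_content la T k"
        "tab_content la (r \<circ> T) (Suc (Suc k)) = tab_content la T (Suc (Suc k))"
      and cs: "tab_content la (s \<circ> T) k = tab_content la T k"
        "tab_content la (s \<circ> T) (Suc k) = tab_content la T (Suc (Suc k))"
        "tab_content la (s \<circ> T) (Suc (Suc k)) = tab_content la T (Suc k)" if "filling la T" for T
      using k k' k1 by (auto simp: r_def s_def content_swap[OF that])
    have neq: "a \<noteq> b" "b \<noteq> c" "a \<noteq> c"
      unfolding a_def b_def c_def by (rule content_distinct[OF la S]; use k in simp)+
    define x y z x' y' z' where "x = diag_coeff a b" and "y = diag_coeff b c" and "z = diag_coeff a c"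
      and "x' = off_coeff a b" and "y' = off_coeff b c" and "z' = off_coeff a c"
    \<comment> \<open>Partial fractions: \<open>x\<close>, \<open>y\<close> and \<open>z\<close> are
      the reciprocals of b - a, c - b and their sum c - a.\<close>
    have rel: "x * y = z * (x + y)"
      using neq by (simp add: x_def y_def z_def diag_coeff_def field_simps)
    have sq: "x' * x' = 1 - x * x" "y' * y' = 1 - y * y"
      using content_coeff_squares[of la S k "Suc k"] content_coeff_squares[of la S "Suc k" "Suc (Suc k)"] neq
      unfolding a_def[symmetric] b_def[symmetric] c_def[symmetric] x_def y_def x'_def y'_def by auto
    have sym: "diag_coeff b a = - x" "diag_coeff c b = - y" "diag_coeff c a = - z"
        "off_coeff b a = x'" "off_coeff c b = y'" "off_coeff c a = z'"
      unfolding x_def y_def z_def x'_def y'_def z'_def by (rule coeff_sym)+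
    have gf: "gen_fill la k u T = diag_coeff (tab_content la T k) (tab_content la T (Suc k)) * u T
        + off_coeff (tab_content la T k) (tab_content la T (Suc k)) * u (r \<circ> T)"
      "gen_fill la (Suc k) u T = diag_coeff (tab_content la T (Suc k)) (tab_content la T (Suc (Suc k))) * u T
        + off_coeff (tab_content la T (Suc k)) (tab_content la T (Suc (Suc k))) * u (s \<circ> T)" for u T
      by (auto simp: gen_fill_def r_def s_def)
    have rr: "r \<circ> (r \<circ> T) = T" "s \<circ> (s \<circ> T) = T" "s \<circ> (r \<circ> (s \<circ> T)) = r \<circ> (s \<circ> (r \<circ> T))" for T
      unfolding r_def s_def by (rule adj_trans_comp_invol adj_trans_braid)+
    note cc = cr cs fr fs f a_def[symmetric] b_def[symmetric] c_def[symmetric]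
    have L: "gen_fill la k (gen_fill la (Suc k) (gen_fill la k v)) S
      = x * (y * (x * v S + x' * v (r \<circ> S)) + y' * (z * v (s \<circ> S) + z' * v (r \<circ> (s \<circ> S))))
      + x' * (z * (- x * v (r \<circ> S) + x' * v S)
         + z' * (y * v (s \<circ> (r \<circ> S)) + y' * v (r \<circ> (s \<circ> (r \<circ> S)))))"
      unfolding gf by (simp add: cc rr sym x_def[symmetric] y_def[symmetric] z_def[symmetric]
          x'_def[symmetric] y'_def[symmetric] z'_def[symmetric] del: comp_apply)
    have R: "gen_fill la (Suc k) (gen_fill la k (gen_fill la (Suc k) v)) S
      = y * (x * (y * v S + y' * v (s \<circ> S)) + x' * (z * v (r \<circ> S) + z' * v (s \<circ> (r \<circ> S))))
      + y' * (z * (- y * v (s \<circ> S) + y' * v S)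
         + z' * (x * v (r \<circ> (s \<circ> S)) + x' * v (r \<circ> (s \<circ> (r \<circ> S)))))"
      unfolding gf by (simp add: cc rr sym x_def[symmetric] y_def[symmetric] z_def[symmetric]
          x'_def[symmetric] y'_def[symmetric] z'_def[symmetric] del: comp_apply)
    have 1: "young_gen la (Suc k) (young_gen la k (young_gen la (Suc k) v)) S
      = gen_fill la (Suc k) (gen_fill la k (gen_fill la (Suc k) v)) S"
      by (intro g g1 S refl)
    have 2: "young_gen la k (young_gen la (Suc k) (young_gen la k v)) S
      = gen_fill la k (gen_fill la (Suc k) (gen_fill la k v)) S"
      by (intro g g1 S refl)
    show "young_gen la (Suc k) (young_gen la k (young_gen la (Suc k) v)) S
      = young_gen la k (young_gen la (Suc k) (young_gen la k v)) S"
      unfolding 1 2 L R using rel sq by algebra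
  qed
qed

text \<open>The matrix is symmetric: the swap is an involution on the standard tableaux whose swap
  is again standard, and it preserves the off-diagonal coefficient.\<close>

lemma young_gen_selfadjoint:
  assumes la: "is_partition la" and k: "1 \<le> k" "k < sum_list la"
  shows "ip (Tab la) (young_gen la k v) w = ip (Tab la) v (young_gen la k w)"
proof -
  define p q where "p T = diag_coeff (tab_content la T k) (tab_content la T (Suc k))"
    and "q T = off_coeff (tab_content la T k) (tab_content la T (Suc k))" for T
  define A where "A = {S \<in> Tab la. adj_trans k \<circ> S \<in> Tab la}"
  have e: "ip (Tab la) (young_gen la k v) w
      = (\<Sum>S\<in>Tab la. p S * v S * w S) + (\<Sum>S\<in>A. q S * v (adj_trans k \<circ> S) * w S)" for v w
  proof -
    have "ip (Tab la) (young_gen la k v) w = (\<Sum>S\<in>Tab la. p S * v S * w S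
        + (if adj_trans k \<circ> S \<in> Tab la then q S * v (adj_trans k \<circ> S) * w S else 0))"
      unfolding ip_def by (rule sum.cong) (auto simp: young_gen_apply[OF la k] p_def q_def algebra_simps)
    then show ?thesis by (simp add: sum.distrib A_def sum.inter_filter finite_Tab)
  qed
  have "(\<Sum>S\<in>A. q S * v (adj_trans k \<circ> S) * w S) = (\<Sum>S\<in>A. q S * w (adj_trans k \<circ> S) * v S)"
  proof (rule sum.reindex_bij_witness[of _ "\<lambda>S. adj_trans k \<circ> S" "\<lambda>S. adj_trans k \<circ> S"])
    fix S assume "S \<in> A"
    then have "q (adj_trans k \<circ> S) = q S"
      unfolding q_def A_def
      using content_swap_pair[OF Tab_filling k] coeff_sym(2)[of "tab_content la S k"] by auto
    then show "q (adj_trans k \<circ> S) * w (adj_trans k \<circ> (adj_trans k \<circ> S)) * v (adj_trans k \<circ> S)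
        = q S * v (adj_trans k \<circ> S) * w S"
      unfolding adj_trans_comp_invol by simp
  qed (auto simp: A_def simp del: comp_apply)
  then have "ip (Tab la) (young_gen la k v) w = ip (Tab la) (young_gen la k w) v"
    unfolding e by (simp add: mult_ac)
  then show ?thesis by (simp add: ip_def mult.commute)
qed

lemma young_gen_add: "young_gen la k (\<lambda>x. v x + w x) = (\<lambda>y. young_gen la k v y + young_gen la k w y)"
  by (simp add: young_gen_def sum.distrib distrib_right)

lemma young_gen_scale: "young_gen la k (\<lambda>x. c * v x) = (\<lambda>y. c * young_gen la k v y)"
  by (simp add: young_gen_def sum_distrib_left mult.assoc)

section \<open>Words in the adjacent transpositions\<close>

text \<open>A one-way rewriting version of the Coxeter relations. Cancellation removes letters, and
  the braid rule trades two higher letters for one. No rule introduces a new letter, so a word in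
  legal generators remains legal.\<close>

inductive coxeter_step :: "nat list \<Rightarrow> nat list \<Rightarrow> bool" where
  cancel: "coxeter_step (u @ [i, i] @ v) (u @ v)"
| commute_up: "i + 1 < j \<Longrightarrow> coxeter_step (u @ [i, j] @ v) (u @ [j, i] @ v)"
| commute_down: "i + 1 < j \<Longrightarrow> coxeter_step (u @ [j, i] @ v) (u @ [i, j] @ v)"
| braid: "coxeter_step (u @ [Suc i, i, Suc i] @ v) (u @ [i, Suc i, i] @ v)"

abbreviation coxeter_red :: "nat list \<Rightarrow> nat list \<Rightarrow> bool" where
  "coxeter_red \<equiv> coxeter_step\<^sup>*\<^sup>*"

lemma coxeter_step_context: "coxeter_step w w' \<Longrightarrow> coxeter_step (a @ w @ b) (a @ w' @ b)"
proof (induction rule: coxeter_step.induct)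
  case (cancel u i v)
  show ?case using coxeter_step.cancel[of "a @ u" i "v @ b"] by simp
next
  case (commute_up i j u v)
  then show ?case using coxeter_step.commute_up[of i j "a @ u" "v @ b"] by simp
next
  case (commute_down i j u v)
  then show ?case using coxeter_step.commute_down[of i j "a @ u" "v @ b"] by simp
next
  case (braid u i v)
  show ?case using coxeter_step.braid[of "a @ u" i "v @ b"] by simp
qed

lemma coxeter_red_context: "coxeter_red w w' \<Longrightarrow> coxeter_red (a @ w @ b) (a @ w' @ b)"
  by (induction rule: rtranclp_induct) (auto intro: coxeter_step_context rtranclp.rtrancl_into_rtrancl)

lemma coxeter_step_set: "coxeter_step w w' \<Longrightarrow> set w' \<subseteq> set w"
  by (induction rule: coxeter_step.induct) auto

lemma coxeter_red_set: "coxeter_red w w' \<Longrightarrow> set w' \<subseteq> set w"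
  by (induction rule: rtranclp_induct) (use coxeter_step_set in fastforce)+

lemma coxeter_red_commute:
  assumes "\<And>k. k \<in> set a \<Longrightarrow> k + 1 < m"
  shows "coxeter_red (m # a) (a @ [m])"
  using assms
proof (induction a)
  case (Cons k a)
  have "coxeter_step (m # k # a) (k # m # a)"
    using commute_down[of k m "[]" a] Cons.prems by simp
  moreover have "coxeter_red (m # a) (a @ [m])" using Cons by auto
  then have "coxeter_red (k # m # a) (k # a @ [m])"
    using coxeter_red_context[of "m # a" "a @ [m]" "[k]" "[]"] by simp
  ultimately show ?case by (simp add: converse_rtranclp_into_rtranclp)
qed simp

text \<open>This is the double coset decomposition of the symmetric group with respect to the
  stabilizer of its last point, carried out on words.\<close>

lemma coxeter_red_one_top:
  assumes "set w \<subseteq> {1..m}"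
  shows "\<exists>w'. coxeter_red w w' \<and> (set w' \<subseteq> {1..<m} \<or>
    (\<exists>a b. w' = a @ [m] @ b \<and> set a \<subseteq> {1..<m} \<and> set b \<subseteq> {1..<m}))"
  using assms
proof (induction m arbitrary: w)
  case (Suc m)
  note IH_m = Suc.IH
  from Suc.prems show ?case
  proof (induction w)
    case Nil
    then show ?case by (intro exI[of _ "[]"]) auto
  next
    case (Cons k u)
    then obtain u' where u': "coxeter_red u u'" and
      or: "set u' \<subseteq> {1..<Suc m} \<or>
        (\<exists>a b. u' = a @ [Suc m] @ b \<and> set a \<subseteq> {1..<Suc m} \<and> set b \<subseteq> {1..<Suc m})"
      by auto
    have ku: "coxeter_red (k # u) (k # u')" using coxeter_red_context[OF u', of "[k]" "[]"] by simp
    have k: "1 \<le> k" "k \<le> Suc m" using Cons.prems by auto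
    show ?case
    proof (cases "k = Suc m")
      case False
      then have "k \<in> {1..<Suc m}" using k by auto
      with or have "set (k # u') \<subseteq> {1..<Suc m} \<or>
        (\<exists>a b. k # u' = a @ [Suc m] @ b \<and> set a \<subseteq> {1..<Suc m} \<and> set b \<subseteq> {1..<Suc m})"
      proof (elim disjE exE conjE)
        fix a b assume "u' = a @ [Suc m] @ b" "set a \<subseteq> {1..<Suc m}" "set b \<subseteq> {1..<Suc m}"
        then show ?thesis using \<open>k \<in> {1..<Suc m}\<close>
          by (intro disjI2 exI[of _ "k # a"] exI[of _ b]) auto
      qed auto
      with ku show ?thesis by blast
    next
      case True
      from or show ?thesis
      proof (elim disjE exE conjE)
        assume "set u' \<subseteq> {1..<Suc m}"
        then show ?thesis using ku True
          by (intro exI[of _ "k # u'"] conjI disjI2 exI[of _ "[]"] exI[of _ u']) auto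
      next
        fix a b assume ab: "u' = a @ [Suc m] @ b" "set a \<subseteq> {1..<Suc m}" "set b \<subseteq> {1..<Suc m}"
        then have "set a \<subseteq> {1..m}" by auto
        \<comment> \<open>The block enclosed by two letters \<open>Suc m\<close> uses letters up to
          \<open>m\<close> only, so it can first be reduced until \<open>m\<close> occurs at most
          once in it.\<close>
        from IH_m[OF this] obtain a' where a': "coxeter_red a a'"
          and or': "set a' \<subseteq> {1..<m} \<or> (\<exists>c d. a' = c @ [m] @ d \<and> set c \<subseteq> {1..<m} \<and> set d \<subseteq> {1..<m})"
          by blast
        have sa': "set a' \<subseteq> {1..m}" using coxeter_red_set[OF a'] \<open>set a \<subseteq> {1..m}\<close> by blast
        have r1: "coxeter_red (k # u) (Suc m # a' @ [Suc m] @ b)"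
          using rtranclp_trans[OF ku, of "Suc m # a' @ [Suc m] @ b"]
            coxeter_red_context[OF a', of "[Suc m]" "[Suc m] @ b"] ab(1) True by simp
        from or' show ?thesis
        proof (elim disjE exE conjE)
          \<comment> \<open>Without \<open>m\<close> in between, the left letter
            \<open>Suc m\<close> commutes through the block and cancels against the right
            one.\<close>
          assume s: "set a' \<subseteq> {1..<m}"
          have "coxeter_red (Suc m # a') (a' @ [Suc m])"
            by (rule coxeter_red_commute) (use s in force)
          from coxeter_red_context[OF this, of "[]" "[Suc m] @ b"]
          have "coxeter_red (Suc m # a' @ [Suc m] @ b) (a' @ [Suc m, Suc m] @ b)" by simp
          from rtranclp_trans[OF r1 this] have "coxeter_red (k # u) (a' @ b)"
            by (rule rtranclp.rtrancl_into_rtrancl) (rule cancel)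
          moreover have "set (a' @ b) \<subseteq> {1..<Suc m}" using sa' ab(3) by auto
          ultimately show ?thesis by blast
        next
          \<comment> \<open>With a single \<open>m\<close> in between, both letters
            \<open>Suc m\<close> are moved next to it, one from each side, and a braid step leaves
            just one of them.\<close>
          fix c d assume cd: "a' = c @ [m] @ d" "set c \<subseteq> {1..<m}" "set d \<subseteq> {1..<m}"
          have "coxeter_red (Suc m # c) (c @ [Suc m])"
            by (rule coxeter_red_commute) (use cd in force)
          from coxeter_red_context[OF this, of "[]" "[m] @ d @ [Suc m] @ b"]
          have 1: "coxeter_red (Suc m # a' @ [Suc m] @ b) (c @ [Suc m] @ [m] @ d @ [Suc m] @ b)"
            using cd(1) by simp
          have "coxeter_red (d @ [Suc m]) (Suc m # d)"
          proof -
            have "coxeter_red (e @ [Suc m]) (Suc m # e)" if "set e \<subseteq> {1..<m}" for e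
              using that
            proof (induction e)
              case (Cons x e)
              have "coxeter_red (x # e @ [Suc m]) (x # Suc m # e)"
                using coxeter_red_context[of "e @ [Suc m]" "Suc m # e" "[x]" "[]"] Cons by simp
              moreover have "coxeter_step (x # Suc m # e) (Suc m # x # e)"
                using commute_up[of x "Suc m" "[]" e] Cons.prems by simp
              ultimately show ?case by simp
            qed simp
            then show ?thesis using cd(3) .
          qed
          from coxeter_red_context[OF this, of "c @ [Suc m] @ [m]" b]
          have 2: "coxeter_red (c @ [Suc m] @ [m] @ d @ [Suc m] @ b) (c @ [Suc m, m, Suc m] @ d @ b)" by simp
          have 3: "coxeter_step (c @ [Suc m, m, Suc m] @ d @ b) (c @ [m, Suc m, m] @ d @ b)"
            by (rule braid)
          have "coxeter_red (k # u) (c @ [m, Suc m, m] @ d @ b)"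
            by (rule rtranclp.rtrancl_into_rtrancl[OF rtranclp_trans[OF rtranclp_trans[OF r1 1] 2] 3])
          then have "coxeter_red (k # u) ((c @ [m]) @ [Suc m] @ (m # d @ b))" by simp
          moreover have "set (c @ [m]) \<subseteq> {1..<Suc m}" "set (m # d @ b) \<subseteq> {1..<Suc m}"
            using sa' ab(3) cd(1) by auto
          ultimately show ?thesis by blast
        qed
      qed
    qed
  qed
qed auto

section \<open>Words evaluated as permutations and as orthogonal operators\<close>

lemma word_perm_Nil [simp]: "word_perm [] = id"
  and word_perm_Cons [simp]: "word_perm (k # ks) = adj_trans k \<circ> word_perm ks"
  by (simp_all add: word_perm_def)

lemma word_perm_append: "word_perm (u @ v) = word_perm u \<circ> word_perm v"
  by (induction u) (auto simp: comp_assoc)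

lemma word_perm_rev: "word_perm (rev w) (word_perm w x) = x"
  by (induction w arbitrary: x) (auto simp: word_perm_append)

lemma word_perm_step: "coxeter_step w w' \<Longrightarrow> word_perm w = word_perm w'"
proof (induction rule: coxeter_step.induct)
  case (braid u i v)
  show ?case using adj_trans_braid[of i "word_perm v"] by (simp add: word_perm_append)
next
  case (commute_up i j u v)
  then show ?case using adj_trans_commute[of i j "word_perm v"] by (simp add: word_perm_append)
next
  case (commute_down i j u v)
  then show ?case using adj_trans_commute[of i j "word_perm v"] by (simp add: word_perm_append)
qed (simp add: word_perm_append)

lemma word_perm_red: "coxeter_red w w' \<Longrightarrow> word_perm w = word_perm w'"
  by (induction rule: rtranclp_induct) (auto dest: word_perm_step)

lemma word_perm_permutes: "set w \<subseteq> {k. 1 \<le> k \<and> k < n} \<Longrightarrow> word_perm w permutes {1..n}"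
  by (induction w) (auto intro!: permutes_compose adj_trans_permutes[unfolded One_nat_def] permutes_id)

lemma word_perm_cycle: "j \<le> n \<Longrightarrow> word_perm [j..<n] n = j"
  by (induction rule: inc_induct) (simp_all add: upt_conv_Cons)

text \<open>The word \<open>[j..<Suc n]\<close> carries the last point to its required image
  \<open>j\<close>; what remains fixes the last point and is covered by induction.\<close>

lemma word_perm_exists:
  assumes "\<sigma> permutes {1..n}"
  shows "\<exists>ks. set ks \<subseteq> {k. 1 \<le> k \<and> k < n} \<and> word_perm ks = \<sigma>"
  using assms
proof (induction n arbitrary: \<sigma>)
  case 0
  then show ?case by (intro exI[of _ "[]"]) (simp add: permutes_empty)
next
  case (Suc n)
  define j where "j = \<sigma> (Suc n)"
  have j: "1 \<le> j" "j \<le> Suc n" using permutes_in_image[OF Suc.prems, of "Suc n"] by (auto simp: j_def)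
  define c where "c = [j..<Suc n]"
  have sc: "set c \<subseteq> {k. 1 \<le> k \<and> k < Suc n}" using j by (auto simp: c_def)
  define \<tau> where "\<tau> = word_perm (rev c) \<circ> \<sigma>"
  have c: "word_perm c (Suc n) = j" unfolding c_def by (rule word_perm_cycle[OF j(2)])
  have \<tau>p: "\<tau> permutes {1..Suc n}" unfolding \<tau>_def
    by (rule permutes_compose[OF Suc.prems word_perm_permutes]) (use sc in auto)
  have \<tau>n: "\<tau> (Suc n) = Suc n" using word_perm_rev[of c "Suc n"] c by (simp add: \<tau>_def j_def)
  have "x = Suc n" if "x \<in> {1..Suc n} - {1..n}" for x using that by auto
  then have "\<tau> permutes {1..n}" using \<tau>n by (intro permutes_superset[OF \<tau>p]) metis
  from Suc.IH[OF this] obtain ks where ks: "set ks \<subseteq> {k. 1 \<le> k \<and> k < n}" "word_perm ks = \<tau>" by blast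
  have "word_perm (c @ ks) = \<sigma>"
    using word_perm_rev[of "rev c"] by (simp add: word_perm_append ks(2) \<tau>_def fun_eq_iff)
  then show ?case using ks(1) sc by (intro exI[of _ "c @ ks"]) auto
qed

lemma word_op_Nil [simp]: "word_op la [] v = v"
  and word_op_Cons [simp]: "word_op la (k # ks) v = young_gen la k (word_op la ks v)"
  by (simp_all add: word_op_def)

lemma word_op_append: "word_op la (u @ w) v = word_op la u (word_op la w v)"
  by (induction u) auto

abbreviation letters :: "nat list \<Rightarrow> nat set" where
  "letters la \<equiv> {k. 1 \<le> k \<and> k < sum_list la}"

lemma word_op_hspace:
  "is_partition la \<Longrightarrow> set w \<subseteq> letters la \<Longrightarrow> v \<in> hspace (Tab la) \<Longrightarrow> word_op la w v \<in> hspace (Tab la)"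
  by (induction w) (auto intro: young_gen_hspace)

lemma word_op_rev:
  assumes "is_partition la" "set w \<subseteq> letters la" "v \<in> hspace (Tab la)"
  shows "word_op la (rev w) (word_op la w v) = v"
  using assms(2)
proof (induction w)
  case (Cons k w)
  then show ?case using young_gen_invol[OF assms(1), of k] word_op_hspace[OF assms(1) _ assms(3), of w]
    by (simp add: word_op_append)
qed simp

lemma word_op_adjoint:
  assumes "is_partition la" "set w \<subseteq> letters la"
  shows "ip (Tab la) (word_op la w v) u = ip (Tab la) v (word_op la (rev w) u)"
  using assms(2)
proof (induction w arbitrary: u)
  case (Cons k w)
  then show ?case by (simp add: young_gen_selfadjoint[OF assms(1)] word_op_append)
qed simp

lemma word_op_isometry:
  assumes "is_partition la" "set w \<subseteq> letters la" "u \<in> hspace (Tab la)"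
  shows "ip (Tab la) (word_op la w v) (word_op la w u) = ip (Tab la) v u"
  using assms by (simp add: word_op_adjoint word_op_rev)

lemma word_op_add: "word_op la w (\<lambda>x. v x + u x) = (\<lambda>y. word_op la w v y + word_op la w u y)"
  by (induction w) (auto simp: young_gen_add)

lemma word_op_scale: "word_op la w (\<lambda>x. c * v x) = (\<lambda>y. c * word_op la w v y)"
  by (induction w) (auto simp: young_gen_scale)

text \<open>Each rewriting rule is one of the relations verified for Young's operators. Cancellation
  needs the intermediate vector to vanish outside the standard tableaux.\<close>

lemma word_op_step:
  assumes la: "is_partition la" and v: "v \<in> hspace (Tab la)"
  shows "coxeter_step w w' \<Longrightarrow> set w \<subseteq> letters la \<Longrightarrow> word_op la w v = word_op la w' v"
proof (induction rule: coxeter_step.induct)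
  case (cancel u i w)
  then show ?case
    using young_gen_invol[OF la, of i "word_op la w v"] word_op_hspace[OF la _ v, of w]
    by (simp add: word_op_append)
next
  case (commute_up i j u w)
  then show ?case using young_gen_commute[OF la, of i j] by (simp add: word_op_append)
next
  case (commute_down i j u w)
  then show ?case using young_gen_commute[OF la, of i j] by (simp add: word_op_append)
next
  case (braid u i w)
  then show ?case using young_gen_braid[OF la, of i] by (simp add: word_op_append)
qed

lemma word_op_red:
  assumes la: "is_partition la" and v: "v \<in> hspace (Tab la)"
  shows "coxeter_red w w' \<Longrightarrow> set w \<subseteq> letters la \<Longrightarrow> word_op la w v = word_op la w' v"
proof (induction rule: rtranclp_induct)
  case (step y z)
  then show ?case using word_op_step[OF la v step.hyps(2)] coxeter_red_set[OF step.hyps(1)] by auto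
qed simp

section \<open>The Gram operators of the family\<close>

lemma up_cases:
  assumes "la \<in> up \<mu>"
  obtains i where "is_partition la" "row la = (row \<mu>)(i := Suc (row \<mu> i))"
    "added_box la \<mu> = (Suc i, Suc (row \<mu> i))" "sum_list la = Suc (sum_list \<mu>)"
    "diagram la = insert (added_box la \<mu>) (diagram \<mu>)" "added_box la \<mu> \<notin> diagram \<mu>"
proof -
  from assms obtain i where la: "is_partition la" and i: "row la = (row \<mu>)(i := Suc (row \<mu> i))"
    by (auto simp: up_iff)
  show thesis
    by (rule that[OF la i added_box_row[OF i] sum_list_row_insert[OF i]])
      (simp_all only: added_box_row[OF i] diagram_of_row_insert[OF i] not_False_eq_True)
qed

lemma up_Tab_iff:
  assumes "is_partition \<mu>" "la \<in> up \<mu>" "S (added_box la \<mu>) = sum_list la"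
  shows "S \<in> Tab la \<longleftrightarrow> S(added_box la \<mu> := 0) \<in> Tab \<mu>"
  using assms(2) by (rule up_cases) (rule Tab_extend_iff[where S = S, OF assms(1) _ _ assms(3)])

lemma Tab_added_box: "la \<in> up \<mu> \<Longrightarrow> R \<in> Tab \<mu> \<Longrightarrow> R(added_box la \<mu> := 0) = R"
  using Tab_D(2)[of R \<mu> "added_box la \<mu>"] by (elim up_cases) auto

lemma up_bij_Tab:
  assumes "is_partition \<mu>" "la \<in> up \<mu>"
  shows "bij_betw (\<lambda>R. R(added_box la \<mu> := sum_list la)) (Tab \<mu>) {S \<in> Tab la. S (added_box la \<mu>) = sum_list la}"
  using assms(2) by (rule up_cases) (rule bij_betw_Tab_extend[OF assms(1)])

lemma Psi_apply:
  assumes la: "la \<in> up \<mu>" and v: "v \<in> hspace (Tab \<mu>)"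
  shows "Psi la \<mu> v S = (if S (added_box la \<mu>) = sum_list la then v (S(added_box la \<mu> := 0)) else 0)"
proof -
  let ?b = "added_box la \<mu>"
  have iff: "S = R(?b := sum_list la) \<longleftrightarrow> S ?b = sum_list la \<and> R = S(?b := 0)" if "R \<in> Tab \<mu>" for R
  proof
    assume "S = R(?b := sum_list la)"
    then show "S ?b = sum_list la \<and> R = S(?b := 0)" using Tab_added_box[OF la that] by simp
  qed (auto simp: fun_upd_idem_iff)
  have "Psi la \<mu> v S = (\<Sum>R\<in>Tab \<mu>. if R = S(?b := 0) then (if S ?b = sum_list la then v R else 0) else 0)"
    unfolding Psi_def by (rule sum.cong) (auto simp: bvec_def extend_tab_def iff)
  also have "\<dots> = (if S ?b = sum_list la then v (S(?b := 0)) else 0)"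
    using v by (auto simp: finite_Tab hspace_def)
  finally show ?thesis .
qed

lemma Psi_hspace:
  assumes "is_partition \<mu>" "la \<in> up \<mu>" "v \<in> hspace (Tab \<mu>)"
  shows "Psi la \<mu> v \<in> hspace (Tab la)"
  using assms(3) up_Tab_iff[OF assms(1,2)] unfolding hspace_def
  by (auto simp: Psi_apply[OF assms(2,3)])

lemma Psi_add: "Psi la \<mu> (\<lambda>x. v x + w x) = (\<lambda>y. Psi la \<mu> v y + Psi la \<mu> w y)"
  by (simp add: Psi_def sum.distrib distrib_right)

lemma Psi_scale: "Psi la \<mu> (\<lambda>x. c * v x) = (\<lambda>y. c * Psi la \<mu> v y)"
  by (simp add: Psi_def sum_distrib_left mult.assoc)

lemma tab_content_restrict:
  assumes \<mu>: "is_partition \<mu>" and la: "la \<in> up \<mu>" and S: "S \<in> Tab la" "S (added_box la \<mu>) = sum_list la"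
    and a: "1 \<le> a" "a \<le> sum_list \<mu>"
  shows "tab_content la S a = tab_content \<mu> (S(added_box la \<mu> := 0)) a"
proof -
  let ?b = "added_box la \<mu>" let ?R = "S(added_box la \<mu> := 0)"
  have "?R \<in> Tab \<mu>" using up_Tab_iff[where S = S, OF \<mu> la S(2)] S(1) by simp
  note b = box_of[OF Tab_filling[OF this] a]
  have x: "box_of \<mu> ?R a \<in> diagram la" "box_of \<mu> ?R a \<noteq> ?b" using la b(1) by (auto elim!: up_cases)
  then have "S (box_of \<mu> ?R a) = a" using b(2) by simp
  then have "box_of la S a = box_of \<mu> ?R a"
    using box_of_eq[OF Tab_filling[OF S(1)] x(1)] by simp
  then show ?thesis by (simp add: tab_content_def)
qed

lemma tab_content_added:
  assumes la: "la \<in> up \<mu>" and S: "S \<in> Tab la" "S (added_box la \<mu>) = sum_list la"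
  shows "tab_content la S (sum_list la) = real_of_int (superdiag (added_box la \<mu>))"
proof -
  have "added_box la \<mu> \<in> diagram la" using la by (auto elim!: up_cases)
  from box_of_eq[OF Tab_filling[OF S(1)] this] show ?thesis by (simp add: tab_content_def S(2))
qed

text \<open>A swap of entries below the largest one does not move the largest entry, and the
  contents of the other entries are the same before and after extension. Tableaux with the largest
  entry elsewhere give 0 on both sides.\<close>

lemma Psi_intertwines:
  assumes \<mu>: "is_partition \<mu>" and la: "la \<in> up \<mu>" and k: "1 \<le> k" "k < sum_list \<mu>"
    and v: "v \<in> hspace (Tab \<mu>)"
  shows "young_gen la k (Psi la \<mu> v) = Psi la \<mu> (young_gen \<mu> k v)"
proof -
  let ?b = "added_box la \<mu>"
  have pla: "is_partition la" and n: "sum_list la = Suc (sum_list \<mu>)" using la by (auto elim!: up_cases)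
  have k': "k < sum_list la" using k n by simp
  note gv = young_gen_hspace[OF \<mu> k, of v]
  show ?thesis
  proof (rule hspace_eqI[OF young_gen_hspace[OF pla k(1) k'] Psi_hspace[OF \<mu> la gv]])
    fix S assume S: "S \<in> Tab la"
    have L: "young_gen la k (Psi la \<mu> v) S = gen_fill la k (Psi la \<mu> v) S"
      by (rule young_gen_fill[OF pla k(1) k' S]) simp
    show "young_gen la k (Psi la \<mu> v) S = Psi la \<mu> (young_gen \<mu> k v) S"
    proof (cases "S ?b = sum_list la")
      case True
      define R where "R = S(?b := 0)"
      have R: "R \<in> Tab \<mu>" using up_Tab_iff[where S = S, OF \<mu> la True] S by (simp add: R_def)
      have c: "tab_content la S k = tab_content \<mu> R k" "tab_content la S (Suc k) = tab_content \<mu> R (Suc k)"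
        using tab_content_restrict[OF \<mu> la S True] k by (auto simp: R_def)
      have "adj_trans k (sum_list la) = sum_list la" using k n by simp
      then have s: "(adj_trans k \<circ> S) ?b = sum_list la" using True by simp
      have s2: "(adj_trans k \<circ> S)(?b := 0) = adj_trans k \<circ> R"
        using k by (auto simp: R_def fun_eq_iff)
      have "Psi la \<mu> (young_gen \<mu> k v) S = young_gen \<mu> k v R"
        using True by (simp add: Psi_apply[OF la gv] R_def)
      also have "\<dots> = gen_fill \<mu> k v R" by (rule young_gen_fill[OF \<mu> k R]) simp
      also have "\<dots> = gen_fill la k (Psi la \<mu> v) S"
        unfolding gen_fill_def c Psi_apply[OF la v] s s2 using True by (simp add: R_def)
      finally show ?thesis using L by simp
    next
      case False
      have "S ?b \<noteq> sum_list la \<Longrightarrow> adj_trans k (S ?b) \<noteq> sum_list la"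
        using k n by (auto simp: adj_trans_def transpose_def split: if_splits)
      then show ?thesis using False unfolding L gen_fill_def by (simp add: Psi_apply[OF la v] Psi_apply[OF la gv])
    qed
  qed
qed

lemma word_op_Psi:
  assumes \<mu>: "is_partition \<mu>" and la: "la \<in> up \<mu>" and w: "set w \<subseteq> letters \<mu>" and v: "v \<in> hspace (Tab \<mu>)"
  shows "word_op la w (Psi la \<mu> v) = Psi la \<mu> (word_op \<mu> w v)"
  using w
proof (induction w)
  case (Cons k w)
  then show ?case using Psi_intertwines[OF \<mu> la, of k] word_op_hspace[OF \<mu> _ v, of w] by simp
qed simp

lemma ip_Psi:
  assumes \<mu>: "is_partition \<mu>" and la: "la \<in> up \<mu>" and v: "v \<in> hspace (Tab \<mu>)"
  shows "ip (Tab la) (Psi la \<mu> v) w = (\<Sum>R\<in>Tab \<mu>. v R * w (R(added_box la \<mu> := sum_list la)))"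
proof -
  let ?b = "added_box la \<mu>"
  have "ip (Tab la) (Psi la \<mu> v) w = (\<Sum>S\<in>Tab la. if S ?b = sum_list la then v (S(?b := 0)) * w S else 0)"
    unfolding ip_def by (rule sum.cong) (auto simp: Psi_apply[OF la v])
  also have "\<dots> = (\<Sum>S\<in>{S \<in> Tab la. S ?b = sum_list la}. v (S(?b := 0)) * w S)"
    by (rule sum.inter_filter[symmetric]) (rule finite_Tab)
  also have "\<dots> = (\<Sum>R\<in>Tab \<mu>. v ((R(?b := sum_list la))(?b := 0)) * w (R(?b := sum_list la)))"
    by (rule sum.reindex_bij_betw[OF up_bij_Tab[OF \<mu> la], symmetric])
  also have "\<dots> = (\<Sum>R\<in>Tab \<mu>. v R * w (R(?b := sum_list la)))"
    by (rule sum.cong) (use Tab_added_box[OF la] in auto)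
  finally show ?thesis .
qed

lemma Psi_extend:
  assumes "la \<in> up \<mu>" "v \<in> hspace (Tab \<mu>)" "R \<in> Tab \<mu>"
  shows "Psi la \<mu> v (R(added_box la \<mu> := sum_list la)) = v R"
  using Tab_added_box[OF assms(1,3)] by (simp add: Psi_apply[OF assms(1,2)])

lemma Psi_isometry:
  assumes "is_partition \<mu>" "la \<in> up \<mu>" "v \<in> hspace (Tab \<mu>)" "w \<in> hspace (Tab \<mu>)"
  shows "ip (Tab la) (Psi la \<mu> v) (Psi la \<mu> w) = ip (Tab \<mu>) v w"
  unfolding ip_Psi[OF assms(1-3)] unfolding ip_def by (rule sum.cong) (auto simp: Psi_extend[OF assms(2,4)])

text \<open>The compression of the top generator to the image of \<open>Psi\<close> is diagonal: the
  swap moves the largest entry out of the added box, so the off-diagonal term leaves that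
  image.\<close>

lemma ip_Psi_top:
  assumes \<mu>: "is_partition \<mu>" and la: "la \<in> up \<mu>" and pos: "0 < sum_list \<mu>"
    and v: "v \<in> hspace (Tab \<mu>)" and w: "w \<in> hspace (Tab \<mu>)"
  shows "ip (Tab la) (Psi la \<mu> v) (young_gen la (sum_list \<mu>) (Psi la \<mu> w))
    = (\<Sum>R\<in>Tab \<mu>. v R * (w R / real_of_int (axial (added_box la \<mu>) (box_of \<mu> R (sum_list \<mu>)))))"
  unfolding ip_Psi[OF \<mu> la v]
proof (rule sum.cong[OF refl])
  fix R assume R: "R \<in> Tab \<mu>"
  let ?b = "added_box la \<mu>" and ?m = "sum_list \<mu>"
  define S where "S = R(?b := sum_list la)"
  have pla: "is_partition la" and n: "sum_list la = Suc ?m" using la by (auto elim!: up_cases)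
  have Sb: "S ?b = sum_list la" by (simp add: S_def)
  have R': "S(?b := 0) = R" using Tab_added_box[OF la R] by (simp add: S_def)
  then have S: "S \<in> Tab la" using up_Tab_iff[where S = S, OF \<mu> la Sb] R by simp
  have "young_gen la ?m (Psi la \<mu> w) S = gen_fill la ?m (Psi la \<mu> w) S"
    by (rule young_gen_fill[OF pla _ _ S]) (use pos n in auto)
  also have "\<dots> = diag_coeff (tab_content la S ?m) (tab_content la S (Suc ?m)) * w R"
  proof -
    have "(adj_trans ?m \<circ> S) ?b \<noteq> sum_list la" using Sb n by simp
    then have "Psi la \<mu> w (adj_trans ?m \<circ> S) = 0" by (simp only: Psi_apply[OF la w] if_False)
    moreover have "Psi la \<mu> w S = w R" using Sb R' by (simp add: Psi_apply[OF la w])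
    ultimately show ?thesis by (simp add: gen_fill_def)
  qed
  also have "\<dots> = w R / real_of_int (axial ?b (box_of \<mu> R ?m))"
    using tab_content_restrict[OF \<mu> la S Sb, of ?m] tab_content_added[OF la S Sb] pos R' n
    by (simp add: diag_coeff_def axial_def tab_content_def)
  finally show "v R * young_gen la ?m (Psi la \<mu> w) (R(?b := sum_list la))
      = v R * (w R / real_of_int (axial ?b (box_of \<mu> R ?m)))" by (simp add: S_def)
qed

text \<open>Both sides are the orthogonal projection of \<open>w\<close> onto the common image. The
  preimage \<open>u\<close> of one projection is identified by testing against basis
  vectors.\<close>

lemma isometry_projection:
  assumes A: "finite A" and F: "isometry A B F" and G: "isometry A B G"
    and im: "F ` hspace A = G ` hspace A"
  shows "F (adj A B F w) = G (adj A B G w)"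
proof -
  have h: "adj A B H w \<in> hspace A" for H by (simp add: adj_def hspace_def)
  have lF: "lin_map A B F" and lG: "lin_map A B G" using F G by (auto simp: isometry_def)
  obtain u where u: "u \<in> hspace A" "G (adj A B G w) = F u"
    using h[of G] im by (metis imageE imageI)
  have "u = adj A B F w"
  proof (rule hspace_eqI[OF u(1) h])
    fix x assume x: "x \<in> A"
    have bx: "bvec x \<in> hspace A" using x by (auto simp: bvec_def hspace_def)
    obtain z where z: "z \<in> hspace A" "F (bvec x) = G z" using bx im by (metis imageE imageI)
    have "ip A (bvec x) u = ip B (F (bvec x)) (F u)" using F bx u by (simp add: isometry_def)
    also have "\<dots> = ip B (G z) (G (adj A B G w))" using u z by simp
    also have "\<dots> = ip A z (adj A B G w)" using G z h by (simp add: isometry_def)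
    also have "\<dots> = ip B (F (bvec x)) w" using ip_adj[OF A lG z(1)] z(2) by simp
    also have "\<dots> = ip A (bvec x) (adj A B F w)" by (rule ip_adj[OF A lF bx])
    finally show "u x = adj A B F w x" by (simp add: ip_bvec[OF A x])
  qed
  then show ?thesis using u by simp
qed

text \<open>Allows unknown isometries in the definition of equi-isoclinism to be exchanged for the
  explicit ones.\<close>

lemma isometry_adj_ip:
  assumes "finite A" "isometry A B F" "isometry A B G" "F ` hspace A = G ` hspace A"
  shows "ip A (adj A B F w) (adj A B F w') = ip A (adj A B G w) (adj A B G w')"
proof -
  have h: "adj A B H w \<in> hspace A" for H w by (simp add: adj_def hspace_def)
  have "ip A (adj A B F w) (adj A B F w') = ip B (F (adj A B F w)) (F (adj A B F w'))"
    using assms(2) h by (simp add: isometry_def)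
  also have "\<dots> = ip B (G (adj A B G w)) (G (adj A B G w'))"
    using isometry_projection[OF assms] by simp
  also have "\<dots> = ip A (adj A B G w) (adj A B G w')"
    using assms(3) h by (simp add: isometry_def)
  finally show ?thesis .
qed

section \<open>The canonical isometries and their cross Gram operators\<close>

locale branching =
  fixes \<mu> :: "nat list" and L :: "nat list set" and t :: "nat \<Rightarrow> nat \<Rightarrow> nat"
  assumes \<mu>: "is_partition \<mu>" and pos: "0 < sum_list \<mu>"
    and L: "L \<subseteq> up \<mu>" "L \<noteq> {}" and t: "coset_reps (Suc (sum_list \<mu>)) t"
begin

lemma finite_L: "finite L" using L(1) finite_up[OF \<mu>] by (rule finite_subset)

lemma dim_set_pos: "0 < dim_set L"
proof -
  have "is_partition la" if "la \<in> L" for la using that L(1) by (auto elim!: up_cases)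
  then show ?thesis unfolding dim_set_def using finite_L L(2) dimn_pos by (intro sum_pos) auto
qed

text \<open>This is the choice made inside \<open>young_rep\<close>. All shapes in \<open>L\<close>
  have the same size, so one word represents \<open>t k\<close> on every summand.\<close>

definition rep_word :: "nat \<Rightarrow> nat list" where
  "rep_word k = (SOME ks. set ks \<subseteq> {j. 1 \<le> j \<and> j < Suc (sum_list \<mu>)} \<and> word_perm ks = t k)"

lemma rep_word:
  assumes "k \<in> {1..Suc (sum_list \<mu>)}"
  shows "set (rep_word k) \<subseteq> {j. 1 \<le> j \<and> j < Suc (sum_list \<mu>)}" "word_perm (rep_word k) = t k"
proof -
  have "t k permutes {1..Suc (sum_list \<mu>)}" using t assms by (auto simp: coset_reps_def)
  from someI_ex[OF word_perm_exists[OF this]]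
  show "set (rep_word k) \<subseteq> {j. 1 \<le> j \<and> j < Suc (sum_list \<mu>)}" "word_perm (rep_word k) = t k"
    by (simp_all add: rep_word_def)
qed

lemma young_rep_word:
  assumes "la \<in> L"
  shows "young_rep la (t k) = word_op la (rep_word k)"
proof -
  have "sum_list la = Suc (sum_list \<mu>)" using assms L(1) by (auto elim!: up_cases)
  then show ?thesis by (simp add: young_rep_def rep_word_def)
qed

definition Phi :: "nat \<Rightarrow> (tableau \<Rightarrow> real) \<Rightarrow> (nat list \<times> tableau \<Rightarrow> real)" where
  "Phi k v = young_rep_set L (t k) (Psi_set \<mu> L v)"

lemma Phi_apply:
  "Phi k v (la, T) = (if la \<in> L then sqrt (real (dimn la) / real (dim_set L)) *
     word_op la (rep_word k) (Psi la \<mu> v) T else 0)"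
  by (simp add: Phi_def young_rep_set_def Psi_set_def young_rep_word word_op_scale)

lemma letters_up: "la \<in> L \<Longrightarrow> letters la = {j. 1 \<le> j \<and> j < Suc (sum_list \<mu>)}"
  using L(1) by (auto elim!: up_cases)

lemma up_partition: "la \<in> L \<Longrightarrow> is_partition la" "la \<in> L \<Longrightarrow> la \<in> up \<mu>"
  using L(1) by (auto elim!: up_cases)

lemma ip_Phi:
  "ip (Tab_set L) (Phi k v) (Phi l w) = (\<Sum>la\<in>L. real (dimn la) / real (dim_set L) *
     ip (Tab la) (word_op la (rep_word k) (Psi la \<mu> v)) (word_op la (rep_word l) (Psi la \<mu> w)))"
proof -
  have "ip (Tab_set L) (Phi k v) (Phi l w) = (\<Sum>la\<in>L. \<Sum>T\<in>Tab la. Phi k v (la, T) * Phi l w (la, T))"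
    unfolding ip_def Tab_set_def using finite_L finite_Tab by (subst sum.Sigma) auto
  also have "\<dots> = (\<Sum>la\<in>L. real (dimn la) / real (dim_set L) *
     ip (Tab la) (word_op la (rep_word k) (Psi la \<mu> v)) (word_op la (rep_word l) (Psi la \<mu> w)))"
  proof (rule sum.cong[OF refl])
    fix la assume la: "la \<in> L"
    define c where "c = sqrt (real (dimn la) / real (dim_set L))"
    have c: "c * c = real (dimn la) / real (dim_set L)" by (simp add: c_def)
    show "(\<Sum>T\<in>Tab la. Phi k v (la, T) * Phi l w (la, T)) = real (dimn la) / real (dim_set L) *
     ip (Tab la) (word_op la (rep_word k) (Psi la \<mu> v)) (word_op la (rep_word l) (Psi la \<mu> w))"
      unfolding c[symmetric] ip_def sum_distrib_left
      by (rule sum.cong) (use la in \<open>simp_all add: Phi_apply c_def[symmetric] mult_ac\<close>)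
  qed
  finally show ?thesis .
qed

text \<open>Each summand is an isometry up to its weight, and the weights d_\<lambda> / d_L add up
  to 1.\<close>

lemma Phi_isometry:
  assumes k: "k \<in> {1..Suc (sum_list \<mu>)}"
  shows "isometry (Tab \<mu>) (Tab_set L) (Phi k)"
  unfolding isometry_def lin_map_def
proof (intro conjI ballI allI)
  fix v assume v: "v \<in> hspace (Tab \<mu>)"
  show "Phi k v \<in> hspace (Tab_set L)"
    unfolding hspace_def mem_Collect_eq
  proof (intro allI impI)
    fix x assume "x \<notin> Tab_set L"
    moreover obtain la T where x: "x = (la, T)" by (cases x)
    ultimately have n: "(la, T) \<notin> Sigma L Tab" by (simp add: Tab_set_def)
    have "word_op la (rep_word k) (Psi la \<mu> v) \<in> hspace (Tab la)" if "la \<in> L"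
      using word_op_hspace[OF up_partition(1)[OF that]] rep_word(1)[OF k] letters_up[OF that]
        Psi_hspace[OF \<mu> up_partition(2)[OF that] v] by blast
    then show "Phi k v x = 0" using n by (auto simp: x Phi_apply hspace_def)
  qed
next
  fix v w assume "v \<in> hspace (Tab \<mu>)" "w \<in> hspace (Tab \<mu>)"
  show "Phi k (\<lambda>x. v x + w x) = (\<lambda>y. Phi k v y + Phi k w y)"
    by (auto simp: fun_eq_iff Phi_apply Psi_add word_op_add distrib_left)
next
  fix c v assume "v \<in> hspace (Tab \<mu>)"
  show "Phi k (\<lambda>x. c * v x) = (\<lambda>y. c * Phi k v y)"
    by (auto simp: fun_eq_iff Phi_apply Psi_scale word_op_scale)
next
  fix v w assume vw: "v \<in> hspace (Tab \<mu>)" "w \<in> hspace (Tab \<mu>)"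
  have "ip (Tab_set L) (Phi k v) (Phi k w) = (\<Sum>la\<in>L. real (dimn la) / real (dim_set L) * ip (Tab \<mu>) v w)"
    unfolding ip_Phi
  proof (rule sum.cong[OF refl])
    fix la assume la: "la \<in> L"
    note u = up_partition[OF la]
    have "ip (Tab la) (word_op la (rep_word k) (Psi la \<mu> v)) (word_op la (rep_word k) (Psi la \<mu> w))
        = ip (Tab la) (Psi la \<mu> v) (Psi la \<mu> w)"
      using rep_word(1)[OF k] letters_up[OF la] Psi_hspace[OF \<mu> u(2) vw(2)]
      by (intro word_op_isometry[OF u(1)]) auto
    then show "real (dimn la) / real (dim_set L) *
        ip (Tab la) (word_op la (rep_word k) (Psi la \<mu> v)) (word_op la (rep_word k) (Psi la \<mu> w))
      = real (dimn la) / real (dim_set L) * ip (Tab \<mu>) v w"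
      using Psi_isometry[OF \<mu> u(2) vw] by simp
  qed
  also have "\<dots> = real (dim_set L) / real (dim_set L) * ip (Tab \<mu>) v w"
    by (simp only: dim_set_def of_nat_sum flip: sum_distrib_right sum_divide_distrib)
  also have "\<dots> = ip (Tab \<mu>) v w" using dim_set_pos by simp
  finally show "ip (Tab_set L) (Phi k v) (Phi k w) = ip (Tab \<mu>) v w" .
qed

lemma Phi_image: "Phi k ` hspace (Tab \<mu>) = W_fam t \<mu> L k"
  by (auto simp: W_fam_def W_sub_def Phi_def)

definition eigen :: "box \<Rightarrow> real" where
  "eigen r = (\<Sum>la\<in>L. real (dimn la) / real (dim_set L) * (1 / real_of_int (axial (added_box la \<mu>) r)))"

text \<open>The word for t_k^{-1} t_l is reduced to one occurrence of the top letter. The outer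
  parts \<open>a\<close> and \<open>b\<close> avoid that letter, so they pass through
  \<open>Psi\<close> and act orthogonally on \<open>hspace (Tab \<mu>)\<close>, the same way for
  every shape in \<open>L\<close>.\<close>

lemma adj_Phi:
  assumes k: "k \<in> {1..Suc (sum_list \<mu>)}" and l: "l \<in> {1..Suc (sum_list \<mu>)}" and kl: "k \<noteq> l"
  shows "\<exists>a b. set a \<subseteq> letters \<mu> \<and> set b \<subseteq> letters \<mu> \<and>
    (\<forall>v\<in>hspace (Tab \<mu>). adj (Tab \<mu>) (Tab_set L) (Phi k) (Phi l v)
       = word_op \<mu> a (\<lambda>R. eigen (box_of \<mu> R (sum_list \<mu>)) * word_op \<mu> b v R))"
proof -
  let ?m = "sum_list \<mu>"
  define w where "w = rev (rep_word k) @ rep_word l"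
  have sw: "set w \<subseteq> {1..?m}" using rep_word(1)[OF k] rep_word(1)[OF l] by (auto simp: w_def)
  from coxeter_red_one_top[OF sw] obtain w' where w': "coxeter_red w w'"
    and or: "set w' \<subseteq> {1..<?m} \<or> (\<exists>a b. w' = a @ [?m] @ b \<and> set a \<subseteq> {1..<?m} \<and> set b \<subseteq> {1..<?m})" by blast
  \<comment> \<open>Distinct cosets: the permutation moves the last point because \<open>k\<close>
    and \<open>l\<close> differ. Hence the reduced word must contain the top letter.\<close>
  have "word_perm w (Suc ?m) \<noteq> Suc ?m"
  proof
    assume "word_perm w (Suc ?m) = Suc ?m"
    moreover have "t k (Suc ?m) = k" "t l (Suc ?m) = l" using t k l by (auto simp: coset_reps_def)
    ultimately have "word_perm (rev (rep_word k)) l = Suc ?m"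
      by (simp add: w_def word_perm_append rep_word[OF l])
    then have "l = word_perm (rep_word k) (Suc ?m)"
      using word_perm_rev[of "rev (rep_word k)" l] by simp
    then show False using kl \<open>t k (Suc ?m) = k\<close> by (simp add: rep_word[OF k])
  qed
  moreover have "word_perm w' (Suc ?m) = Suc ?m" if "set w' \<subseteq> {1..<?m}"
    using permutes_not_in[OF word_perm_permutes[of w' ?m], of "Suc ?m"] that by force
  ultimately obtain a b where w'_eq: "w' = a @ [?m] @ b" and "set a \<subseteq> {1..<?m}" "set b \<subseteq> {1..<?m}"
    using or word_perm_red[OF w'] by metis
  then have a: "set a \<subseteq> letters \<mu>" and b: "set b \<subseteq> letters \<mu>" by auto
  have gram: "ip (Tab_set L) (Phi k v) (Phi l u)
      = ip (Tab \<mu>) v (word_op \<mu> a (\<lambda>R. eigen (box_of \<mu> R ?m) * word_op \<mu> b u R))"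
    if v: "v \<in> hspace (Tab \<mu>)" and u: "u \<in> hspace (Tab \<mu>)" for v u
  proof -
    \<comment> \<open>The factors \<open>a\<close> and \<open>b\<close> are absorbed into the two
      vectors, so that only the top generator remains between images of \<open>Psi\<close>.\<close>
    define x y where "x = word_op \<mu> (rev a) v" and "y = word_op \<mu> b u"
    have x: "x \<in> hspace (Tab \<mu>)" and y: "y \<in> hspace (Tab \<mu>)"
      unfolding x_def y_def using a b u v by (auto intro!: word_op_hspace[OF \<mu>])
    have "ip (Tab la) (word_op la (rep_word k) (Psi la \<mu> v)) (word_op la (rep_word l) (Psi la \<mu> u))
        = (\<Sum>R\<in>Tab \<mu>. x R * (y R / real_of_int (axial (added_box la \<mu>) (box_of \<mu> R ?m))))"
      if la: "la \<in> L" for la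
    proof -
      note la' = up_partition[OF la]
      have al: "set a \<subseteq> letters la" using a letters_up[OF la] by auto
      have wl: "set w \<subseteq> letters la" using sw letters_up[OF la] by auto
      note hu = Psi_hspace[OF \<mu> la'(2) u] and hv = Psi_hspace[OF \<mu> la'(2) v]
      have "ip (Tab la) (word_op la (rep_word k) (Psi la \<mu> v)) (word_op la (rep_word l) (Psi la \<mu> u))
          = ip (Tab la) (Psi la \<mu> v) (word_op la w (Psi la \<mu> u))"
        using rep_word(1)[OF k] letters_up[OF la]
        by (subst word_op_adjoint[OF la'(1)]) (auto simp: w_def word_op_append)
      also have "word_op la w (Psi la \<mu> u) = word_op la w' (Psi la \<mu> u)"
        by (rule word_op_red[OF la'(1) hu w' wl])
      also have "\<dots> = word_op la a (young_gen la ?m (Psi la \<mu> y))"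
        by (simp add: w'_eq word_op_append word_op_Psi[OF \<mu> la'(2) b u] y_def)
      also have "ip (Tab la) (Psi la \<mu> v) (word_op la a (young_gen la ?m (Psi la \<mu> y)))
          = ip (Tab la) (word_op la (rev a) (Psi la \<mu> v)) (young_gen la ?m (Psi la \<mu> y))"
        using word_op_adjoint[OF la'(1), of "rev a"] al by simp
      also have "word_op la (rev a) (Psi la \<mu> v) = Psi la \<mu> x"
        unfolding x_def by (rule word_op_Psi[OF \<mu> la'(2) _ v]) (use a in auto)
      also have "ip (Tab la) (Psi la \<mu> x) (young_gen la ?m (Psi la \<mu> y))
          = (\<Sum>R\<in>Tab \<mu>. x R * (y R / real_of_int (axial (added_box la \<mu>) (box_of \<mu> R ?m))))"
        by (rule ip_Psi_top[OF \<mu> la'(2) pos x y])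
      finally show ?thesis .
    qed
    then have "ip (Tab_set L) (Phi k v) (Phi l u) = (\<Sum>la\<in>L. real (dimn la) / real (dim_set L) *
       (\<Sum>R\<in>Tab \<mu>. x R * (y R / real_of_int (axial (added_box la \<mu>) (box_of \<mu> R ?m)))))"
      unfolding ip_Phi by (intro sum.cong) auto
    also have "\<dots> = (\<Sum>R\<in>Tab \<mu>. \<Sum>la\<in>L. real (dimn la) / real (dim_set L) *
       (x R * (y R / real_of_int (axial (added_box la \<mu>) (box_of \<mu> R ?m)))))"
      unfolding sum_distrib_left by (rule sum.swap)
    also have "\<dots> = ip (Tab \<mu>) x (\<lambda>R. eigen (box_of \<mu> R ?m) * y R)"
      unfolding ip_def eigen_def sum_distrib_left sum_distrib_right
      by (intro sum.cong refl) (simp add: mult_ac)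
    also have "\<dots> = ip (Tab \<mu>) v (word_op \<mu> a (\<lambda>R. eigen (box_of \<mu> R ?m) * y R))"
      unfolding x_def using word_op_adjoint[OF \<mu>, of "rev a"] a by simp
    finally show ?thesis by (simp add: y_def)
  qed
  have "adj (Tab \<mu>) (Tab_set L) (Phi k) (Phi l u)
       = word_op \<mu> a (\<lambda>R. eigen (box_of \<mu> R ?m) * word_op \<mu> b u R)" if u: "u \<in> hspace (Tab \<mu>)" for u
  proof (rule hspace_eqI[of _ "Tab \<mu>"])
    show "adj (Tab \<mu>) (Tab_set L) (Phi k) (Phi l u) \<in> hspace (Tab \<mu>)" by (simp add: adj_def hspace_def)
    have "word_op \<mu> b u \<in> hspace (Tab \<mu>)" by (rule word_op_hspace[OF \<mu> b u])
    then have "(\<lambda>R. eigen (box_of \<mu> R ?m) * word_op \<mu> b u R) \<in> hspace (Tab \<mu>)" by (simp add: hspace_def)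
    then show "word_op \<mu> a (\<lambda>R. eigen (box_of \<mu> R ?m) * word_op \<mu> b u R) \<in> hspace (Tab \<mu>)"
      by (rule word_op_hspace[OF \<mu> a])
    fix x assume x: "x \<in> Tab \<mu>"
    then have bx: "bvec x \<in> hspace (Tab \<mu>)" by (auto simp: bvec_def hspace_def)
    show "adj (Tab \<mu>) (Tab_set L) (Phi k) (Phi l u) x
       = word_op \<mu> a (\<lambda>R. eigen (box_of \<mu> R ?m) * word_op \<mu> b u R) x"
      using gram[OF bx u] x by (simp add: adj_def ip_bvec[OF finite_Tab x])
  qed
  then show ?thesis using a b by blast
qed

end

lemma Tab_box_removable:
  assumes "is_partition \<mu>" "0 < sum_list \<mu>" "R \<in> Tab \<mu>"
  shows "box_of \<mu> R (sum_list \<mu>) \<in> removable \<mu>"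
proof -
  obtain i where i: "i \<in> removable_rows \<mu>" "R (Suc i, row \<mu> i) = sum_list \<mu>"
    using Tab_max_removable[OF assms(1,3,2)] by blast
  have "(Suc i, row \<mu> i) \<in> diagram \<mu>" using i(1) by (simp add: mem_diagram_Suc removable_rows_def)
  from box_of_eq[OF Tab_filling[OF assms(3)] this] i show ?thesis
    by (auto simp: removable_eq[OF assms(1)])
qed

text \<open>The shape with \<open>r\<close> deleted has a standard tableau since its dimension is
  positive, and the largest entry is then put into \<open>r\<close>. Every \<open>eigen r\<close>
  therefore occurs in the Gram operators.\<close>

lemma Tab_removable_box:
  assumes "is_partition \<mu>" "r \<in> removable \<mu>"
  shows "\<exists>R\<in>Tab \<mu>. box_of \<mu> R (sum_list \<mu>) = r"
proof -
  obtain i where i: "i \<in> removable_rows \<mu>" "r = (Suc i, row \<mu> i)"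
    using assms by (auto simp: removable_eq)
  note d = del_row[OF assms(1) i(1)]
  have r: "r = (Suc i, Suc (row (del_row \<mu> i) i))" using d(4) i(2) by (metis fun_upd_same)
  have "Tab (del_row \<mu> i) \<noteq> {}" using dimn_pos[OF d(2)] by (auto simp: dimn_def)
  then obtain R where "R \<in> Tab (del_row \<mu> i)" by blast
  with bij_betwE[OF bij_betw_Tab_extend[OF d(2,4) r]]
  have T: "R(r := sum_list \<mu>) \<in> Tab \<mu>" by blast
  have "r \<in> diagram \<mu>" using i by (simp add: mem_diagram_Suc removable_rows_def)
  from box_of_eq[OF Tab_filling[OF T] this] T show ?thesis by auto
qed

lemma lin_map_adj_comp:
  assumes G: "lin_map A B G"
  shows "lin_map A A (adj A B F \<circ> G)"
proof -
  have "adj A B F (\<lambda>x. v x + w x) = (\<lambda>y. adj A B F v y + adj A B F w y)" for v w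
    by (auto simp: adj_def ip_def fun_eq_iff algebra_simps sum.distrib)
  moreover have "adj A B F (\<lambda>x. c * v x) = (\<lambda>y. c * adj A B F v y)" for c v
    by (auto simp: adj_def ip_def fun_eq_iff sum_distrib_left mult_ac)
  moreover have "adj A B F v \<in> hspace A" for v by (simp add: adj_def hspace_def)
  ultimately show ?thesis using G by (simp add: lin_map_def)
qed

context branching
begin

text \<open>The squared Gram operator is conjugate, by the operator of \<open>b\<close>, to the
  diagonal operator with entries \<open>(eigen r)\<^sup>2\<close>. It is scalar exactly when all
  these entries agree.\<close>

lemma W_equi_isoclinic_iff:
  "W_equi_isoclinic t \<mu> L \<alpha> \<longleftrightarrow> (\<forall>r\<in>removable \<mu>. (eigen r)\<^sup>2 = \<alpha>)"
proof
  let ?A = "Tab \<mu>" and ?B = "Tab_set L" and ?m = "sum_list \<mu>"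
  assume "W_equi_isoclinic t \<mu> L \<alpha>"
  then obtain F where *: "(\<forall>k\<in>{1..Suc ?m}. isometry ?A ?B (F k) \<and> F k ` hspace ?A = W_fam t \<mu> L k) \<and>
      (\<forall>k\<in>{1..Suc ?m}. \<forall>l\<in>{1..Suc ?m}. k \<noteq> l \<longrightarrow> (\<forall>v\<in>hspace ?A.
        adj ?A ?A (adj ?A ?B (F k) \<circ> F l) ((adj ?A ?B (F k) \<circ> F l) v) = (\<lambda>x. \<alpha> * v x)))"
    unfolding W_equi_isoclinic_def equi_isoclinic_def Let_def Suc_eq_plus1[symmetric] by (elim exE)
  note F = bspec[OF conjunct1[OF *]]
  note Q = bspec[OF mp[OF bspec[OF bspec[OF conjunct2[OF *]]]]]
  show "\<forall>r\<in>removable \<mu>. (eigen r)\<^sup>2 = \<alpha>"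
  proof
    fix r assume "r \<in> removable \<mu>"
    then obtain R where R: "R \<in> ?A" "box_of \<mu> R ?m = r" using Tab_removable_box[OF \<mu>] by blast
    \<comment> \<open>A single pair of distinct members suffices in this direction; positivity of
      the size ensures that such a pair exists.\<close>
    have "1 \<noteq> Suc ?m" using pos by linarith
    then have kl: "1 \<in> {1..Suc ?m}" "Suc ?m \<in> {1..Suc ?m}" "1 \<noteq> Suc ?m" by simp_all
    from adj_Phi[OF kl] obtain a b where a: "set a \<subseteq> letters \<mu>" and b: "set b \<subseteq> letters \<mu>"
      and ad: "\<And>v. v \<in> hspace ?A \<Longrightarrow> adj ?A ?B (Phi 1) (Phi (Suc ?m) v)
       = word_op \<mu> a (\<lambda>R. eigen (box_of \<mu> R ?m) * word_op \<mu> b v R)" by blast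
    have e: "bvec R \<in> hspace ?A" using R by (auto simp: bvec_def hspace_def)
    \<comment> \<open>Chosen so that \<open>b\<close> carries it to the basis vector at
      \<open>R\<close>, on which the middle factor acts as the scalar
      \<open>eigen r\<close>.\<close>
    define v where "v = word_op \<mu> (rev b) (bvec R)"
    have v: "v \<in> hspace ?A" unfolding v_def using b by (intro word_op_hspace[OF \<mu> _ e]) auto
    have bv: "word_op \<mu> b v = bvec R"
      using word_op_rev[OF \<mu>, of "rev b" "bvec R"] b e by (simp add: v_def)
    have vv: "ip ?A v v = 1"
      unfolding v_def using word_op_isometry[OF \<mu>, of "rev b" "bvec R"] b e ip_bvec[OF finite_Tab R(1)]
      by (simp add: bvec_def)
    define w where "w = Phi (Suc ?m) v"
    \<comment> \<open>The same vector of the subspace is now written through the given isometry. Its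
      preimage \<open>u\<close> is again a unit vector, so the isoclinism condition can be evaluated
      at \<open>u\<close>.\<close>
    have "w \<in> F (Suc ?m) ` hspace ?A"
      using F[OF kl(2)] Phi_image[of "Suc ?m"] v by (auto simp: w_def)
    then obtain u where u: "u \<in> hspace ?A" "w = F (Suc ?m) u" by blast
    have uu: "ip ?A u u = 1"
    proof -
      have "ip ?A u u = ip ?B w w" using F[OF kl(2)] u by (simp add: isometry_def)
      also have "\<dots> = ip ?A v v" using Phi_isometry[OF kl(2)] v by (simp add: isometry_def w_def)
      finally show ?thesis using vv by simp
    qed
    let ?Q = "adj ?A ?B (F 1) \<circ> F (Suc ?m)"
    have lQ: "lin_map ?A ?A ?Q" using F[OF kl(2)] by (intro lin_map_adj_comp) (simp add: isometry_def)
    have "\<alpha> = ip ?A u (adj ?A ?A ?Q (?Q u))"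
      unfolding Q[OF kl u(1)] using uu by (simp add: ip_def mult_ac flip: sum_distrib_left)
    also have "\<dots> = ip ?A (?Q u) (?Q u)" by (rule ip_adj[OF finite_Tab lQ u(1), symmetric])
    also have "\<dots> = ip ?A (adj ?A ?B (F 1) w) (adj ?A ?B (F 1) w)" by (simp add: u)
    also have "\<dots> = ip ?A (adj ?A ?B (Phi 1) w) (adj ?A ?B (Phi 1) w)"
      by (rule isometry_adj_ip[OF finite_Tab]) (use F[OF kl(1)] Phi_isometry[OF kl(1)] Phi_image[of 1] in auto)
    also have "adj ?A ?B (Phi 1) w = word_op \<mu> a (\<lambda>S. eigen (box_of \<mu> S ?m) * bvec R S)"
      unfolding w_def ad[OF v] bv ..
    also have "(\<lambda>S. eigen (box_of \<mu> S ?m) * bvec R S) = (\<lambda>S. eigen r * bvec R S)"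
      using R(2) by (auto simp: bvec_def)
    also have "ip ?A (word_op \<mu> a (\<lambda>S. eigen r * bvec R S)) (word_op \<mu> a (\<lambda>S. eigen r * bvec R S))
      = ip ?A (\<lambda>S. eigen r * bvec R S) (\<lambda>S. eigen r * bvec R S)"
      by (rule word_op_isometry[OF \<mu> a]) (use e in \<open>auto simp: hspace_def\<close>)
    also have "\<dots> = (eigen r)\<^sup>2 * ip ?A (bvec R) (bvec R)"
      by (simp add: ip_def sum_distrib_left power2_eq_square mult_ac)
    also have "\<dots> = (eigen r)\<^sup>2" using ip_bvec[OF finite_Tab R(1)] by (simp add: bvec_def)
    finally show "(eigen r)\<^sup>2 = \<alpha>" by simp
  qed
next
  let ?A = "Tab \<mu>" and ?B = "Tab_set L" and ?m = "sum_list \<mu>"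
  assume eig: "\<forall>r\<in>removable \<mu>. (eigen r)\<^sup>2 = \<alpha>"
  have Q: "adj ?A ?A (adj ?A ?B (Phi k) \<circ> Phi l) ((adj ?A ?B (Phi k) \<circ> Phi l) v) = (\<lambda>x. \<alpha> * v x)"
    if k: "k \<in> {1..Suc ?m}" and l: "l \<in> {1..Suc ?m}" and kl: "k \<noteq> l" and v: "v \<in> hspace ?A" for k l v
  proof
    fix x
    let ?Q = "adj ?A ?B (Phi k) \<circ> Phi l"
    from adj_Phi[OF k l kl] obtain a b where a: "set a \<subseteq> letters \<mu>" and b: "set b \<subseteq> letters \<mu>"
      and ad: "\<And>v. v \<in> hspace ?A \<Longrightarrow> adj ?A ?B (Phi k) (Phi l v)
       = word_op \<mu> a (\<lambda>R. eigen (box_of \<mu> R ?m) * word_op \<mu> b v R)" by blast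
    show "adj ?A ?A ?Q (?Q v) x = \<alpha> * v x"
    proof (cases "x \<in> ?A")
      case True
      then have e: "bvec x \<in> hspace ?A" by (auto simp: bvec_def hspace_def)
      have hb: "word_op \<mu> b v \<in> hspace ?A" by (rule word_op_hspace[OF \<mu> b v])
      have "adj ?A ?A ?Q (?Q v) x = ip ?A (?Q (bvec x)) (?Q v)" using True by (simp add: adj_def)
      also have "\<dots> = ip ?A (\<lambda>R. eigen (box_of \<mu> R ?m) * word_op \<mu> b (bvec x) R)
          (\<lambda>R. eigen (box_of \<mu> R ?m) * word_op \<mu> b v R)"
        unfolding comp_apply ad[OF e] ad[OF v]
        by (rule word_op_isometry[OF \<mu> a]) (use hb in \<open>auto simp: hspace_def\<close>)
      also have "\<dots> = \<alpha> * ip ?A (word_op \<mu> b (bvec x)) (word_op \<mu> b v)"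
        unfolding ip_def sum_distrib_left
      proof (rule sum.cong[OF refl])
        fix R assume "R \<in> ?A"
        then have "\<alpha> = (eigen (box_of \<mu> R ?m))\<^sup>2" using eig Tab_box_removable[OF \<mu> pos] by auto
        then show "eigen (box_of \<mu> R ?m) * word_op \<mu> b (bvec x) R * (eigen (box_of \<mu> R ?m) * word_op \<mu> b v R)
          = \<alpha> * (word_op \<mu> b (bvec x) R * word_op \<mu> b v R)" by (simp add: power2_eq_square)
      qed
      also have "\<dots> = \<alpha> * v x" unfolding word_op_isometry[OF \<mu> b v] ip_bvec[OF finite_Tab True] ..
      finally show ?thesis .
    next
      case False
      then show ?thesis using v by (simp add: adj_def hspace_def)
    qed
  qed
  show "W_equi_isoclinic t \<mu> L \<alpha>"
    unfolding W_equi_isoclinic_def equi_isoclinic_def Let_def Suc_eq_plus1[symmetric]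
    by (intro exI[of _ Phi] conjI ballI impI Phi_isometry Phi_image Q)
qed

end

section \<open>Interlacing poles\<close>

definition cauchy_sum :: "(nat \<Rightarrow> real) \<Rightarrow> (nat \<Rightarrow> real) \<Rightarrow> nat set \<Rightarrow> real \<Rightarrow> real" where
  "cauchy_sum w x P z = (\<Sum>p\<in>P. w p / (x p - z))"

text \<open>Indices increase as positions decrease: \<open>y q\<close> lies between
  \<open>x (Suc q)\<close> and \<open>x q\<close>. The assumption \<open>total\<close> is the
  transition identity, by which passing to the complementary set of poles negates the value at each
  \<open>y q\<close>.\<close>

locale interlacing =
  fixes m :: nat and w x y :: "nat \<Rightarrow> real"
  assumes w: "\<And>p. p \<in> {1..Suc m} \<Longrightarrow> 0 < w p"
    and xy: "\<And>q. q \<in> {1..m} \<Longrightarrow> y q < x q" and yx: "\<And>q. q \<in> {1..m} \<Longrightarrow> x (Suc q) < y q"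
    and total: "\<And>q. q \<in> {1..m} \<Longrightarrow> cauchy_sum w x {1..Suc m} (y q) = 0"
begin

abbreviation g where "g \<equiv> cauchy_sum w x"

lemma x_antimono:
  assumes "1 \<le> p" "p \<le> q" "q \<le> Suc m"
  shows "x q \<le> x p"
  using assms(2,1,3)
proof (induction q rule: dec_induct)
  case (step q)
  then show ?case using xy[of q] yx[of q] by force
qed simp

lemma x_gt_y: "1 \<le> p \<Longrightarrow> p \<le> q \<Longrightarrow> q \<le> m \<Longrightarrow> y q < x p"
  using x_antimono[of p q] xy[of q] by force

lemma x_lt_y: "1 \<le> q \<Longrightarrow> q < p \<Longrightarrow> p \<le> Suc m \<Longrightarrow> x p < y q"
  using x_antimono[of "Suc q" p] yx[of q] by force

text \<open>The last hypothesis keeps the poles of \<open>P\<close> out of the closed interval from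
  \<open>u\<close> to \<open>v\<close>; there each term w / (x - z) increases in z because its
  weight is positive.\<close>

lemma g_mono:
  assumes "P \<subseteq> {1..Suc m}" "P \<noteq> {}" "u < v" "\<And>p. p \<in> P \<Longrightarrow> x p < u \<or> v < x p"
  shows "g P u < g P v"
  unfolding cauchy_sum_def
proof (rule sum_strict_mono)
  show "finite P" using assms(1) finite_subset by blast
  fix p assume p: "p \<in> P"
  have wp: "0 < w p" using w assms(1) p by blast
  have "inverse (x p - u) < inverse (x p - v)"
    using assms(4)[OF p] assms(3) less_imp_inverse_less[of "x p - v" "x p - u"]
      less_imp_inverse_less_neg[of "x p - v" "x p - u"] by auto
  then show "w p / (x p - u) < w p / (x p - v)" using wp by (simp add: divide_inverse)
qed fact

lemma g_pos:
  assumes "P \<subseteq> {1..Suc m}" "P \<noteq> {}" "\<And>p. p \<in> P \<Longrightarrow> v < x p"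
  shows "0 < g P v"
  unfolding cauchy_sum_def using assms w finite_subset[OF assms(1)] by (intro sum_pos) auto

lemma g_neg:
  assumes "P \<subseteq> {1..Suc m}" "P \<noteq> {}" "\<And>p. p \<in> P \<Longrightarrow> x p < v"
  shows "g P v < 0"
proof -
  have "0 < (\<Sum>p\<in>P. w p / (v - x p))"
    using assms w finite_subset[OF assms(1)] by (intro sum_pos) auto
  also have "\<dots> = - g P v"
    unfolding cauchy_sum_def sum_negf[symmetric] by (rule sum.cong) (auto simp: minus_divide_right)
  finally show ?thesis by simp
qed

lemma g_complement:
  assumes "P \<subseteq> {1..Suc m}" "q \<in> {1..m}"
  shows "g ({1..Suc m} - P) (y q) = - g P (y q)"
  using total[OF assms(2)] sum.subset_diff[OF assms(1), of "\<lambda>p. w p / (x p - y q)"]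
  by (simp add: cauchy_sum_def)

text \<open>Between two consecutive poles in \<open>P\<close> the function \<open>g P\<close> increases strictly, so it takes
  each of the values \<open>\<beta>\<close> and \<open>- \<beta>\<close> at most once there; to the left of all poles it is positive
  and to the right of them negative. If two neighbours \<open>r\<close>, \<open>Suc r\<close> were both missing from \<open>P\<close>,
  too many of the points \<open>y q\<close> would lie in one such interval.\<close>

lemma no_double_gap:
  assumes P: "P \<subseteq> {1..Suc m}" "P \<noteq> {}" and \<beta>: "0 \<le> \<beta>"
    and val: "\<And>q. q \<in> {1..m} \<Longrightarrow> g P (y q) = \<beta> \<or> g P (y q) = - \<beta>"
    and r: "r \<in> {1..m}" "r \<notin> P" "Suc r \<notin> P"
  shows False
proof -
  have gap: "p < r \<or> Suc r < p" if "p \<in> P" for p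
  proof -
    have "p \<noteq> r" "p \<noteq> Suc r" using r that by auto
    then show ?thesis by linarith
  qed
  have rng: "1 \<le> p" "p \<le> Suc m" if "p \<in> P" for p using P that by auto
  have ydec: "y (Suc q) < y q" if "1 \<le> q" "Suc q \<le> m" for q
    using x_lt_y[of q "Suc q"] x_gt_y[of "Suc q" "Suc q"] that by force
  \<comment> \<open>With the poles \<open>r\<close> and \<open>Suc r\<close> absent,
    \<open>y (Suc r)\<close>, \<open>y r\<close> and \<open>y (r - 1)\<close>, as far as they exist,
    lie in one interval free of poles. Three strictly ordered values cannot all belong to a set of
    two, which settles interior \<open>r\<close>.\<close>
  have up: "g P (y (Suc r)) < g P (y r)" if "Suc r \<le> m"
  proof (rule g_mono[OF P])
    show "y (Suc r) < y r" using ydec r that by simp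
    show "x p < y (Suc r) \<or> y r < x p" if "p \<in> P" for p
      using gap[OF that] rng[OF that] x_gt_y[of p r] x_lt_y[of "Suc r" p] r by auto
  qed
  have down: "g P (y r) < g P (y (r - 1))" if "2 \<le> r"
  proof (rule g_mono[OF P])
    show "y r < y (r - 1)" using ydec[of "r - 1"] r that by simp
    show "x p < y r \<or> y (r - 1) < x p" if "p \<in> P" for p
    proof (cases "p < r")
      case True
      then have "p \<le> r - 1" "r - 1 \<le> m" using r(1) by auto
      then show ?thesis using x_gt_y[OF rng(1)[OF that]] by blast
    next
      case False
      then show ?thesis using gap[OF that] rng[OF that] x_lt_y[of r p] r by simp
    qed
  qed
  have vr: "g P (y r) = \<beta> \<or> g P (y r) = - \<beta>" using val r by simp
  have v1: "Suc r \<le> m \<Longrightarrow> g P (y (Suc r)) = \<beta> \<or> g P (y (Suc r)) = - \<beta>" using val by simp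
  have v2: "g P (y (r - 1)) = \<beta> \<or> g P (y (r - 1)) = - \<beta>" if "2 \<le> r"
    by (rule val) (use that r in auto)
  show False
  proof (cases "Suc r \<le> m")
    case True
    note u = up[OF True]
    show False
    proof (cases "2 \<le> r")
      case True
      then show False using u down[OF True] vr v1[OF \<open>Suc r \<le> m\<close>] v2[OF True] by auto
    next
      case False
      then have r1: "r = 1" using r by simp
      \<comment> \<open>At the upper end all poles lie below \<open>y r\<close>, so its value is
        already the smaller one, -\<beta>, and nothing is left for \<open>y (Suc r)\<close>.\<close>
      have "g P (y r) < 0"
      proof (rule g_neg[OF P])
        fix p assume p: "p \<in> P"
        have "r < p" using gap[OF p] rng[OF p] r1 by linarith
        then show "x p < y r" using rng[OF p] r1 by (intro x_lt_y) auto
      qed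
      then show False using u vr v1[OF True] \<beta> by auto
    qed
  next
    case False
    then have rm: "r = m" using r by simp
    show False
    proof (cases "2 \<le> r")
      case True
      \<comment> \<open>At the lower end all poles lie above \<open>y r\<close>, so its value is
        already \<beta>, which leaves no larger value for \<open>y (r - 1)\<close>.\<close>
      have "0 < g P (y r)"
      proof (rule g_pos[OF P])
        fix p assume p: "p \<in> P"
        have "p \<le> r" using gap[OF p] rng[OF p] rm by linarith
        then show "y r < x p" using rng[OF p] rm by (intro x_gt_y) auto
      qed
      then show False using down[OF True] vr v2[OF True] \<beta> by auto
    next
      case False
      \<comment> \<open>Here r = m = 1, and both available poles would be missing from the nonempty
        set \<open>P\<close>.\<close>
      obtain p where p: "p \<in> P" using P(2) by blast
      show False using gap[OF p] rng[OF p] rm False by linarith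
    qed
  qed
qed

text \<open>Two neighbours contained in \<open>P\<close> form a double gap of the complement, where
  the values are only negated and hence still admissible.\<close>

lemma alternating:
  assumes P: "P \<subseteq> {1..Suc m}" "P \<noteq> {}" "P \<noteq> {1..Suc m}" and \<beta>: "0 \<le> \<beta>"
    and val: "\<And>q. q \<in> {1..m} \<Longrightarrow> g P (y q) = \<beta> \<or> g P (y q) = - \<beta>"
    and r: "r \<in> {1..m}"
  shows "Suc r \<in> P \<longleftrightarrow> r \<notin> P"
proof (rule ccontr)
  let ?N = "{1..Suc m} - P"
  assume "\<not> (Suc r \<in> P \<longleftrightarrow> r \<notin> P)"
  then consider "r \<notin> P" "Suc r \<notin> P" | "r \<notin> ?N" "Suc r \<notin> ?N" by blast
  then show False
  proof cases
    case 1
    then show False using no_double_gap[OF P(1,2) \<beta> val r] by blast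
  next
    case 2
    have "g ?N (y q) = \<beta> \<or> g ?N (y q) = - \<beta>" if "q \<in> {1..m}" for q
      using val[OF that] g_complement[OF P(1) that] by auto
    moreover have "?N \<noteq> {}" using P by auto
    ultimately show False using no_double_gap[OF _ _ \<beta>, of ?N r] r 2 by blast
  qed
qed

lemma alternating_parity:
  assumes P: "P \<subseteq> {1..Suc m}" "P \<noteq> {}" "P \<noteq> {1..Suc m}" and \<beta>: "0 \<le> \<beta>"
    and val: "\<And>q. q \<in> {1..m} \<Longrightarrow> g P (y q) = \<beta> \<or> g P (y q) = - \<beta>"
  shows "P = {p \<in> {1..Suc m}. even p} \<or> P = {p \<in> {1..Suc m}. odd p}"
proof -
  have *: "p \<in> P \<longleftrightarrow> (1 \<in> P) = odd p" if "1 \<le> p" "p \<le> Suc m" for p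
    using that
  proof (induction p rule: dec_induct)
    case (step p)
    then show ?case using alternating[OF P \<beta> val, of p] by auto
  qed simp
  have "p \<in> P \<longleftrightarrow> p \<in> {1..Suc m} \<and> (1 \<in> P) = odd p" for p
    using *[of p] P(1) by (cases "p \<in> {1..Suc m}") auto
  then obtain c where "\<And>p. p \<in> P \<longleftrightarrow> p \<in> {1..Suc m} \<and> c = odd p" by blast
  then show ?thesis by (cases c) (simp_all add: set_eq_iff)
qed

text \<open>Only the pole \<open>Suc r\<close> separates \<open>y (Suc r)\<close> from
  \<open>y r\<close>; if it is absent, the value at \<open>y (Suc r)\<close> is the smaller one,
  -\<beta>, and that at \<open>y r\<close> is \<beta>. At either end, where one of the two points is
  missing, all poles lie on one side and fix the sign.\<close>

lemma alternating_sign: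
  assumes P: "P \<subseteq> {1..Suc m}" "P \<noteq> {}" and \<beta>: "0 \<le> \<beta>"
    and val: "\<And>q. q \<in> {1..m} \<Longrightarrow> g P (y q) = \<beta> \<or> g P (y q) = - \<beta>"
    and alt: "\<And>r. r \<in> {1..m} \<Longrightarrow> Suc r \<in> P \<longleftrightarrow> r \<notin> P"
    and q: "q \<in> {1..m}"
  shows "g P (y q) = (if q \<in> P then \<beta> else - \<beta>)"
proof -
  have rng: "1 \<le> p" "p \<le> Suc m" if "p \<in> P" for p using P that by auto
  have incr: "g P (y (Suc r)) < g P (y r)" if r: "1 \<le> r" "Suc r \<le> m" "Suc r \<notin> P" for r
  proof (rule g_mono[OF P])
    show "y (Suc r) < y r" using x_lt_y[of r "Suc r"] x_gt_y[of "Suc r" "Suc r"] r by force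
    fix p assume p: "p \<in> P"
    then have "p \<noteq> Suc r" using r(3) by auto
    then have "p \<le> r \<or> Suc r < p" by linarith
    then show "x p < y (Suc r) \<or> y r < x p"
      using rng[OF p] x_gt_y[of p r] x_lt_y[of "Suc r" p] r by auto
  qed
  show ?thesis
  proof (cases "q \<in> P")
    case True
    then have n: "Suc q \<notin> P" using alt[OF q] by simp
    show ?thesis
    proof (cases "Suc q \<le> m")
      case True
      then show ?thesis using incr[of q] n q val[OF q] val[of "Suc q"] \<beta> \<open>q \<in> P\<close> by auto
    next
      case False
      then have qm: "q = m" using q by simp
      have "0 < g P (y q)"
      proof (rule g_pos[OF P])
        fix p assume p: "p \<in> P"
        then have "p \<noteq> Suc q" using n by auto
        then have "p \<le> q" using rng[OF p] qm by linarith
        then show "y q < x p" using x_gt_y[of p q] rng[OF p] qm by simp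
      qed
      then show ?thesis using val[OF q] \<beta> \<open>q \<in> P\<close> by auto
    qed
  next
    case False
    show ?thesis
    proof (cases "2 \<le> q")
      case True
      then obtain q' where q': "q = Suc q'" "1 \<le> q'" by (cases q) auto
      then have "g P (y q) < g P (y q')" "g P (y q') = \<beta> \<or> g P (y q') = - \<beta>"
        using incr[of q'] False q val[of q'] by auto
      then show ?thesis using val[OF q] \<beta> False by auto
    next
      case F2: False
      then have q1: "q = 1" using q by simp
      have "g P (y q) < 0"
      proof (rule g_neg[OF P])
        fix p assume p: "p \<in> P"
        then have "p \<noteq> q" using False by auto
        then have "q < p" using rng[OF p] q1 by linarith
        then show "x p < y q" using x_lt_y[of q p] rng[OF p] q1 by simp
      qed
      then show ?thesis using val[OF q] \<beta> False by auto
    qed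
  qed
qed

end

section \<open>Interlacing of removable and addable boxes, and the conclusion\<close>

lemma removable_between:
  assumes \<mu>: "is_partition \<mu>" and la: "la \<in> up \<mu>" "la' \<in> up \<mu>"
    and lt: "superdiag (added_box la' \<mu>) < superdiag (added_box la \<mu>)"
  shows "\<exists>r\<in>removable \<mu>. superdiag (added_box la' \<mu>) < superdiag r \<and> superdiag r < superdiag (added_box la \<mu>)"
proof -
  obtain i where i: "added_box la \<mu> = (Suc i, Suc (row \<mu> i))" using la(1) by (rule up_cases)
  obtain j where j: "added_box la' \<mu> = (Suc j, Suc (row \<mu> j))"
    "is_partition la'" "row la' = (row \<mu>)(j := Suc (row \<mu> j))" using la(2) by (rule up_cases)
  have ij: "i < j"
  proof (rule ccontr)
    assume "\<not> i < j"
    then show False using row_antimono[OF \<mu>, of j i] lt by (simp add: i j(1) superdiag_row)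
  qed
  have "row la' j \<le> row la' (j - 1)" by (rule row_antimono[OF j(2)]) simp
  then have rj: "row \<mu> j < row \<mu> (j - 1)" using ij by (auto simp: j(3) split: if_splits)
  \<comment> \<open>The box at the end of the row directly above the lower added box. That row is
    strictly longer than the next, which makes the box removable and puts it above the smaller
    superdiagonal.\<close>
  let ?r = "(j, row \<mu> (j - 1))"
  have "j - 1 \<in> removable_rows \<mu>" using rj ij by (simp add: removable_rows_def)
  then have "(Suc (j - 1), row \<mu> (j - 1)) \<in> removable \<mu>" by (simp add: removable_eq[OF \<mu>])
  then have "?r \<in> removable \<mu>" using ij by simp
  moreover have "row \<mu> (j - 1) \<le> row \<mu> i" by (rule row_antimono[OF \<mu>]) (use ij in simp)
  ultimately show ?thesis using rj ij
    by (intro bexI[of _ ?r]) (auto simp: i j(1) superdiag_def)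
qed

text \<open>Steps of size at least 1 bound \<open>h p\<close> below from the left end and above from
  the right end, and the two bounds meet at \<open>p\<close>.\<close>

lemma strict_mono_self_map:
  fixes h :: "nat \<Rightarrow> nat"
  assumes "\<And>p. p \<in> {1..m} \<Longrightarrow> h p \<in> {1..m}"
    and "\<And>p q. 1 \<le> p \<Longrightarrow> p < q \<Longrightarrow> q \<le> m \<Longrightarrow> h p < h q" and p: "p \<in> {1..m}"
  shows "h p = p"
proof -
  have step: "h p + d \<le> h (p + d)" if "1 \<le> p" "p + d \<le> m" for p d
    using that
  proof (induction d)
    case (Suc d)
    then show ?case using assms(2)[of "p + d" "Suc (p + d)"] by simp
  qed simp
  have "h 1 + (p - 1) \<le> h p" using step[of 1 "p - 1"] p by simp
  moreover have "1 \<le> h 1" using assms(1)[of 1] p by auto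
  moreover have "h p + (m - p) \<le> h m" using step[of p "m - p"] p by simp
  moreover have "h m \<le> m" using assms(1)[of m] p by auto
  ultimately show ?thesis using p by auto
qed

theorem theorem6p8:
  fixes n m :: nat
    and \<mu> :: "nat list"
    and t :: "nat \<Rightarrow> nat \<Rightarrow> nat"
    and k l :: "nat \<Rightarrow> nat"
    and lam :: "nat \<Rightarrow> nat list"
    and L :: "nat \<Rightarrow> nat list set"
  assumes "1 \<le> n"
    and "partition_of (n - 1) \<mu>"
    and "coset_reps n t"
    and "isoclinic t \<mu>"
    and "card (set \<mu>) = m"
    and "removable \<mu> = (\<lambda>q. (k q, l q)) ` {1..m}"
    and "\<And>p q. 1 \<le> p \<Longrightarrow> p < q \<Longrightarrow> q \<le> m \<Longrightarrow> int (l p) - int (k p) > int (l q) - int (k q)"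
    and "up \<mu> = lam ` {1..m + 1}"
    and "\<And>p q. 1 \<le> p \<Longrightarrow> p < q \<Longrightarrow> q \<le> m + 1
           \<Longrightarrow> superdiag (added_box (lam p) \<mu>) > superdiag (added_box (lam q) \<mu>)"
    and "L 0 = {lam p |p. p \<in> {1..m + 1} \<and> even p}"
    and "L 1 = {lam p |p. p \<in> {1..m + 1} \<and> odd p}"
  shows "{M. M \<noteq> {} \<and> M \<subset> up \<mu> \<and> (\<exists>\<alpha>. W_equi_isoclinic t \<mu> M \<alpha>)} = {L 0, L 1} \<and>
         L 0 \<noteq> L 1 \<and>
         (\<forall>\<delta>\<in>{0, 1}. \<forall>\<beta>\<ge>0.
           W_equi_isoclinic t \<mu> (L \<delta>)
             ((real n)\<^sup>2 * (real (dimn \<mu>))\<^sup>2 / (real (dim_set (L \<delta>)))\<^sup>2 * \<beta>\<^sup>2) \<longrightarrow>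
           (\<forall>q\<in>{1..m}.
             (\<Sum>la\<in>L \<delta>. real (dimn la) / (real n * real (dimn \<mu>)) *
                (1 / real_of_int (axial (added_box la \<mu>) (k q, l q)))) = (-1) ^ (q + \<delta>) * \<beta>))"
proof -
  have \<mu>: "is_partition \<mu>" and sum\<mu>: "sum_list \<mu> = n - 1"
    using partition_of_is_partition[OF assms(2)] by auto
  have n: "n = Suc (sum_list \<mu>)" using assms(1) sum\<mu> by simp
  define x where "x p = real_of_int (superdiag (added_box (lam p) \<mu>))" for p
  define y where "y q = real_of_int (superdiag (k q, l q))" for q
  define w where "w p = real (dimn (lam p)) / (real n * real (dimn \<mu>))" for p
  define I where "I = {1..Suc m}"
  have up_lam: "up \<mu> = lam ` I" using assms(8) by (simp add: I_def)
  have xdec: "x q < x p" if "1 \<le> p" "p < q" "q \<le> Suc m" for p q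
    using assms(9)[of p q] that by (simp add: x_def)
  have inj: "inj_on lam I"
  proof (rule inj_onI)
    fix p q assume "p \<in> I" "q \<in> I" "lam p = lam q"
    then show "p = q" using xdec[of p q] xdec[of q p]
      by (cases p q rule: linorder_cases) (auto simp: I_def x_def)
  qed
  have lam_up: "lam p \<in> up \<mu>" if "p \<in> I" for p using that up_lam by blast
  have lam_part: "is_partition (lam p)" if "p \<in> I" for p using lam_up[OF that] by (rule up_cases)
  have d\<mu>: "0 < real (dimn \<mu>)" using dimn_pos[OF \<mu>] by simp
  obtain M0 where M0: "M0 \<noteq> {}" "M0 \<subset> up \<mu>" "\<exists>\<alpha>. W_equi_isoclinic t \<mu> M0 \<alpha>"
    using assms(4) unfolding isoclinic_def by blast
  \<comment> \<open>For m = 0 there is a single shape above \<open>\<mu>\<close>, so no nonempty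
    proper subset could witness isoclinism.\<close>
  have m: "1 \<le> m"
  proof (rule ccontr)
    assume "\<not> 1 \<le> m"
    then have "I = {1}" by (auto simp: I_def)
    then have "up \<mu> = {lam 1}" using up_lam by simp
    then have "M0 \<subset> {lam 1}" using M0(2) by simp
    then show False using M0(1) by (simp add: psubset_eq subset_singleton_iff)
  qed
  have pos: "0 < sum_list \<mu>"
  proof (rule ccontr)
    assume "\<not> 0 < sum_list \<mu>"
    then have "set \<mu> = {}" using \<mu> by (cases \<mu>) (auto simp: is_partition_def partition_of_def)
    then show False using assms(5) m by simp
  qed
  have rem: "(k q, l q) \<in> removable \<mu>" if "q \<in> {1..m}" for q using that assms(6) by blast
  have between: "\<exists>q\<in>{1..m}. x (Suc p) < y q \<and> y q < x p" if p: "p \<in> {1..m}" for p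
  proof -
    have "superdiag (added_box (lam (Suc p)) \<mu>) < superdiag (added_box (lam p) \<mu>)"
      using assms(9)[of p "Suc p"] p by simp
    from removable_between[OF \<mu> lam_up lam_up this] p
    show ?thesis unfolding assms(6) by (auto simp: I_def x_def y_def)
  qed
  have ydec: "y q < y p" if "1 \<le> p" "p < q" "q \<le> m" for p q
    using assms(7)[OF that] by (simp add: y_def superdiag_def)
  \<comment> \<open>Each of the m gaps between consecutive added boxes contains a removable box.
    Choosing one index per gap gives a strictly increasing self-map of \<open>{1..m}\<close>, so the
    box in gap \<open>p\<close> is the p-th.\<close>
  have inter: "x (Suc p) < y p \<and> y p < x p" if p: "p \<in> {1..m}" for p
  proof -
    from between obtain h where h: "\<And>p. p \<in> {1..m} \<Longrightarrow> h p \<in> {1..m} \<and> x (Suc p) < y (h p) \<and> y (h p) < x p"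
      by metis
    have "h p = p"
    proof (rule strict_mono_self_map[of m h, OF _ _ p])
      show "h p \<in> {1..m}" if "p \<in> {1..m}" for p using h[OF that] by blast
      fix p q assume pq: "1 \<le> p" "p < q" "q \<le> m"
      then have hp: "h p \<in> {1..m}" "x (Suc p) < y (h p)" and hq: "h q \<in> {1..m}" "y (h q) < x q"
        using h[of p] h[of q] by auto
      have "x q \<le> x (Suc p)" using xdec[of "Suc p" q] pq by (cases "q = Suc p") auto
      then have "y (h q) < y (h p)" using hp hq by linarith
      then show "h p < h q" using ydec[of "h q" "h p"] hp(1) hq(1)
        by (cases "h p" "h q" rule: linorder_cases) auto
    qed
    then show ?thesis using h[OF p] by simp
  qed
  have sum_lam: "(\<Sum>la\<in>lam ` P. real (dimn la) / (real n * real (dimn \<mu>)) *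
      (1 / real_of_int (axial (added_box la \<mu>) (k q, l q)))) = cauchy_sum w x P (y q)" if "P \<subseteq> I" for P q
    unfolding cauchy_sum_def sum.reindex[OF inj_on_subset[OF inj that]]
    by (simp add: w_def x_def y_def axial_def)
  interpret interlacing m w x y
  proof
    show "0 < w p" if "p \<in> {1..Suc m}" for p
      using dimn_pos[OF lam_part] that d\<mu> n by (simp add: w_def I_def)
    show "y q < x q" "x (Suc q) < y q" if "q \<in> {1..m}" for q using inter[OF that] by auto
    show "cauchy_sum w x {1..Suc m} (y q) = 0" if q: "q \<in> {1..m}" for q
    proof -
      have "cauchy_sum w x I (y q) = (\<Sum>la\<in>up \<mu>. real (dimn la) / (real n * real (dimn \<mu>)) *
          (1 / real_of_int (axial (added_box la \<mu>) (k q, l q))))"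
        using sum_lam[of I q] up_lam by simp
      also have "\<dots> = (\<Sum>la\<in>up \<mu>. real (dimn la) / real_of_int (axial (added_box la \<mu>) (k q, l q)))
          / (real n * real (dimn \<mu>))"
        unfolding sum_divide_distrib by (intro sum.cong refl) simp
      also have "\<dots> = 0" unfolding transition_sum_zero[OF \<mu> rem[OF q]] by simp
      finally show ?thesis by (simp add: I_def)
    qed
  qed
  \<comment> \<open>Converts the weights of the claimed sum, with denominator n d_\<mu>, into those
    of \<open>eigen\<close>, with denominator d_L. Its square is the factor in front of \<beta>^2 in
    the isoclinism parameter.\<close>
  define C where "C P = real n * real (dimn \<mu>) / real (dim_set (lam ` P))" for P
  have W: "W_equi_isoclinic t \<mu> (lam ` P) \<alpha> \<longleftrightarrow> (\<forall>q\<in>{1..m}. (C P * g P (y q))\<^sup>2 = \<alpha>)"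
    and Cpos: "0 < C P" if P: "P \<subseteq> I" "P \<noteq> {}" for P \<alpha>
  proof -
    interpret branching \<mu> "lam ` P" t
      by unfold_locales (use \<mu> pos P up_lam assms(3) n in auto)
    show "0 < C P" using d\<mu> n dim_set_pos by (simp add: C_def)
    have "eigen (k q, l q) = C P * g P (y q)" for q
      unfolding eigen_def C_def sum_lam[OF P(1), symmetric] sum_distrib_left
      by (intro sum.cong refl) (use d\<mu> n in simp)
    then show "W_equi_isoclinic t \<mu> (lam ` P) \<alpha> \<longleftrightarrow> (\<forall>q\<in>{1..m}. (C P * g P (y q))\<^sup>2 = \<alpha>)"
      unfolding W_equi_isoclinic_iff assms(6) by simp
  qed
  have vals: "g P (y q) = \<beta> \<or> g P (y q) = - \<beta>"
    if "P \<subseteq> I" "P \<noteq> {}" "W_equi_isoclinic t \<mu> (lam ` P) ((C P)\<^sup>2 * \<beta>\<^sup>2)" "q \<in> {1..m}" for P \<beta> q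
  proof -
    have "(C P)\<^sup>2 * (g P (y q))\<^sup>2 = (C P)\<^sup>2 * \<beta>\<^sup>2"
      using bspec[OF iffD1[OF W[OF that(1,2)] that(3)] that(4)] by (simp only: power_mult_distrib)
    then have "(g P (y q))\<^sup>2 = \<beta>\<^sup>2" using Cpos[OF that(1,2)] by simp
    then show ?thesis by (simp add: power2_eq_iff)
  qed
  \<comment> \<open>Every isoclinism parameter is a square of an eigenvalue; the nonnegative \<beta>
    is read off at q = 1, which exists because \<open>1 \<le> m\<close>.\<close>
  have scaled: "\<exists>\<beta>\<ge>0. W_equi_isoclinic t \<mu> (lam ` P) ((C P)\<^sup>2 * \<beta>\<^sup>2)"
    if P: "P \<subseteq> I" "P \<noteq> {}" "\<exists>\<alpha>. W_equi_isoclinic t \<mu> (lam ` P) \<alpha>" for P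
  proof -
    from P obtain \<alpha> where \<alpha>: "\<And>q. q \<in> {1..m} \<Longrightarrow> (C P * g P (y q))\<^sup>2 = \<alpha>" using W by blast
    have "1 \<in> {1..m}" using m by simp
    from \<alpha>[OF this] have "\<alpha> = (C P)\<^sup>2 * \<bar>g P (y 1)\<bar>\<^sup>2" by (simp add: power_mult_distrib)
    then show ?thesis using \<alpha> W[OF P(1,2)] by (intro exI[of _ "\<bar>g P (y 1)\<bar>"]) auto
  qed
  define E where "E \<delta> = {p \<in> I. even (p + \<delta>)}" for \<delta> :: nat
  have L: "L 0 = lam ` E 0" "L 1 = lam ` E 1"
    unfolding assms(10,11) by (auto simp: E_def I_def)
  have E: "E \<delta> \<subseteq> I" "E \<delta> \<noteq> {}" "E \<delta> \<noteq> I" for \<delta>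
  proof -
    have "1 \<in> I" "2 \<in> I" using m by (auto simp: I_def)
    moreover have "1 \<in> E \<delta> \<longleftrightarrow> 2 \<notin> E \<delta>" using \<open>1 \<in> I\<close> \<open>2 \<in> I\<close> by (simp add: E_def)
    ultimately show "E \<delta> \<noteq> {}" "E \<delta> \<noteq> I" by auto
    show "E \<delta> \<subseteq> I" by (auto simp: E_def)
  qed
  have compl: "I - E 0 = E 1" "I - E 1 = E 0" by (auto simp: E_def)
  have parity: "P = E 0 \<or> P = E 1"
    if P: "P \<subseteq> I" "P \<noteq> {}" "P \<noteq> I" "\<exists>\<alpha>. W_equi_isoclinic t \<mu> (lam ` P) \<alpha>" for P
  proof -
    obtain \<beta> where "0 \<le> \<beta>" "W_equi_isoclinic t \<mu> (lam ` P) ((C P)\<^sup>2 * \<beta>\<^sup>2)"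
      using scaled[OF P(1,2,4)] by blast
    from alternating_parity[OF _ P(2) _ this(1) vals[OF P(1,2) this(2)]] P
    show ?thesis by (simp add: E_def I_def)
  qed
  \<comment> \<open>Complementation changes the sign of the sums and the normalizing constant, but
    not the common absolute value \<beta>.\<close>
  have compl_iso: "\<exists>\<alpha>. W_equi_isoclinic t \<mu> (lam ` (I - P)) \<alpha>"
    if P: "P \<subseteq> I" "P \<noteq> {}" "P \<noteq> I" "\<exists>\<alpha>. W_equi_isoclinic t \<mu> (lam ` P) \<alpha>" for P
  proof -
    obtain \<beta> where \<beta>: "W_equi_isoclinic t \<mu> (lam ` P) ((C P)\<^sup>2 * \<beta>\<^sup>2)"
      using scaled[OF P(1,2,4)] by blast
    have "(C (I - P) * g (I - P) (y q))\<^sup>2 = (C (I - P))\<^sup>2 * \<beta>\<^sup>2" if "q \<in> {1..m}" for q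
      using vals[OF P(1,2) \<beta> that] g_complement[of P q] P(1) that
      by (auto simp: I_def power_mult_distrib)
    moreover have "I - P \<subseteq> I" "I - P \<noteq> {}" using P by auto
    ultimately show ?thesis using W by blast
  qed
  have pull: "\<exists>P\<subseteq>I. P \<noteq> {} \<and> P \<noteq> I \<and> M = lam ` P" if "M \<noteq> {}" "M \<subset> up \<mu>" for M
    using that unfolding up_lam by (metis image_is_empty psubsetE subset_image_iff)
  \<comment> \<open>The given isoclinic set is one of the two parity classes, without telling which;
    its complement supplies the other.\<close>
  have iso: "\<exists>\<alpha>. W_equi_isoclinic t \<mu> (L \<delta>) \<alpha>" if "\<delta> \<in> {0, 1}" for \<delta>
  proof -
    obtain P where P: "P \<subseteq> I" "P \<noteq> {}" "P \<noteq> I" "M0 = lam ` P" using pull[OF M0(1,2)] by blast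
    have ex: "\<exists>\<alpha>. W_equi_isoclinic t \<mu> (lam ` P) \<alpha>" using M0(3) P(4) by simp
    from parity[OF P(1-3) ex] have "P = E 0 \<or> P = E 1" .
    then show ?thesis using ex compl_iso[OF P(1-3) ex] compl that L by auto
  qed
  have proper: "lam ` E \<delta> \<noteq> {} \<and> lam ` E \<delta> \<subset> up \<mu>" for \<delta>
    using E[of \<delta>] inj_on_image_eq_iff[OF inj, of "E \<delta>" I] unfolding up_lam by blast
  have main: "{M. M \<noteq> {} \<and> M \<subset> up \<mu> \<and> (\<exists>\<alpha>. W_equi_isoclinic t \<mu> M \<alpha>)} = {L 0, L 1}"
  proof (intro equalityI subsetI)
    fix M assume "M \<in> {M. M \<noteq> {} \<and> M \<subset> up \<mu> \<and> (\<exists>\<alpha>. W_equi_isoclinic t \<mu> M \<alpha>)}"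
    then have M: "M \<noteq> {}" "M \<subset> up \<mu>" "\<exists>\<alpha>. W_equi_isoclinic t \<mu> M \<alpha>" by auto
    obtain P where P: "P \<subseteq> I" "P \<noteq> {}" "P \<noteq> I" "M = lam ` P" using pull[OF M(1,2)] by blast
    show "M \<in> {L 0, L 1}" using parity[OF P(1-3)] M(3) P(4) L by auto
  next
    fix M assume "M \<in> {L 0, L 1}"
    then obtain \<delta> where \<delta>: "\<delta> \<in> {0, 1}" "M = L \<delta>" by auto
    then have "M = lam ` E \<delta>" using L by auto
    then show "M \<in> {M. M \<noteq> {} \<and> M \<subset> up \<mu> \<and> (\<exists>\<alpha>. W_equi_isoclinic t \<mu> M \<alpha>)}"
      using iso[OF \<delta>(1)] proper[of \<delta>] \<delta>(2) by simp
  qed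
  have ne: "L 0 \<noteq> L 1"
    unfolding L using inj_on_image_eq_iff[OF inj E(1) E(1), of 0 1] compl(1) E(2)[of 0] E(1)[of 0] by blast
  have sgn: "\<forall>q\<in>{1..m}. (\<Sum>la\<in>L \<delta>. real (dimn la) / (real n * real (dimn \<mu>)) *
      (1 / real_of_int (axial (added_box la \<mu>) (k q, l q)))) = (-1) ^ (q + \<delta>) * \<beta>"
    if \<delta>: "\<delta> \<in> {0, 1}" and \<beta>: "0 \<le> \<beta>" and iso: "W_equi_isoclinic t \<mu> (L \<delta>)
      ((real n)\<^sup>2 * (real (dimn \<mu>))\<^sup>2 / (real (dim_set (L \<delta>)))\<^sup>2 * \<beta>\<^sup>2)" for \<delta> \<beta>
  proof
    fix q assume q: "q \<in> {1..m}"
    have L\<delta>: "L \<delta> = lam ` E \<delta>" using \<delta> L by auto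
    have iso': "W_equi_isoclinic t \<mu> (lam ` E \<delta>) ((C (E \<delta>))\<^sup>2 * \<beta>\<^sup>2)"
      using iso by (simp add: L\<delta> C_def power_mult_distrib power_divide)
    have alt: "Suc r \<in> E \<delta> \<longleftrightarrow> r \<notin> E \<delta>" if "r \<in> {1..m}" for r using that by (auto simp: E_def I_def)
    have "g (E \<delta>) (y q) = (if q \<in> E \<delta> then \<beta> else - \<beta>)"
      by (rule alternating_sign[OF _ E(2) \<beta> vals[OF E(1,2) iso'] alt q]) (use E(1) in \<open>auto simp: I_def\<close>)
    \<comment> \<open>Membership of \<open>q\<close> in \<open>E \<delta>\<close> means that
      \<open>q + \<delta>\<close> is even, so the case distinction is precisely the stated
      sign.\<close>
    also have "\<dots> = (-1) ^ (q + \<delta>) * \<beta>" using q by (simp add: E_def I_def)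
    finally show "(\<Sum>la\<in>L \<delta>. real (dimn la) / (real n * real (dimn \<mu>)) *
      (1 / real_of_int (axial (added_box la \<mu>) (k q, l q)))) = (-1) ^ (q + \<delta>) * \<beta>"
      unfolding L\<delta> sum_lam[OF E(1)] .
  qed
  show ?thesis by (intro conjI ballI allI impI main ne sgn[THEN bspec])
qed

end
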